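(* Let $a,r,s\in\mathbb N$ and $k\in\mathbb Z$. (1) As formal power series in $q$, $$q^{-\frac{ra(a+1)}{2}}\mathcal A_{a,k,r}(q)=\prod_{n\ge1}\frac{1}{(1-q^{rn})(1-q^n)^k}+O\!\left(q^{a+1}\right),\qquad q^{-\frac{a(a+1)(r+2ar+3s)}{6}}\mathcal B_{a,k,r,s}(q)=\prod_{n\ge1}\frac{1}{(1-q^n)^k}+O\!\left(q^{a+1}\right).$$ (2) If $n\in\mathbb N_0$ with $n\le a$, then $$c_{a,k,r}\!\left(n+\frac{ra(a+1)}{2}\right)=\sum_{m=0}^{\lfloor n/r\rfloor}p(m)\sum_{\lambda\vdash (n-rm)}\ \prod_{h\in\mathcal H(\lambda)}\left(1+\frac{k-1}{h^2}\right).$$ (3) If $n\in\mathbb N_0$ with $n\le a$, then $$c_{a,k,1}\!\left(n+\frac{a(a+1)}{2}\right)=d_{a,k+1,r,s}\!\left(n+\frac{a(a+1)(r+2ar+3s)}{6}\right)=\sum_{\lambda\vdash n}\ \prod_{h\in\mathcal H(\lambda)}\left(1+\frac{k}{h^2}\right).$$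
   Context: For $a,r,s\in\mathbb N$ and $k\in\mathbb Z$ define the $q$-series $$\mathcal A_{a,k,r}(q):=\sum_{1\le n_1<\dots<n_a}\frac{q^{r(n_1+\dots+n_a)}}{(1-q^{n_1})^k\cdots(1-q^{n_a})^k}=:\sum_{n\ge0}c_{a,k,r}(n)q^n,$$ $$\mathcal B_{a,k,r,s}(q):=\sum_{1\le n_1<\dots<n_a}\frac{q^{r(n_1^2+\dots+n_a^2)+s(n_1+\dots+n_a)}}{(1-q^{n_1})^k\cdots(1-q^{n_a})^k}=:\sum_{n\ge0}d_{a,k,r,s}(n)q^n.$$ $p(m)$ is the number of partitions of $m$; $\lambda\vdash n$ means $\lambda$ is a partition of $n$. For a partition $\lambda$ with Young diagram having rows of lengths $\lambda_1\ge\lambda_2\ge\dots$, the hook length of the cell in row $j$, column $i$ is the number of cells consisting of that cell, the cells to its right in row $j$, and the cells below it in column $i$; $\mathcal H(\lambda)$ is the multiset of hook lengths of all cells of $\lambda$ (empty for the empty partition, whose product is $1$). $O(q^{a+1})$ denotes a power series all of whose exponents are at least $a+1$. *)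

theory Defs
  imports
    "HOL-Analysis.Analysis"
    "HOL-Computational_Algebra.Computational_Algebra"
    "HOL-Library.Multiset"
begin

section \<open>The \<open>q\<close>-series\<close>

text \<open>The tuples \<open>1 \<le> n\<^sub>1 < \<dots> < n\<^sub>a\<close> are represented as strictly increasing lists.\<close>

definition incr_tuples :: "nat \<Rightarrow> nat list set" where
  "incr_tuples a = {ns. length ns = a \<and> sorted_wrt (<) ns \<and> (\<forall>n\<in>set ns. 1 \<le> n)}"

text \<open>
  The infinite sums and products are taken in the library's topology on formal power
  series, in which convergence means that every coefficient is eventually constant.
  The values \<^const>\<open>infsum\<close> and \<^const>\<open>prodinf\<close> assign to divergent families play no
  role: see \<open>A_term_summable\<close>, \<open>B_term_summable\<close> and \<open>euler_factors_convergent\<close> below.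
\<close>

definition A_term :: "int \<Rightarrow> nat \<Rightarrow> nat list \<Rightarrow> rat fps" where
  "A_term k r ns = fps_X ^ (r * (\<Sum>n\<leftarrow>ns. n)) / (\<Prod>n\<leftarrow>ns. (1 - fps_X ^ n) powi k)"

definition A_series :: "nat \<Rightarrow> int \<Rightarrow> nat \<Rightarrow> rat fps" where
  "A_series a k r = (\<Sum>\<^sub>\<infinity>ns\<in>incr_tuples a. A_term k r ns)"

definition B_term :: "int \<Rightarrow> nat \<Rightarrow> nat \<Rightarrow> nat list \<Rightarrow> rat fps" where
  "B_term k r s ns =
     fps_X ^ (r * (\<Sum>n\<leftarrow>ns. n\<^sup>2) + s * (\<Sum>n\<leftarrow>ns. n)) / (\<Prod>n\<leftarrow>ns. (1 - fps_X ^ n) powi k)"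

definition B_series :: "nat \<Rightarrow> int \<Rightarrow> nat \<Rightarrow> nat \<Rightarrow> rat fps" where
  "B_series a k r s = (\<Sum>\<^sub>\<infinity>ns\<in>incr_tuples a. B_term k r s ns)"

definition c_coeff :: "nat \<Rightarrow> int \<Rightarrow> nat \<Rightarrow> nat \<Rightarrow> rat" where
  "c_coeff a k r n = fps_nth (A_series a k r) n"

definition d_coeff :: "nat \<Rightarrow> int \<Rightarrow> nat \<Rightarrow> nat \<Rightarrow> nat \<Rightarrow> rat" where
  "d_coeff a k r s n = fps_nth (B_series a k r s) n"

definition big_O_q :: "nat \<Rightarrow> rat fps set" where
  "big_O_q N = {E. \<forall>i<N. fps_nth E i = 0}"


section \<open>Partitions and hook lengths\<close>

text \<open>A partition is the weakly decreasing list of its (positive) parts.\<close>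

definition partitions_of :: "nat \<Rightarrow> nat list set" where
  "partitions_of n = {\<mu>. sorted_wrt (\<ge>) \<mu> \<and> (\<forall>x\<in>set \<mu>. 1 \<le> x) \<and> sum_list \<mu> = n}"

definition num_partitions :: "nat \<Rightarrow> nat" where
  "num_partitions n = card (partitions_of n)"

text \<open>Cells are pairs (row, column), both counted from \<open>0\<close>.\<close>

definition young_diagram :: "nat list \<Rightarrow> (nat \<times> nat) set" where
  "young_diagram \<mu> = {(j, i). j < length \<mu> \<and> i < \<mu> ! j}"

definition hook :: "nat list \<Rightarrow> nat \<times> nat \<Rightarrow> (nat \<times> nat) set" where
  "hook \<mu> = (\<lambda>(j, i). {(j', i') \<in> young_diagram \<mu>.
     (j', i') = (j, i) \<or> (j' = j \<and> i < i') \<or> (i' = i \<and> j < j')})"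

definition hook_length :: "nat list \<Rightarrow> nat \<times> nat \<Rightarrow> nat" where
  "hook_length \<mu> u = card (hook \<mu> u)"

definition hook_lengths :: "nat list \<Rightarrow> nat multiset" where
  "hook_lengths \<mu> = image_mset (hook_length \<mu>) (mset_set (young_diagram \<mu>))"


section \<open>Well-definedness\<close>

lemma finite_young_diagram: "finite (young_diagram \<mu>)"
proof -
  have "young_diagram \<mu> = (SIGMA j:{..<length \<mu>}. {..<\<mu> ! j})"
    by (auto simp: young_diagram_def)
  then show ?thesis by simp
qed

lemma finite_lists_bounded_sum:
  "finite {ns. length ns \<le> L \<and> sum_list ns \<le> (N::nat)}"
proof (rule finite_subset)
  show "{ns. length ns \<le> L \<and> sum_list ns \<le> N} \<subseteq> {ns. set ns \<subseteq> {..N} \<and> length ns \<le> L}"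
    using member_le_sum_list order_trans by fastforce
  show "finite {ns. set ns \<subseteq> {..N} \<and> length ns \<le> L}"
    by (rule finite_lists_length_le) simp
qed

lemma finite_partitions_of: "finite (partitions_of n)"
proof (rule finite_subset)
  have len: "length \<mu> \<le> sum_list \<mu>" if "\<forall>x\<in>set \<mu>. 1 \<le> x" for \<mu> :: "nat list"
    using that by (induction \<mu>) auto
  show "partitions_of n \<subseteq> {ns. length ns \<le> n \<and> sum_list ns \<le> n}"
    using len by (auto simp: partitions_of_def)
qed (rule finite_lists_bounded_sum)

lemma summable_on_fps_if_order_unbounded:
  fixes f :: "'a \<Rightarrow> rat fps"
  assumes fin: "\<And>N. finite {x\<in>S. e x \<le> (N::nat)}"
    and zero: "\<And>x n. x \<in> S \<Longrightarrow> n < e x \<Longrightarrow> fps_nth (f x) n = 0"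
  shows "f summable_on S"
proof -
  have "finite {x\<in>S. fps_nth (f x) n \<noteq> 0}" for n
    by (rule finite_subset[OF _ fin[of n]]) (use zero not_le in blast)
  then have "(f has_sum Abs_fps (\<lambda>n. \<Sum>x | x \<in> S \<and> fps_nth (f x) n \<noteq> 0. fps_nth (f x) n)) S"
    by (intro has_sum_fpsI) auto
  then show ?thesis
    unfolding summable_on_def by blast
qed

lemma factor_powi_nth_0:
  assumes "1 \<le> n"
  shows "fps_nth ((1 - fps_X ^ n :: rat fps) powi k) 0 = 1"
  using assms by (auto simp: power_int_def fps_power_zeroth zero_power)

lemma denominator_nth_0:
  assumes "\<forall>n\<in>set ns. 1 \<le> n"
  shows "fps_nth (\<Prod>n\<leftarrow>ns. (1 - fps_X ^ n :: rat fps) powi k) 0 = 1"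
  using assms by (induction ns) (auto simp: factor_powi_nth_0)

lemma X_power_divide_nth_eq_0:
  fixes D :: "rat fps"
  assumes "fps_nth D 0 = 1" "n < m"
  shows "fps_nth (fps_X ^ m / D) n = 0"
  using assms by (simp add: fps_divide_unit fps_X_power_mult_nth)

lemma A_term_summable:
  assumes "0 < r"
  shows "A_term k r summable_on incr_tuples a"
proof (rule summable_on_fps_if_order_unbounded[where e = "\<lambda>ns. r * (\<Sum>n\<leftarrow>ns. n)"])
  fix N
  have "sum_list ns \<le> N" if "r * sum_list ns \<le> N" for ns :: "nat list"
    using that assms by (cases r) auto
  then show "finite {ns \<in> incr_tuples a. r * (\<Sum>n\<leftarrow>ns. n) \<le> N}"
    by (intro finite_subset[OF _ finite_lists_bounded_sum[of a N]])
      (auto simp: incr_tuples_def)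
next
  fix ns n assume "ns \<in> incr_tuples a" "n < r * (\<Sum>n\<leftarrow>ns. n)"
  then show "fps_nth (A_term k r ns) n = 0"
    unfolding A_term_def by (intro X_power_divide_nth_eq_0 denominator_nth_0)
      (auto simp: incr_tuples_def)
qed

lemma B_term_summable:
  assumes "0 < s"
  shows "B_term k r s summable_on incr_tuples a"
proof (rule summable_on_fps_if_order_unbounded
    [where e = "\<lambda>ns. r * (\<Sum>n\<leftarrow>ns. n\<^sup>2) + s * (\<Sum>n\<leftarrow>ns. n)"])
  fix N
  have "sum_list ns \<le> N" if "r * (\<Sum>n\<leftarrow>ns. n\<^sup>2) + s * sum_list ns \<le> N" for ns :: "nat list"
    using that assms by (cases s) auto
  then show "finite {ns \<in> incr_tuples a. r * (\<Sum>n\<leftarrow>ns. n\<^sup>2) + s * (\<Sum>n\<leftarrow>ns. n) \<le> N}"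
    by (intro finite_subset[OF _ finite_lists_bounded_sum[of a N]])
      (auto simp: incr_tuples_def)
next
  fix ns n assume "ns \<in> incr_tuples a" "n < r * (\<Sum>n\<leftarrow>ns. n\<^sup>2) + s * (\<Sum>n\<leftarrow>ns. n)"
  then show "fps_nth (B_term k r s ns) n = 0"
    unfolding B_term_def by (intro X_power_divide_nth_eq_0 denominator_nth_0)
      (auto simp: incr_tuples_def)
qed

lemma convergent_prod_fps:
  fixes f :: "nat \<Rightarrow> rat fps"
  assumes one: "\<And>i. fps_nth (f i) 0 = 1"
    and zero: "\<And>i n. 0 < n \<Longrightarrow> n \<le> i \<Longrightarrow> fps_nth (f i) n = 0"
  shows "convergent_prod f"
proof -
  define P where "P = (\<lambda>m. \<Prod>i\<le>m. f i)"
  have step: "fps_nth (P (Suc m)) n = fps_nth (P m) n" if "n \<le> m" for m n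
  proof -
    have "fps_nth (P m * f (Suc m)) n = (\<Sum>i=0..n. fps_nth (P m) i * fps_nth (f (Suc m)) (n - i))"
      by (simp add: fps_mult_nth)
    also have "\<dots> = (\<Sum>i=0..n. if i = n then fps_nth (P m) i else 0)"
      by (intro sum.cong) (use that in \<open>auto simp: one intro!: zero\<close>)
    also have "\<dots> = fps_nth (P m) n" by simp
    finally show ?thesis by (simp add: P_def)
  qed
  have stable: "fps_nth (P m) n = fps_nth (P n) n" if "n \<le> m" for m n
    using that by (induction m rule: dec_induct) (auto simp: step)
  define L where "L = Abs_fps (\<lambda>n. fps_nth (P n) n)"
  have lim: "P \<longlonglongrightarrow> L"
    by (rule tendsto_fpsI) (auto simp: L_def eventually_sequentially intro: stable)
  have "fps_nth L 0 = 1"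
    by (simp add: L_def P_def one)
  then have "L \<noteq> 0" by auto
  with lim have "raw_has_prod f 0 L"
    by (simp add: raw_has_prod_def P_def)
  then show ?thesis
    unfolding convergent_prod_def by blast
qed

lemma one_mod_mult:
  assumes "fps_X ^ N dvd f - 1" "fps_X ^ N dvd g - (1 :: rat fps)"
  shows "fps_X ^ N dvd f * g - 1"
proof -
  have "f * g - 1 = f * (g - 1) + (f - 1)" by (simp add: algebra_simps)
  also have "fps_X ^ N dvd \<dots>" by (intro dvd_add dvd_mult assms)
  finally show ?thesis .
qed

lemma one_mod_nth:
  assumes "fps_X ^ N dvd f - (1 :: rat fps)" "n < N"
  shows "fps_nth f n = (if n = 0 then 1 else 0)"
proof -
  from assms obtain g where "f = 1 + fps_X ^ N * g"
    by (metis add.commute diff_add_cancel dvdE)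
  with assms(2) show ?thesis by (simp add: fps_X_power_mult_nth)
qed

lemma one_mod_inverse:
  assumes "fps_X ^ N dvd f - (1 :: rat fps)" "0 < N"
  shows "fps_X ^ N dvd inverse f - 1"
proof -
  have "fps_nth f 0 \<noteq> 0" using one_mod_nth[OF assms] by simp
  then have "inverse f - 1 = - inverse f * (f - 1)"
    by (simp add: right_diff_distrib inverse_mult_eq_1)
  also have "fps_X ^ N dvd \<dots>" by (intro dvd_mult assms)
  finally show ?thesis .
qed

lemma one_mod_power:
  "fps_X ^ N dvd f - (1 :: rat fps) \<Longrightarrow> fps_X ^ N dvd f ^ m - 1"
  by (induction m) (auto intro: one_mod_mult)

lemma one_mod_powi:
  "fps_X ^ N dvd f - (1 :: rat fps) \<Longrightarrow> 0 < N \<Longrightarrow> fps_X ^ N dvd f powi k - 1"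
  by (auto simp: power_int_def intro: one_mod_power one_mod_inverse)

lemma one_mod_one_divide:
  assumes "fps_X ^ N dvd f - (1 :: rat fps)" "0 < N"
  shows "fps_X ^ N dvd 1 / f - 1"
proof -
  have "fps_nth f 0 \<noteq> 0" using one_mod_nth[OF assms] by simp
  then show ?thesis using one_mod_inverse[OF assms] by (simp add: fps_divide_unit)
qed

lemma one_mod_factor:
  "N \<le> m \<Longrightarrow> fps_X ^ N dvd (1 - fps_X ^ m) - (1 :: rat fps)"
  by (simp add: le_imp_power_dvd)

lemma euler_factors_convergent:
  shows "convergent_prod (\<lambda>n. 1 / (1 - fps_X ^ Suc n :: rat fps) powi k)"
    and "0 < r \<Longrightarrow> convergent_prod
           (\<lambda>n. 1 / ((1 - fps_X ^ (r * Suc n)) * (1 - fps_X ^ Suc n :: rat fps) powi k))"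
proof -
  have conv: "convergent_prod f" if "\<And>i. fps_X ^ Suc i dvd f i - 1" for f :: "nat \<Rightarrow> rat fps"
    by (rule convergent_prod_fps) (use one_mod_nth[OF that] in auto)
  show "convergent_prod (\<lambda>n. 1 / (1 - fps_X ^ Suc n :: rat fps) powi k)"
    by (intro conv one_mod_one_divide one_mod_powi one_mod_factor) auto
  show "convergent_prod
          (\<lambda>n. 1 / ((1 - fps_X ^ (r * Suc n)) * (1 - fps_X ^ Suc n :: rat fps) powi k))"
    if "0 < r"
  proof (intro conv one_mod_one_divide one_mod_mult one_mod_powi one_mod_factor)
    show "Suc i \<le> r * Suc i" for i
      using that by (cases r) auto
  qed auto
qed

end

theory Submission
  imports Defs "Jordan_Normal_Form.Determinant"
begin

text \<open>
  The coefficients of both series stabilise because a tuple \<open>n\<^sub>1 < \<dots> < n\<^sub>a\<close> is a partition added to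
  \<open>1, \<dots>, a\<close>; the substance is the Nekrasov--Okounkov formula
  \<open>\<Sum>\<^sub>\<lambda> q\<^bsup>|\<lambda>|\<^esup> \<Prod>\<^sub>h (1 - z/h\<^sup>2) = \<Prod>\<^sub>n (1 - q\<^sup>n)\<^bsup>z-1\<^esup>\<close>.
  Coefficientwise it is polynomial in \<open>z\<close>, so \<open>z = t\<^sup>2\<close> with \<open>t\<close> a large natural number suffices.

  For such \<open>t\<close> let \<open>H\<close> count the ways to remove \<open>t\<close> horizontal strips from a partition and \<open>V\<close> the ways
  to remove \<open>t\<close> vertical strips, with sign. Adding horizontal strips and removing vertical strips
  commute up to a scalar factor, and moving one operator cyclically around the trace of
  \<open>q\<^bsup>|\<lambda>|\<^esup> \<Sum>\<^sub>\<nu> H(\<lambda>,\<nu>) V(\<lambda>,\<nu>)\<close> evaluates it as \<open>\<Prod>\<^sub>n (1 - q\<^sup>n)\<^bsup>t\<^sup>2-1\<^esup>\<close>.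
  On the other hand \<open>H\<close> and \<open>V\<close> are Toeplitz minors, so by Cauchy--Binet the diagonal entry at \<open>\<lambda>\<close> is a
  minor of an explicit kernel. This kernel is a rescaled Cauchy matrix, and Cauchy's determinant gives
  \<open>\<Prod>\<^sub>h (1 - t\<^sup>2/h\<^sup>2)\<close>.
\<close>

section \<open>Horizontal and vertical strips\<close>

text \<open>The trace is an infinite sum, so it is cut off modulo q^(n+1) and evaluated inside
  finite boxes \<open>pbox R C\<close>; the margins required of R and C reflect that a horizontal
  strip adds at most one row and a vertical strip at most one column. Horizontal strips carry a
  weight y per cell. One round of the cyclic move multiplies y by q and exchanges t horizontal with
  t vertical strips at the cost of (1 - y)^(t^2) for the new y; hence round j contributes (1 -
  q^j)^(t^2). As y tends to 0 only the trivial chains survive and the trace becomes the generating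
  function of partitions, the inverse of Euler's product: this is the -1 in the exponent t^2 - 1.
  The kernel satisfies (l - l' + t) K(l, l') = t A(l) B(l'), and t has to exceed all differences of
  the numbers l, both to solve this for K and to cancel a product over pairs of rows that must not
  vanish. Passing from z = t^2 to integers of either sign requires powers of power series whose
  coefficients are polynomials in the exponent.\<close>

text \<open>Partitions are modelled as weakly decreasing functions with finite support, rows counted from \<open>0\<close>.\<close>

definition part_size :: "(nat \<Rightarrow> nat) \<Rightarrow> nat" where
  "part_size f = (\<Sum>i | f i \<noteq> 0. f i)"

definition pbox :: "nat \<Rightarrow> nat \<Rightarrow> (nat \<Rightarrow> nat) set" where
  "pbox R C = {f. antimono f \<and> f 0 \<le> C \<and> (\<forall>i\<ge>R. f i = 0)}"

definition subparts :: "(nat \<Rightarrow> nat) \<Rightarrow> (nat \<Rightarrow> nat) set" where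
  "subparts f = {g. antimono g \<and> g \<le> f}"

definition hstrip :: "(nat \<Rightarrow> nat) \<Rightarrow> (nat \<Rightarrow> nat) \<Rightarrow> bool" where
  "hstrip f g \<longleftrightarrow> (\<forall>i. g i \<le> f i \<and> f (Suc i) \<le> g i)"

definition vstrip :: "(nat \<Rightarrow> nat) \<Rightarrow> (nat \<Rightarrow> nat) \<Rightarrow> bool" where
  "vstrip f g \<longleftrightarrow> (\<forall>i. g i \<le> f i \<and> f i \<le> g i + 1)"

text \<open>The ring is left open because y is a power of q in the trace identity and the number 1
  in the determinant evaluation.\<close>

definition hstep :: "'a::comm_ring_1 \<Rightarrow> (nat \<Rightarrow> nat) \<Rightarrow> (nat \<Rightarrow> nat) \<Rightarrow> 'a" where
  "hstep y f g = (if hstrip f g then y ^ (part_size f - part_size g) else 0)"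

definition vstep :: "'a::comm_ring_1 \<Rightarrow> (nat \<Rightarrow> nat) \<Rightarrow> (nat \<Rightarrow> nat) \<Rightarrow> 'a" where
  "vstep y f g = (if vstrip f g then y ^ (part_size f - part_size g) else 0)"

text \<open>The entry at (f, g) of the t-th power of the matrix s. Summing over
  \<open>subparts f\<close> keeps the sum finite, and strips removed from f lead only there.\<close>

primrec chain :: "((nat \<Rightarrow> nat) \<Rightarrow> (nat \<Rightarrow> nat) \<Rightarrow> 'a::comm_ring_1) \<Rightarrow> nat \<Rightarrow> (nat \<Rightarrow> nat) \<Rightarrow> (nat \<Rightarrow> nat) \<Rightarrow> 'a" where
  "chain s 0 f g = (if f = g then 1 else 0)"
| "chain s (Suc t) f g = (\<Sum>e\<in>subparts f. s f e * chain s t e g)"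

section \<open>Sizes, boxes and sums over independent rows\<close>

lemma part_size_eq:
  assumes "\<forall>i\<ge>R. f i = 0"
  shows "part_size f = (\<Sum>i<R. f i)"
proof -
  have "{i. f i \<noteq> 0} \<subseteq> {..<R}" by (rule subsetI) (metis assms lessThan_iff leI mem_Collect_eq)
  then show ?thesis unfolding part_size_def by (intro sum.mono_neutral_left) auto
qed

lemma pbox_zero: "f \<in> pbox R C \<Longrightarrow> R \<le> i \<Longrightarrow> f i = 0"
  by (auto simp: pbox_def)

lemma pbox_antimono: "f \<in> pbox R C \<Longrightarrow> antimono f"
  by (auto simp: pbox_def)

lemma pbox_le: "f \<in> pbox R C \<Longrightarrow> f i \<le> C"
  unfolding pbox_def using antimonoD[of f 0 i] by force

lemma part_size_pbox: "f \<in> pbox R C \<Longrightarrow> part_size f = (\<Sum>i<R. f i)"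
  by (rule part_size_eq) (auto simp: pbox_def)

lemma pbox_mono: "R \<le> R' \<Longrightarrow> C \<le> C' \<Longrightarrow> pbox R C \<subseteq> pbox R' C'"
  by (auto simp: pbox_def)

lemma finite_row_functions:
  fixes R :: nat
  assumes "\<And>i. i < R \<Longrightarrow> finite (G i)"
  shows "finite {f. (\<forall>i<R. f i \<in> G i) \<and> (\<forall>i\<ge>R. f i = (0::nat))}" (is "finite ?S")
proof -
  have "inj_on (\<lambda>f. restrict f {..<R}) ?S"
  proof (rule inj_onI)
    fix f g assume fg: "f \<in> ?S" "g \<in> ?S" "restrict f {..<R} = restrict g {..<R}"
    show "f = g"
    proof
      fix i show "f i = g i"
      proof (cases "i < R")
        case True
        then show ?thesis using fun_cong[OF fg(3), of i] by simp
      next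
        case False
        then have "R \<le> i" by simp
        then show ?thesis using fg(1,2) by auto
      qed
    qed
  qed
  moreover have "(\<lambda>f. restrict f {..<R}) ` ?S \<subseteq> Pi\<^sub>E {..<R} G"
    by (auto split: if_splits)
  moreover have "finite (Pi\<^sub>E {..<R} G)" using assms by (intro finite_PiE) auto
  ultimately show ?thesis using finite_subset finite_imageD by blast
qed

text \<open>What makes a sum over strips computable: with both neighbours fixed, the rows of the
  intermediate partition can be chosen independently of each other.\<close>

lemma sum_prod_row_functions:
  fixes F :: "nat \<Rightarrow> nat \<Rightarrow> 'a::comm_ring_1"
  assumes fin: "\<And>i. i < R \<Longrightarrow> finite (G i)"
  shows "(\<Sum>f | (\<forall>i<R. f i \<in> G i) \<and> (\<forall>i\<ge>R. f i = 0). \<Prod>i<R. F i (f i)) =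
         (\<Prod>i<R. \<Sum>g\<in>G i. F i g)"
proof -
  let ?S = "{f. (\<forall>i<R. f i \<in> G i) \<and> (\<forall>i\<ge>R. f i = (0::nat))}"
  have "(\<Prod>i<R. \<Sum>g\<in>G i. F i g) = (\<Sum>g\<in>Pi\<^sub>E {..<R} G. \<Prod>i<R. F i (g i))"
    using fin by (intro prod_sum_PiE) auto
  also have "\<dots> = (\<Sum>f\<in>?S. \<Prod>i<R. F i (f i))"
    by (rule sum.reindex_bij_witness[where i = "\<lambda>f. restrict f {..<R}"
          and j = "\<lambda>g i. if i < R then g i else 0"])
       (auto simp: fun_eq_iff PiE_def extensional_def Pi_def)
  finally show ?thesis by simp
qed

lemma finite_pbox: "finite (pbox R C)"
  by (rule finite_subset[OF _ finite_row_functions[of R "\<lambda>_. {..C}"]])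
     (auto intro: pbox_le pbox_zero)

lemma subpartsI_pbox: "f \<in> pbox R C \<Longrightarrow> subparts f \<subseteq> pbox R C"
  unfolding subparts_def pbox_def le_fun_def
  by (smt (verit) le_trans le_zero_eq mem_Collect_eq subsetI)

lemma finite_subparts: "f \<in> pbox R C \<Longrightarrow> finite (subparts f)"
  by (meson subpartsI_pbox finite_pbox finite_subset)

lemma subparts_trans: "g \<in> subparts f \<Longrightarrow> h \<in> subparts g \<Longrightarrow> h \<in> subparts f"
  by (auto simp: subparts_def)

lemma part_size_mono: "f \<in> pbox R C \<Longrightarrow> g \<in> subparts f \<Longrightarrow> part_size g \<le> part_size f"
  using subpartsI_pbox[of f R C] part_size_pbox[of f R C] part_size_pbox[of g R C]
  by (auto simp: subparts_def le_fun_def subset_iff intro!: sum_mono)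

lemma part_size_diff_eq:
  assumes "\<forall>i\<ge>R. f i = 0" "\<forall>i. g i \<le> f i"
  shows "part_size f - part_size g = (\<Sum>i<R. f i - g i)"
proof -
  have "\<forall>i\<ge>R. g i = 0" using assms by (metis le_zero_eq)
  then have "part_size g = (\<Sum>i<R. g i)" by (rule part_size_eq)
  then show ?thesis using part_size_eq[OF assms(1)] assms(2)
    by (simp add: sum_subtractf_nat)
qed

section \<open>Commutation of one horizontal and one vertical strip\<close>

text \<open>Compares the one-row sums on the two sides of the commutation relation. A row with
  \<open>p i\<close> carries a boundary factor tied to the bound above it on one side
  (\<open>s i\<close>) and to the bound below it on the other (\<open>s (Suc i)\<close>), so the
  factors are shifted by one row and only the two ends remain. A row without \<open>p\<close>
  carries no such factor, but there \<open>s i\<close> and \<open>s (Suc i)\<close> agree, so the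
  telescoping passes over it.\<close>

lemma strip_sum_telescope:
  fixes y :: "'a::comm_ring_1" and p s :: "nat \<Rightarrow> bool" and c :: "nat \<Rightarrow> 'a"
  assumes "s 0" and "\<And>i. \<not> p i \<Longrightarrow> s i \<and> s (Suc i)"
  shows "(\<Prod>i<m. if p i then c i * (1 - of_bool (s i) * y) else - 1) *
           (1 - of_bool (s m) * y) =
         (1 - y) * (\<Prod>i<m. if p i then c i * (1 - of_bool (s (Suc i)) * y) else - 1)"
proof (induction m)
  case 0 then show ?case using assms by simp
next
  case (Suc m)
  show ?case
  proof (cases "p m")
    case True
    have "(\<Prod>i<Suc m. if p i then c i * (1 - of_bool (s i) * y) else - 1) * (1 - of_bool (s (Suc m)) * y)
      = ((\<Prod>i<m. if p i then c i * (1 - of_bool (s i) * y) else - 1) * (1 - of_bool (s m) * y)) * (c m * (1 - of_bool (s (Suc m)) * y))"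
      using True by (simp add: mult_ac)
    also have "\<dots> = (1 - y) * (\<Prod>i<Suc m. if p i then c i * (1 - of_bool (s (Suc i)) * y) else - 1)"
      unfolding Suc.IH using True by (simp add: mult_ac)
    finally show ?thesis .
  next
    case False
    then have "s m" "s (Suc m)" using assms by auto
    with False Suc.IH show ?thesis by simp
  qed
qed

text \<open>Both sides vanish unless \<open>b (Suc i) \<le> a i\<close> and
  \<open>a i \<le> b i + 1\<close> for all i; otherwise the rows of g and of d are independent, and
  both sums are products of one-row sums with at most two terms. The factor 1 - y stems from the top
  row, which nothing above bounds, while below the last row there is no room. The box contains every
  relevant g, since it has at most one row more than a and one column more than b.\<close>

lemma strip_commutation:
  fixes y :: "'a::comm_ring_1"
  assumes a: "antimono a" "\<forall>i\<ge>R. a i = 0" and b: "antimono b" "b 0 < C" "\<exists>S. \<forall>i\<ge>S. b i = 0"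
  shows "(\<Sum>g\<in>pbox (Suc R) C. hstep y g a * vstep (- 1) g b) =
         (1 - y) * (\<Sum>d\<in>subparts a. hstep y b d * vstep (- 1) a d)"
proof (cases "(\<forall>i. b (Suc i) \<le> a i) \<and> (\<forall>i. a i \<le> b i + 1)")
  case False
  have "hstep y g a * vstep (- 1) g b = 0" for g
  proof (rule ccontr)
    assume "\<not> ?thesis"
    then have "hstrip g a" "vstrip g b" by (auto simp: hstep_def vstep_def split: if_splits)
    then have "b (Suc i) \<le> a i" "a i \<le> b i + 1" for i
      by (auto simp: hstrip_def vstrip_def dest: spec[of _ i] spec[of _ "Suc i"] intro: le_trans)
    with False show False by auto
  qed
  moreover have "hstep y b d * vstep (- 1) a d = 0" for d
  proof (rule ccontr)
    assume "\<not> ?thesis"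
    then have "hstrip b d" "vstrip a d" by (auto simp: hstep_def vstep_def split: if_splits)
    then have "b (Suc i) \<le> a i" "a i \<le> b i + 1" for i
    proof -
      show "b (Suc i) \<le> a i"
        using \<open>hstrip b d\<close> \<open>vstrip a d\<close> le_trans unfolding hstrip_def vstrip_def by blast
      show "a i \<le> b i + 1"
        using \<open>hstrip b d\<close> \<open>vstrip a d\<close> unfolding hstrip_def vstrip_def
        by (metis add_le_mono1 le_trans)
    qed
    with False show False by auto
  qed
  ultimately show ?thesis by simp
next
  case True
  then have ba: "\<And>i. b (Suc i) \<le> a i" and ab: "\<And>i. a i \<le> b i + 1" by auto
  define M where "M = Suc R"
  have bz: "\<forall>i\<ge>M. b i = 0" unfolding M_def using ba a(2)
    by (metis Suc_le_D le_zero_eq Suc_le_mono)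
  have az: "\<forall>i\<ge>M. a i = 0" using a(2) by (simp add: M_def)
  define p where "p i \<longleftrightarrow> a i \<le> b i" for i
  \<comment> \<open>\<open>s i\<close> says that row i - 1 of a leaves room for
    \<open>g i = b i + 1\<close>. One index later, \<open>s (Suc i)\<close> says that
    \<open>d i = a i - 1\<close> still dominates \<open>b (Suc i)\<close>; this coincidence is what
    makes the two sides comparable.\<close>
  define s where "s i \<longleftrightarrow> i = 0 \<or> b i < a (i - 1)" for i
  have as: "a (Suc i) \<le> a i" "b (Suc i) \<le> b i" for i
    using a b by (auto intro: antimonoD)
  have ps: "s i \<and> s (Suc i)" if "\<not> p i" for i
  proof
    show "s i" using that as[of "i - 1"] by (cases i) (auto simp: s_def p_def)
    show "s (Suc i)" using that as[of i] by (auto simp: s_def p_def)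
  qed
  let ?c = "\<lambda>i. y ^ (b i - a i)"
  define G where "G i = {g. (g = b i \<or> g = b i + 1) \<and> a i \<le> g \<and> (i = 0 \<or> g \<le> a (i - 1))}" for i
  define D where "D i = {d. (d = a i \<or> d + 1 = a i) \<and> b (Suc i) \<le> d \<and> d \<le> b i}" for i
  have finG: "finite (G i)" for i
    by (rule finite_subset[of _ "{b i, b i + 1}"]) (auto simp: G_def)
  have finD: "finite (D i)" for i
    by (rule finite_subset[of _ "{..a i}"]) (auto simp: D_def)
  \<comment> \<open>If \<open>a i = b i + 1\<close> the row is forced and contributes its weight 1
    with the sign of \<open>p i\<close> failing, namely -1; otherwise the admissible values b i and
    b i + 1 have opposite signs and weights that differ by a factor y.\<close>
  have sumG: "(\<Sum>g\<in>G i. y ^ (g - a i) * (- 1) ^ (g - b i)) =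
       (if p i then ?c i * (1 - of_bool (s i) * y) else - 1)" for i
  proof (cases "p i")
    case False
    then have "a i = b i + 1" "s i" using ab[of i] ps by (auto simp: p_def)
    then have "G i = {b i + 1}" by (cases i) (auto simp: G_def s_def)
    with False \<open>a i = b i + 1\<close> show ?thesis by simp
  next
    case True
    then have "G i = (if s i then {b i, b i + 1} else {b i})"
      using ba[of "i - 1"] by (cases i) (auto simp: G_def s_def p_def)
    with True show ?thesis by (simp add: p_def Suc_diff_le algebra_simps)
  qed
  have sumD: "(\<Sum>d\<in>D i. y ^ (b i - d) * (- 1) ^ (a i - d)) =
       (if p i then ?c i * (1 - of_bool (s (Suc i)) * y) else - 1)" for i
  proof (cases "p i")
    case False
    then have "a i = b i + 1" "s (Suc i)" using ab[of i] ps by (auto simp: p_def)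
    then have "D i = {b i}" using as[of i] by (auto simp: D_def s_def)
    with False \<open>a i = b i + 1\<close> show ?thesis by simp
  next
    case True
    show ?thesis
    proof (cases "s (Suc i)")
      case s: True
      then have "D i = {a i, a i - 1}" "0 < a i"
        using True ba[of i] by (auto simp: D_def s_def p_def)
      moreover have "b i - (a i - 1) = Suc (b i - a i)" "a i - (a i - 1) = 1"
        using True \<open>0 < a i\<close> by (auto simp: p_def)
      ultimately show ?thesis using True s by (simp add: algebra_simps)
    next
      case s: False
      then have "D i = {a i}"
        using True ba[of i] by (auto simp: D_def s_def p_def)
      then show ?thesis using True s by simp
    qed
  qed
  have L: "(\<Sum>g\<in>pbox M C. hstep y g a * vstep (- 1) g b) =
      (\<Prod>i<M. \<Sum>g\<in>G i. y ^ (g - a i) * (- 1) ^ (g - b i))"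
  proof -
    have "(\<Sum>g\<in>pbox M C. hstep y g a * vstep (- 1) g b) =
       (\<Sum>g | (\<forall>i<M. g i \<in> G i) \<and> (\<forall>i\<ge>M. g i = 0). hstep y g a * vstep (- 1) g b)"
    proof (rule sum.mono_neutral_right[OF finite_pbox], safe)
      fix g assume g: "\<forall>i<M. g i \<in> G i" "\<forall>i\<ge>M. g i = 0"
      have "g (Suc i) \<le> g i" for i
      proof (cases "Suc i < M")
        case True
        then have "g (Suc i) \<in> G (Suc i)" "g i \<in> G i" using g by auto
        then show ?thesis by (auto simp: G_def)
      qed (use g in auto)
      moreover have "g 0 \<le> C" using g(1)[rule_format, of 0] b(2) by (auto simp: G_def M_def)
      ultimately show "g \<in> pbox M C" using g by (auto simp: pbox_def antimono_iff_le_Suc)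
    next
      fix g i assume g: "g \<in> pbox M C" "hstep y g a * vstep (- 1) g b \<noteq> 0"
      then have hv: "hstrip g a" "vstrip g b" by (auto simp: hstep_def vstep_def split: if_splits)
      then show "g i \<in> G i"
        unfolding G_def hstrip_def vstrip_def
        by (cases i) (simp_all, metis le_Suc_eq le_antisym, metis le_Suc_eq le_antisym)
    qed (auto intro: pbox_zero)
    also have "\<dots> = (\<Sum>g | (\<forall>i<M. g i \<in> G i) \<and> (\<forall>i\<ge>M. g i = 0).
        \<Prod>i<M. y ^ (g i - a i) * (- 1) ^ (g i - b i))"
    proof (intro sum.cong refl, clarify)
      fix g assume g: "\<forall>i<M. g i \<in> G i" "\<forall>i\<ge>M. g i = 0"
      have G: "a i \<le> g i" "b i \<le> g i" "g i \<le> b i + 1" "g (Suc i) \<le> a i" for i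
      proof -
        show "a i \<le> g i" using g az by (cases "i < M") (auto simp: G_def)
        show "b i \<le> g i" using g bz by (cases "i < M") (auto simp: G_def)
        show "g i \<le> b i + 1" using g bz by (cases "i < M") (auto simp: G_def)
        show "g (Suc i) \<le> a i" using g by (cases "Suc i < M") (auto simp: G_def)
      qed
      then have hv: "hstrip g a" "vstrip g b" by (auto simp: hstrip_def vstrip_def)
      have "part_size g - part_size a = (\<Sum>i<M. g i - a i)" "part_size g - part_size b = (\<Sum>i<M. g i - b i)"
        using g G by (auto intro: part_size_diff_eq)
      with hv show "hstep y g a * vstep (- 1) g b = (\<Prod>i<M. y ^ (g i - a i) * (- 1) ^ (g i - b i))"
        by (simp add: hstep_def vstep_def prod.distrib power_sum)
    qed
    also have "\<dots> = (\<Prod>i<M. \<Sum>g\<in>G i. y ^ (g - a i) * (- 1) ^ (g - b i))"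
      by (rule sum_prod_row_functions) (rule finG)
    finally show ?thesis .
  qed
  have abox: "a \<in> pbox M (a 0)" using a az by (auto simp: pbox_def)
  have R: "(\<Sum>d\<in>subparts a. hstep y b d * vstep (- 1) a d) =
      (\<Prod>i<M. \<Sum>d\<in>D i. y ^ (b i - d) * (- 1) ^ (a i - d))"
  proof -
    have "(\<Sum>d\<in>subparts a. hstep y b d * vstep (- 1) a d) =
       (\<Sum>d | (\<forall>i<M. d i \<in> D i) \<and> (\<forall>i\<ge>M. d i = 0). hstep y b d * vstep (- 1) a d)"
    proof (rule sum.mono_neutral_right[OF finite_subparts[OF abox]], safe)
      fix d assume d: "\<forall>i<M. d i \<in> D i" "\<forall>i\<ge>M. d i = 0"
      have "d (Suc i) \<le> d i" for i
      proof (cases "Suc i < M")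
        case True
        then have "d (Suc i) \<in> D (Suc i)" "d i \<in> D i" using d by auto
        then show ?thesis by (auto simp: D_def)
      qed (use d in auto)
      moreover have "d i \<le> a i" for i
        using d by (cases "i < M") (auto simp: D_def)
      ultimately show "d \<in> subparts a" by (auto simp: subparts_def antimono_iff_le_Suc le_fun_def)
    next
      fix d i assume d: "d \<in> subparts a" "hstep y b d * vstep (- 1) a d \<noteq> 0"
      then have hv: "hstrip b d" "vstrip a d" by (auto simp: hstep_def vstep_def split: if_splits)
      then show "d i \<in> D i"
        unfolding D_def hstrip_def vstrip_def
        by (auto dest!: spec[of _ i] simp: le_Suc_eq)
    next
      fix d i assume "d \<in> subparts a" "M \<le> i"
      then show "d i = 0" using az by (auto simp: subparts_def le_fun_def) (metis le_zero_eq)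
    qed
    also have "\<dots> = (\<Sum>d | (\<forall>i<M. d i \<in> D i) \<and> (\<forall>i\<ge>M. d i = 0).
        \<Prod>i<M. y ^ (b i - d i) * (- 1) ^ (a i - d i))"
    proof (intro sum.cong refl, clarify)
      fix d assume d: "\<forall>i<M. d i \<in> D i" "\<forall>i\<ge>M. d i = 0"
      have G: "d i \<le> a i" "d i \<le> b i" "a i \<le> d i + 1" "b (Suc i) \<le> d i" for i
        using d az bz by (cases "i < M"; force simp: D_def)+
      then have hv: "hstrip b d" "vstrip a d" by (auto simp: hstrip_def vstrip_def)
      have "part_size b - part_size d = (\<Sum>i<M. b i - d i)" "part_size a - part_size d = (\<Sum>i<M. a i - d i)"
        using bz az G by (auto intro: part_size_diff_eq)
      with hv show "hstep y b d * vstep (- 1) a d = (\<Prod>i<M. y ^ (b i - d i) * (- 1) ^ (a i - d i))"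
        by (simp add: hstep_def vstep_def prod.distrib power_sum)
    qed
    also have "\<dots> = (\<Prod>i<M. \<Sum>d\<in>D i. y ^ (b i - d) * (- 1) ^ (a i - d))"
      by (rule sum_prod_row_functions) (rule finD)
    finally show ?thesis .
  qed
  \<comment> \<open>M is R + 1, so the bounding row a (M - 1) is already empty.\<close>
  have "\<not> s M" using a(2) by (simp add: s_def M_def)
  moreover have "s 0" by (simp add: s_def)
  ultimately show ?thesis
    using strip_sum_telescope[of s p ?c y M] ps L R unfolding sumG sumD by (simp add: M_def)
qed

section \<open>Chains of strips and their commutation\<close>

lemma subparts_refl: "antimono f \<Longrightarrow> f \<in> subparts f"
  by (simp add: subparts_def)

lemma finite_subparts': "antimono f \<Longrightarrow> \<forall>i\<ge>L. f i = 0 \<Longrightarrow> finite (subparts f)"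
  by (rule finite_subparts[of f L "f 0"]) (simp add: pbox_def)

lemma hstep_nonzero: "hstep y f g \<noteq> 0 \<Longrightarrow> hstrip f g"
  by (auto simp: hstep_def split: if_splits)

lemma vstep_nonzero: "vstep y f g \<noteq> 0 \<Longrightarrow> vstrip f g"
  by (auto simp: vstep_def split: if_splits)

lemma hstrip_le: "hstrip f g \<Longrightarrow> g \<le> f"
  by (auto simp: hstrip_def le_fun_def)

lemma vstrip_le: "vstrip f g \<Longrightarrow> g \<le> f"
  by (auto simp: vstrip_def le_fun_def)

lemma chain_Suc_nonzeroE:
  assumes "chain s (Suc t) f g \<noteq> 0"
  obtains e where "e \<in> subparts f" "s f e \<noteq> 0" "chain s t e g \<noteq> 0"
proof -
  have "\<exists>e\<in>subparts f. s f e * chain s t e g \<noteq> 0"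
  proof (rule ccontr)
    assume "\<not> ?thesis"
    then have "chain s (Suc t) f g = 0" by (simp add: sum.neutral)
    with assms show False by contradiction
  qed
  then show thesis using that mult_not_zero by blast
qed

lemma chain_nonzero_subparts:
  "chain s t f g \<noteq> 0 \<Longrightarrow> antimono f \<Longrightarrow> g \<in> subparts f"
proof (induction t arbitrary: f)
  case 0 then show ?case by (auto simp: subparts_refl split: if_splits)
next
  case (Suc t)
  then obtain e where "e \<in> subparts f" "chain s t e g \<noteq> 0"
    by (metis chain_Suc_nonzeroE)
  then have "g \<in> subparts e" using Suc.IH[of e] by (auto simp: subparts_def)
  with \<open>e \<in> subparts f\<close> show ?case using subparts_trans by blast
qed

text \<open>Each vertical strip lengthens a row by at most one cell. This determines the width of
  the box needed for the commutation.\<close>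

lemma chain_vstep_nonzero:
  "chain (vstep y) t f g \<noteq> 0 \<Longrightarrow> f i \<le> g i + t"
proof (induction t arbitrary: f)
  case 0 then show ?case by (auto split: if_splits)
next
  case (Suc t)
  then obtain e where "vstep y f e \<noteq> 0" "chain (vstep y) t e g \<noteq> 0"
    by (metis chain_Suc_nonzeroE)
  then have "vstrip f e" "e i \<le> g i + t" using Suc.IH[of e] vstep_nonzero[of y f e] by auto
  then show ?case unfolding vstrip_def by (auto dest!: spec[of _ i])
qed

text \<open>Interlacing shifts the row index by one for each strip. This determines the number of
  rows of the box.\<close>

lemma chain_hstep_nonzero:
  "chain (hstep y) t f g \<noteq> 0 \<Longrightarrow> f (i + t) \<le> g i"
proof (induction t arbitrary: f)
  case 0 then show ?case by (auto split: if_splits)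
next
  case (Suc t)
  then obtain e where "hstep y f e \<noteq> 0" "chain (hstep y) t e g \<noteq> 0"
    by (metis chain_Suc_nonzeroE)
  then have "hstrip f e" "e (i + t) \<le> g i" using Suc.IH[of e] hstep_nonzero[of y f e] by auto
  then show ?case unfolding hstrip_def by (metis add_Suc_right le_trans)
qed

text \<open>An index set that does not depend on f is what allows the order of summation to be
  exchanged in the commutation proofs.\<close>

lemma chain_Suc_superset:
  assumes "\<And>e. s f e \<noteq> 0 \<Longrightarrow> e \<le> f" "finite B" "subparts f \<subseteq> B" "B \<subseteq> Collect antimono"
  shows "chain s (Suc t) f g = (\<Sum>e\<in>B. s f e * chain s t e g)"
  unfolding chain.simps
proof (rule sum.mono_neutral_left[OF assms(2,3)], rule ballI)
  fix e assume e: "e \<in> B - subparts f"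
  then have "\<not> e \<le> f" using assms(4) by (auto simp: subparts_def)
  then have "s f e = 0" using assms(1) by blast
  then show "s f e * chain s t e g = 0" by simp
qed

lemma vstep_le: "vstep y f e \<noteq> 0 \<Longrightarrow> e \<le> f"
  using vstep_nonzero vstrip_le by blast

lemma hstep_le: "hstep y f e \<noteq> 0 \<Longrightarrow> e \<le> f"
  using hstep_nonzero hstrip_le by blast

lemma strip_commutation':
  fixes y :: "'a::comm_ring_1"
  assumes a: "antimono a" "\<forall>i\<ge>L. a i = 0" "L < R" and b: "antimono b" "b 0 < C" "\<forall>i\<ge>S. b i = 0"
  shows "(\<Sum>g\<in>pbox R C. hstep y g a * vstep (- 1) g b) =
         (1 - y) * (\<Sum>d\<in>subparts a. hstep y b d * vstep (- 1) a d)"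
proof -
  obtain R' where R: "R = Suc R'" using a(3) by (cases R) auto
  show ?thesis unfolding R
    using a R b by (intro strip_commutation) auto
qed

text \<open>Induction on t: the horizontal strip passes one vertical strip at a time, and each
  passage contributes 1 - y. The width C leaves room for t columns because the intermediate g may be
  wider than b by that much.\<close>

lemma strip_chain_commutation:
  fixes y :: "'a::comm_ring_1"
  assumes a: "antimono a" "\<forall>i\<ge>L. a i = 0" "L < R" and b: "antimono b" "b 0 + t \<le> C" "\<forall>i\<ge>S. b i = 0"
  shows "(\<Sum>g\<in>pbox R C. hstep y g a * chain (vstep (- 1)) t g b) =
         (1 - y) ^ t * (\<Sum>d\<in>subparts a. hstep y b d * chain (vstep (- 1)) t a d)"
  using a b
proof (induction t arbitrary: a)
  case 0
  have "hstep y b a = 0" if "b \<notin> pbox R C"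
  proof (rule ccontr)
    assume "hstep y b a \<noteq> 0"
    then have h: "hstrip b a" by (rule hstep_nonzero)
    have "b i = 0" if "i \<ge> R" for i
    proof -
      have "L \<le> i - 1" "i = Suc (i - 1)" using that 0 by auto
      then have "b i \<le> a (i - 1)" using h unfolding hstrip_def by metis
      with \<open>L \<le> i - 1\<close> show ?thesis using 0 by simp
    qed
    with that 0 show False by (auto simp: pbox_def)
  qed
  then have "(\<Sum>g\<in>pbox R C. hstep y g a * chain (vstep (- 1)) 0 g b) = hstep y b a"
    by (simp add: if_distrib[of "(*) _"] finite_pbox cong: if_cong)
  moreover have "(\<Sum>d\<in>subparts a. hstep y b d * chain (vstep (- 1)) 0 a d) = hstep y b a"
    using 0 by (simp add: if_distrib[of "(*) _"] finite_subparts' subparts_refl cong: if_cong)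
  ultimately show ?case by simp
next
  case (Suc t)
  let ?B = "pbox R C" and ?V = "chain (vstep (- 1) :: _ \<Rightarrow> _ \<Rightarrow> 'a)" and ?v = "vstep (- 1) :: _ \<Rightarrow> _ \<Rightarrow> 'a"
  have fa: "finite (subparts a)" using Suc.prems finite_subparts' by blast
  have "(\<Sum>g\<in>?B. hstep y g a * ?V (Suc t) g b) = (\<Sum>g\<in>?B. \<Sum>e\<in>?B. hstep y g a * (?v g e * ?V t e b))"
  proof (intro sum.cong refl)
    fix g assume g: "g \<in> ?B"
    have "?V (Suc t) g b = (\<Sum>e\<in>?B. ?v g e * ?V t e b)"
      using g by (intro chain_Suc_superset vstep_le) (auto simp: finite_pbox pbox_antimono dest: subpartsI_pbox)
    then show "hstep y g a * ?V (Suc t) g b = (\<Sum>e\<in>?B. hstep y g a * (?v g e * ?V t e b))"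
      by (simp only: sum_distrib_left)
  qed
  also have "\<dots> = (\<Sum>e\<in>?B. ?V t e b * (\<Sum>g\<in>?B. hstep y g a * ?v g e))"
    unfolding sum_distrib_left by (subst sum.swap) (simp add: mult_ac)
  also have "\<dots> = (\<Sum>e\<in>?B. ?V t e b * ((1 - y) * (\<Sum>d\<in>subparts a. hstep y e d * ?v a d)))"
  proof (intro sum.cong refl)
    fix e assume e: "e \<in> ?B"
    show "?V t e b * (\<Sum>g\<in>?B. hstep y g a * ?v g e) =
          ?V t e b * ((1 - y) * (\<Sum>d\<in>subparts a. hstep y e d * ?v a d))"
    proof (cases "?V t e b = 0")
      case False
      \<comment> \<open>The strict bound that a single passage needs: e is at most t columns wider
        than b, and the induction step provides room for t + 1.\<close>
      then have "e 0 < C" using chain_vstep_nonzero[OF False, of 0] Suc.prems by simp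
      then have "(\<Sum>g\<in>?B. hstep y g a * ?v g e) = (1 - y) * (\<Sum>d\<in>subparts a. hstep y e d * ?v a d)"
        using Suc.prems e by (intro strip_commutation'[of a L R e C R]) (auto simp: pbox_def)
      then show ?thesis by simp
    qed simp
  qed
  also have "\<dots> = (1 - y) * (\<Sum>d\<in>subparts a. ?v a d * (\<Sum>e\<in>?B. hstep y e d * ?V t e b))"
    unfolding sum_distrib_left by (subst sum.swap) (simp add: mult_ac)
  also have "(\<Sum>d\<in>subparts a. ?v a d * (\<Sum>e\<in>?B. hstep y e d * ?V t e b)) =
      (\<Sum>d\<in>subparts a. ?v a d * ((1 - y) ^ t * (\<Sum>d'\<in>subparts a. hstep y b d' * ?V t d d')))"
  proof (intro sum.cong refl)
    fix d assume d: "d \<in> subparts a"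
    then have d': "antimono d" "\<forall>i\<ge>L. d i = 0"
      using Suc.prems(2) by (auto simp: subparts_def le_fun_def) (metis le_zero_eq)
    have "(\<Sum>e\<in>?B. hstep y e d * ?V t e b) = (1 - y) ^ t * (\<Sum>d'\<in>subparts d. hstep y b d' * ?V t d d')"
      using Suc.prems d' by (intro Suc.IH) auto
    also have "(\<Sum>d'\<in>subparts d. hstep y b d' * ?V t d d') = (\<Sum>d'\<in>subparts a. hstep y b d' * ?V t d d')"
      using d d' fa subparts_trans chain_nonzero_subparts[of "?v" t d]
      by (intro sum.mono_neutral_left) (auto, metis mult_zero_right)
    finally show "?v a d * (\<Sum>e\<in>?B. hstep y e d * ?V t e b) =
       ?v a d * ((1 - y) ^ t * (\<Sum>d'\<in>subparts a. hstep y b d' * ?V t d d'))" by simp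
  qed
  also have "\<dots> = (1 - y) ^ t * (\<Sum>d'\<in>subparts a. hstep y b d' * ?V (Suc t) a d')"
    unfolding sum_distrib_left chain.simps by (subst sum.swap) (simp add: mult_ac)
  finally show ?case by (simp add: mult.assoc)
qed

text \<open>Induction on s, each time moving one horizontal strip past all t vertical ones, which
  makes s * t exchanges. Every horizontal strip may add a row, hence the s spare rows.\<close>

lemma chain_commutation:
  fixes y :: "'a::comm_ring_1"
  assumes a: "antimono a" "\<forall>i\<ge>L. a i = 0" "L + s \<le> R" and b: "antimono b" "b 0 + t \<le> C" "\<forall>i\<ge>S. b i = 0"
  shows "(\<Sum>g\<in>pbox R C. chain (hstep y) s g a * chain (vstep (- 1)) t g b) =
         (1 - y) ^ (s * t) * (\<Sum>d\<in>subparts a. chain (hstep y) s b d * chain (vstep (- 1)) t a d)"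
  using a b
proof (induction s arbitrary: b)
  case 0
  let ?V = "chain (vstep (- 1) :: _ \<Rightarrow> _ \<Rightarrow> 'a)"
  have "?V t a b = 0" if "a \<notin> pbox R C"
    using that 0 chain_vstep_nonzero[of "- 1" t a b 0] by (fastforce simp: pbox_def)
  then have "(\<Sum>g\<in>pbox R C. chain (hstep y) 0 g a * ?V t g b) = ?V t a b"
    by (simp add: if_distrib[of "\<lambda>x. x * _"] finite_pbox cong: if_cong)
  moreover have "?V t a b = 0" if "b \<notin> subparts a"
    using that 0 chain_nonzero_subparts by blast
  then have "(\<Sum>d\<in>subparts a. chain (hstep y) 0 b d * ?V t a d) = ?V t a b"
    using 0 by (simp add: if_distrib[of "\<lambda>x. x * _"] finite_subparts' cong: if_cong)
  ultimately show ?case by simp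
next
  case (Suc s)
  let ?B = "pbox R C" and ?V = "chain (vstep (- 1) :: _ \<Rightarrow> _ \<Rightarrow> 'a)" and ?H = "chain (hstep y)"
  have fb: "finite (subparts b)" using Suc.prems finite_subparts' by blast
  have "(\<Sum>g\<in>?B. ?H (Suc s) g a * ?V t g b) = (\<Sum>g\<in>?B. \<Sum>e\<in>?B. hstep y g e * ?H s e a * ?V t g b)"
  proof (intro sum.cong refl)
    fix g assume g: "g \<in> ?B"
    have "?H (Suc s) g a = (\<Sum>e\<in>?B. hstep y g e * ?H s e a)"
      using g by (intro chain_Suc_superset hstep_le) (auto simp: finite_pbox pbox_antimono dest: subpartsI_pbox)
    then show "?H (Suc s) g a * ?V t g b = (\<Sum>e\<in>?B. hstep y g e * ?H s e a * ?V t g b)"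
      by (simp only: sum_distrib_right)
  qed
  also have "\<dots> = (\<Sum>e\<in>?B. ?H s e a * (\<Sum>g\<in>?B. hstep y g e * ?V t g b))"
    unfolding sum_distrib_left by (subst sum.swap) (simp add: mult_ac)
  also have "\<dots> = (\<Sum>e\<in>?B. ?H s e a * ((1 - y) ^ t * (\<Sum>d\<in>subparts b. hstep y b d * ?V t e d)))"
  proof (intro sum.cong refl)
    fix e assume e: "e \<in> ?B"
    show "?H s e a * (\<Sum>g\<in>?B. hstep y g e * ?V t g b) =
          ?H s e a * ((1 - y) ^ t * (\<Sum>d\<in>subparts b. hstep y b d * ?V t e d))"
    proof (cases "?H s e a = 0")
      case False
      have e0: "\<forall>i\<ge>L + s. e i = 0"
      proof (intro allI impI)
        fix i assume "L + s \<le> i"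
        then have "e i \<le> a (i - s)" using chain_hstep_nonzero[OF False, of "i - s"] by simp
        then show "e i = 0" using \<open>L + s \<le> i\<close> Suc.prems(2) by simp
      qed
      have "(\<Sum>g\<in>?B. hstep y g e * ?V t g b) = (1 - y) ^ t * (\<Sum>d\<in>subparts e. hstep y b d * ?V t e d)"
        using Suc.prems e e0 by (intro strip_chain_commutation[of e "L + s" R b t C S]) (auto simp: pbox_def)
      \<comment> \<open>The range of d has to become independent of e before the sums are exchanged;
        outside the intersection one of the two factors is zero.\<close>
      also have "(\<Sum>d\<in>subparts e. hstep y b d * ?V t e d) = (\<Sum>d\<in>subparts e \<inter> subparts b. hstep y b d * ?V t e d)"
        using hstep_le[of y b] finite_subparts[OF e]
        by (intro sum.mono_neutral_right) (auto simp: subparts_def dest: mult_not_zero)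
      also have "\<dots> = (\<Sum>d\<in>subparts b. hstep y b d * ?V t e d)"
        using chain_nonzero_subparts[of "vstep (-1)" t e] pbox_antimono[OF e] fb
        by (intro sum.mono_neutral_left) (auto dest: mult_not_zero)
      finally show ?thesis by simp
    qed simp
  qed
  also have "\<dots> = (1 - y) ^ t * (\<Sum>d\<in>subparts b. hstep y b d * (\<Sum>e\<in>?B. ?H s e a * ?V t e d))"
    unfolding sum_distrib_left by (subst sum.swap) (simp add: mult_ac)
  also have "(\<Sum>d\<in>subparts b. hstep y b d * (\<Sum>e\<in>?B. ?H s e a * ?V t e d)) =
      (\<Sum>d\<in>subparts b. hstep y b d * ((1 - y) ^ (s * t) * (\<Sum>d'\<in>subparts a. ?H s d d' * ?V t a d')))"
  proof (intro sum.cong refl)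
    fix d assume "d \<in> subparts b"
    then have d: "antimono d" "d \<le> b" by (auto simp: subparts_def)
    have "\<forall>i\<ge>S. d i = 0" "d 0 \<le> b 0"
      using d(2) Suc.prems(6) by (auto simp: le_fun_def) (metis le_zero_eq)
    then have "(\<Sum>e\<in>?B. ?H s e a * ?V t e d) = (1 - y) ^ (s * t) * (\<Sum>d'\<in>subparts a. ?H s d d' * ?V t a d')"
      using Suc.prems d(1) by (intro Suc.IH) auto
    then show "hstep y b d * (\<Sum>e\<in>?B. ?H s e a * ?V t e d) =
      hstep y b d * ((1 - y) ^ (s * t) * (\<Sum>d'\<in>subparts a. ?H s d d' * ?V t a d'))" by simp
  qed
  also have "\<dots> = (1 - y) ^ (s * t) * (\<Sum>d'\<in>subparts a. ?H (Suc s) b d' * ?V t a d')"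
    unfolding sum_distrib_left sum_distrib_right chain.simps by (subst sum.swap) (simp add: mult_ac)
  finally show ?case by (simp add: mult.assoc power_add)
qed

section \<open>The trace identity\<close>

text \<open>Congruence modulo X^(n+1). It takes the place of limits, since a fixed coefficient
  involves only finitely many partitions.\<close>

definition fps_eq_upto :: "nat \<Rightarrow> 'a::comm_ring_1 fps \<Rightarrow> 'a fps \<Rightarrow> bool" where
  "fps_eq_upto n f g \<longleftrightarrow> (\<forall>i\<le>n. fps_nth f i = fps_nth g i)"

lemma fps_eq_upto_refl [simp]: "fps_eq_upto n f f"
  by (simp add: fps_eq_upto_def)

lemma fps_eq_upto_sym: "fps_eq_upto n f g \<Longrightarrow> fps_eq_upto n g f"
  by (simp add: fps_eq_upto_def)

lemma fps_eq_upto_trans: "fps_eq_upto n f g \<Longrightarrow> fps_eq_upto n g h \<Longrightarrow> fps_eq_upto n f h"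
  by (simp add: fps_eq_upto_def)

lemma fps_eq_upto_mult:
  "fps_eq_upto n f f' \<Longrightarrow> fps_eq_upto n g g' \<Longrightarrow> fps_eq_upto n (f * g) (f' * g')"
  by (auto simp: fps_eq_upto_def fps_mult_nth intro!: sum.cong)

lemma fps_eq_upto_sum:
  "(\<And>x. x \<in> A \<Longrightarrow> fps_eq_upto n (f x) (g x)) \<Longrightarrow> fps_eq_upto n (\<Sum>x\<in>A. f x) (\<Sum>x\<in>A. g x)"
  by (auto simp: fps_eq_upto_def fps_sum_nth intro!: sum.cong)

lemma fps_eq_upto_X_power_mult: "n < k \<Longrightarrow> fps_eq_upto n (fps_X ^ k * f) 0"
  by (auto simp: fps_eq_upto_def fps_X_power_mult_nth)

text \<open>The sizes telescope along a chain, so all chains from f to g carry the same power of the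
  weight.\<close>

lemma chain_hstep_weight:
  fixes x y :: "'a::comm_ring_1"
  assumes "f \<in> pbox R C"
  shows "chain (hstep (x * y)) t f g = x ^ (part_size f - part_size g) * chain (hstep y) t f g"
  using assms
proof (induction t arbitrary: f)
  case 0 then show ?case by simp
next
  case (Suc t)
  show ?case unfolding chain.simps sum_distrib_left
  proof (rule sum.cong[OF refl])
    fix e assume e: "e \<in> subparts f"
    have eb: "e \<in> pbox R C" using e Suc.prems subpartsI_pbox by blast
    show "hstep (x * y) f e * chain (hstep (x * y)) t e g =
        x ^ (part_size f - part_size g) * (hstep y f e * chain (hstep y) t e g)"
    proof (cases "chain (hstep y) t e g = 0")
      case True then show ?thesis using Suc.IH[OF eb] by simp
    next
      case False
      then have "g \<in> subparts e" using chain_nonzero_subparts pbox_antimono[OF eb] by blast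
      then have "part_size f - part_size g = (part_size f - part_size e) + (part_size e - part_size g)"
        using part_size_mono[OF Suc.prems e] part_size_mono[OF eb] by simp
      then show ?thesis using Suc.IH[OF eb]
        by (simp add: hstep_def[of _ f e] power_add power_mult_distrib mult_ac)
    qed
  qed
qed

lemma chain_self:
  assumes "antimono f" "finite (subparts f)" "s f f = 1"
  shows "chain s t f f = 1"
proof (induction t)
  case (Suc t)
  have "s f e * chain s t e f = (if e = f then 1 else 0)" if "e \<in> subparts f" for e
  proof (cases "e = f")
    case False
    then have "f \<notin> subparts e" using that by (auto simp: subparts_def)
    then have "chain s t e f = 0"
      using chain_nonzero_subparts[of s t e f] that by (auto simp: subparts_def)
    then show ?thesis using False by simp
  qed (use assms Suc in simp)
  then show ?case using assms by (simp add: subparts_refl)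
qed simp

lemma chain_hstep_self: "f \<in> pbox R C \<Longrightarrow> chain (hstep y) t f f = 1"
  by (rule chain_self)
     (auto simp: hstep_def hstrip_def pbox_antimono finite_subparts intro: antimonoD[OF pbox_antimono])

lemma chain_vstep_self: "f \<in> pbox R C \<Longrightarrow> chain (vstep y) t f f = 1"
  by (rule chain_self)
     (auto simp: vstep_def vstrip_def pbox_antimono finite_subparts)

definition parts_upto :: "nat \<Rightarrow> (nat \<Rightarrow> nat) set" where
  "parts_upto n = {f \<in> pbox n n. part_size f \<le> n}"

lemma finite_parts_upto: "finite (parts_upto n)"
  by (simp add: parts_upto_def finite_pbox)

text \<open>If row i is nonempty, then so are all rows above it, and each contributes a
  cell.\<close>

lemma part_size_ge:
  assumes "f \<in> pbox R C" "f i \<noteq> 0"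
  shows "f 0 \<le> part_size f" "i < part_size f"
proof -
  have iR: "i < R" using assms pbox_zero leI by metis
  show "f 0 \<le> part_size f" using iR unfolding part_size_pbox[OF assms(1)]
    by (intro member_le_sum) auto
  have "(\<Sum>j<Suc i. 1) \<le> (\<Sum>j<Suc i. f j)"
    using antimonoD[OF pbox_antimono[OF assms(1)], of _ i] assms(2)
    by (intro sum_mono) (metis One_nat_def Suc_leI lessThan_Suc_atMost atMost_iff le_trans not_gr0)
  also have "\<dots> \<le> (\<Sum>j<R. f j)" using iR by (intro sum_mono2) auto
  finally show "i < part_size f" unfolding part_size_pbox[OF assms(1)] by simp
qed

lemma parts_uptoI:
  assumes "f \<in> pbox R C" "part_size f \<le> n"
  shows "f \<in> parts_upto n"
proof -
  have z: "f i = 0" if "n \<le> i" for i using part_size_ge(2)[OF assms(1), of i] assms(2) that by auto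
  have "f 0 \<le> n" using part_size_ge(1)[OF assms(1), of 0] assms(2) by (cases "f 0 = 0") auto
  then show ?thesis using z assms by (auto simp: parts_upto_def pbox_def)
qed

text \<open>The weight y is 1 in the application; it is kept as a parameter because each cyclic move
  multiplies it by q.\<close>

definition trace_upto :: "nat \<Rightarrow> nat \<Rightarrow> rat fps \<Rightarrow> rat fps" where
  "trace_upto n t y = (\<Sum>f\<in>parts_upto n. fps_X ^ part_size f *
     (\<Sum>g\<in>subparts f. chain (hstep y) t f g * chain (vstep (- 1)) t f g))"

text \<open>One cyclic move. The factor X^|f| becomes X^|g| when y is replaced by X y in the
  horizontal strips. For fixed g the sum over the larger partitions f is then the left side of the
  commutation relation, and the sum over smaller d that it produces is again a trace.\<close>

lemma trace_upto_step:
  "fps_eq_upto n (trace_upto n t y) ((1 - fps_X * y) ^ (t * t) * trace_upto n t (fps_X * y))"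
proof -
  let ?P = "parts_upto n" and ?B = "pbox (n + t) (n + t)"
  let ?H = "\<lambda>y. chain (hstep (y :: rat fps)) t" and ?V = "chain (vstep (- 1 :: rat fps)) t"
  let ?y = "fps_X * y"
  have PB: "?P \<subseteq> ?B" using pbox_mono[of n "n + t" n "n + t"] by (auto simp: parts_upto_def)
  have sub: "g \<in> ?P" "part_size g \<le> part_size f" if "f \<in> ?P" "g \<in> subparts f" for f g
    using that part_size_mono[of f n n g] subpartsI_pbox[of f n n] by (auto simp: parts_upto_def)
  have wt: "fps_X ^ part_size f * ?H y f g = fps_X ^ part_size g * ?H ?y f g"
    if "f \<in> ?B" "g \<in> subparts f" for f g
    using that part_size_mono[OF that]
    by (simp add: chain_hstep_weight[of f _ _ fps_X] mult.assoc[symmetric] flip: power_add)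
  have "trace_upto n t y = (\<Sum>f\<in>?P. \<Sum>g\<in>subparts f. fps_X ^ part_size g * (?H ?y f g * ?V f g))"
    unfolding trace_upto_def sum_distrib_left
    using wt PB by (intro sum.cong refl) (simp add: mult.assoc[symmetric] subset_iff)
  also have "\<dots> = (\<Sum>f\<in>?P. \<Sum>g\<in>?P. fps_X ^ part_size g * (?H ?y f g * ?V f g))"
  proof (rule sum.cong[OF refl], rule sum.mono_neutral_left[OF finite_parts_upto])
    fix f assume f: "f \<in> ?P"
    then show "subparts f \<subseteq> ?P" using sub by auto
    show "\<forall>g\<in>?P - subparts f. fps_X ^ part_size g * (?H ?y f g * ?V f g) = 0"
    proof
      fix g assume "g \<in> ?P - subparts f"
      then have "?H ?y f g = 0"
        using f chain_nonzero_subparts[of "hstep ?y" t f g] pbox_antimono[of f n n]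
        unfolding parts_upto_def by blast
      then show "fps_X ^ part_size g * (?H ?y f g * ?V f g) = 0" by simp
    qed
  qed
  finally have tr: "trace_upto n t y = (\<Sum>f\<in>?P. \<Sum>g\<in>?P. fps_X ^ part_size g * (?H ?y f g * ?V f g))" .
  \<comment> \<open>The commutation relation needs f to run through a whole box instead of the
    partitions of size at most n. The surplus f carry X^|f| with |f| > n and are invisible modulo
    X^(n+1).\<close>
  have approx: "fps_eq_upto n (\<Sum>f\<in>?P. \<Sum>g\<in>?P. fps_X ^ part_size g * (?H ?y f g * ?V f g))
    (\<Sum>f\<in>?B. \<Sum>g\<in>?P. fps_X ^ part_size g * (?H ?y f g * ?V f g))"
  proof -
    have "fps_eq_upto n (\<Sum>g\<in>?P. fps_X ^ part_size g * (?H ?y f g * ?V f g)) 0" if f: "f \<in> ?B - ?P" for f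
    proof -
      have nf: "n < part_size f" using f parts_uptoI not_le by blast
      have "fps_eq_upto n (fps_X ^ part_size g * (?H ?y f g * ?V f g)) 0" for g
      proof (cases "g \<in> subparts f")
        case True
        have "fps_X ^ part_size g * (?H ?y f g * ?V f g) = fps_X ^ part_size f * (?H y f g * ?V f g)"
          using wt[OF _ True] f by (simp add: mult.assoc[symmetric])
        then show ?thesis using fps_eq_upto_X_power_mult[OF nf, of "?H y f g * ?V f g"] by (simp only:)
      next
        case False
        then have "?H ?y f g = 0"
          using f chain_nonzero_subparts[of "hstep ?y" t f g] pbox_antimono by blast
        then show ?thesis by simp
      qed
      then have "fps_eq_upto n (\<Sum>g\<in>?P. fps_X ^ part_size g * (?H ?y f g * ?V f g)) (\<Sum>g\<in>?P. 0)"
        by (intro fps_eq_upto_sum)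
      then show ?thesis by simp
    qed
    then have 1: "fps_eq_upto n (\<Sum>f\<in>?B. if f \<in> ?P then \<Sum>g\<in>?P. fps_X ^ part_size g * (?H ?y f g * ?V f g) else 0)
       (\<Sum>f\<in>?B. \<Sum>g\<in>?P. fps_X ^ part_size g * (?H ?y f g * ?V f g))"
      by (intro fps_eq_upto_sum) (auto intro: fps_eq_upto_sym)
    have 2: "(\<Sum>f\<in>?B. if f \<in> ?P then \<Sum>g\<in>?P. fps_X ^ part_size g * (?H ?y f g * ?V f g) else 0) =
       (\<Sum>f\<in>?P. \<Sum>g\<in>?P. fps_X ^ part_size g * (?H ?y f g * ?V f g))"
      using PB by (simp add: sum.If_cases finite_pbox inf.absorb1 inf.absorb2)
    show ?thesis using 1 unfolding 2 .
  qed
  have "(\<Sum>f\<in>?B. \<Sum>g\<in>?P. fps_X ^ part_size g * (?H ?y f g * ?V f g)) =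
      (\<Sum>g\<in>?P. fps_X ^ part_size g * (\<Sum>f\<in>?B. ?H ?y f g * ?V f g))"
    unfolding sum_distrib_left by (rule sum.swap)
  also have "\<dots> = (\<Sum>g\<in>?P. fps_X ^ part_size g * ((1 - ?y) ^ (t * t) * (\<Sum>d\<in>subparts g. ?H ?y g d * ?V g d)))"
  proof (intro sum.cong refl arg_cong[of _ _ "(*) _"])
    fix g assume "g \<in> ?P"
    then have "antimono g" "\<forall>i\<ge>n. g i = 0" "g 0 + t \<le> n + t"
      by (auto simp: parts_upto_def pbox_def)
    then show "(\<Sum>f\<in>?B. ?H ?y f g * ?V f g) = (1 - ?y) ^ (t * t) * (\<Sum>d\<in>subparts g. ?H ?y g d * ?V g d)"
      by (intro chain_commutation[where L = n and S = n]) auto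
  qed
  also have "\<dots> = (1 - ?y) ^ (t * t) * trace_upto n t ?y"
    unfolding trace_upto_def sum_distrib_left by (simp add: mult_ac)
  finally show ?thesis using approx unfolding tr by (simp only:)
qed

lemma trace_upto_iterate:
  "fps_eq_upto n (trace_upto n t 1) ((\<Prod>j=1..m. (1 - fps_X ^ j) ^ (t * t)) * trace_upto n t (fps_X ^ m))"
proof (induction m)
  case (Suc m)
  have "fps_eq_upto n ((\<Prod>j=1..m. (1 - fps_X ^ j) ^ (t * t)) * trace_upto n t (fps_X ^ m))
    ((\<Prod>j=1..m. (1 - fps_X ^ j) ^ (t * t)) * ((1 - fps_X * fps_X ^ m) ^ (t * t) * trace_upto n t (fps_X * fps_X ^ m)))"
    by (intro fps_eq_upto_mult fps_eq_upto_refl trace_upto_step)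
  from fps_eq_upto_trans[OF Suc.IH this] show ?case by (simp add: mult.assoc)
qed simp

text \<open>A proper g costs X^(n (|f| - |g|)) on top of X^|f|, and f is then nonempty, so the total
  degree exceeds n. Only g = f is left, where both chain entries are 1.\<close>

lemma trace_upto_limit:
  "fps_eq_upto n (trace_upto n t (fps_X ^ n)) (\<Sum>f\<in>parts_upto n. fps_X ^ part_size f)"
  unfolding trace_upto_def
proof (rule fps_eq_upto_sum)
  fix f assume "f \<in> parts_upto n"
  then have f: "f \<in> pbox n n" by (simp add: parts_upto_def)
  let ?F = "\<lambda>g. fps_X ^ part_size f * (chain (hstep (fps_X ^ n)) t f g * chain (vstep (- 1 :: rat fps)) t f g)"
  have "fps_eq_upto n (?F g) (if g = f then fps_X ^ part_size f else 0)" if g: "g \<in> subparts f" for g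
  proof (cases "g = f")
    case True
    then show ?thesis using f by (simp add: chain_hstep_self chain_vstep_self)
  next
    case False
    have "\<not> f \<le> g" using g False by (auto simp: subparts_def)
    then obtain i where i: "g i < f i" by (auto simp: le_fun_def not_le)
    then have "i < n" using pbox_zero[OF f, of i] leI by fastforce
    have "g \<in> pbox n n" using f g subpartsI_pbox by blast
    then have "part_size g < part_size f"
      unfolding part_size_pbox[OF f] part_size_pbox[OF \<open>g \<in> pbox n n\<close>]
      using i \<open>i < n\<close> g by (intro sum_strict_mono_ex1) (auto simp: subparts_def le_fun_def)
    then obtain k where k: "part_size f - part_size g = Suc k" "0 < part_size f"
      by (metis Suc_diff_Suc gr_zeroI not_less_zero)
    have "?F g = fps_X ^ (part_size f + n * Suc k) * (chain (hstep 1) t f g * chain (vstep (- 1)) t f g)"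
      using chain_hstep_weight[OF f, of "fps_X ^ n" "1 :: rat fps" t g] k
      by (simp add: power_add mult_ac flip: power_mult)
    moreover have "n < part_size f + n * Suc k" using k by simp
    ultimately show ?thesis using False fps_eq_upto_X_power_mult[of n _ "chain (hstep 1) t f g * chain (vstep (- 1)) t f g"]
      by (simp only: if_False)
  qed
  then have "fps_eq_upto n (\<Sum>g\<in>subparts f. ?F g) (\<Sum>g\<in>subparts f. if g = f then fps_X ^ part_size f else 0)"
    by (rule fps_eq_upto_sum)
  then show "fps_eq_upto n (fps_X ^ part_size f *
      (\<Sum>g\<in>subparts f. chain (hstep (fps_X ^ n)) t f g * chain (vstep (- 1 :: rat fps)) t f g)) (fps_X ^ part_size f)"
    using f by (simp add: sum_distrib_left finite_subparts subparts_refl pbox_antimono)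
qed

text \<open>At y = 1 the chain entries do not involve q, so they are taken in the field of
  rationals, where Cauchy's determinant applies.\<close>

definition diag_entry :: "nat \<Rightarrow> (nat \<Rightarrow> nat) \<Rightarrow> rat" where
  "diag_entry t f = (\<Sum>g\<in>subparts f. chain (hstep 1) t f g * chain (vstep (- 1)) t f g)"

lemma fps_const_sum': "fps_const (\<Sum>x\<in>A. h x) = (\<Sum>x\<in>A. fps_const (h x :: 'a::comm_ring_1))"
  by (induction A rule: infinite_finite_induct) (auto simp flip: fps_const_add)

lemma chain_fps_const:
  assumes "\<And>f g. s' f g = fps_const (s f g)"
  shows "chain s' t f g = fps_const (chain s t f g)"
  by (induction t arbitrary: f) (auto simp: assms fps_const_sum')

lemma diag_fps_const:
  "(\<Sum>g\<in>subparts f. chain (hstep (1 :: rat fps)) t f g * chain (vstep (- 1)) t f g) = fps_const (diag_entry t f)"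
proof -
  have "chain (hstep (1 :: rat fps)) t f g = fps_const (chain (hstep 1) t f g)" for g
    by (rule chain_fps_const) (simp add: hstep_def)
  moreover have "vstep (- 1 :: rat fps) f g = fps_const (vstep (- 1) f g)" for f g
  proof -
    have "(- 1 :: rat fps) ^ k = fps_const ((- 1) ^ k)" for k
      by (cases "even k") (simp_all del: fps_const_neg flip: fps_const_neg)
    then show ?thesis by (simp add: vstep_def)
  qed
  then have "chain (vstep (- 1 :: rat fps)) t f g = fps_const (chain (vstep (- 1)) t f g)" for g
    by (rule chain_fps_const)
  ultimately show ?thesis by (simp add: diag_entry_def fps_const_sum')
qed

theorem diag_generating_function:
  "fps_eq_upto n (\<Sum>f\<in>parts_upto n. fps_X ^ part_size f * fps_const (diag_entry t f))
     ((\<Prod>j=1..n. (1 - fps_X ^ j) ^ (t * t)) * (\<Sum>f\<in>parts_upto n. fps_X ^ part_size f))"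
proof -
  have "(\<Sum>f\<in>parts_upto n. fps_X ^ part_size f * fps_const (diag_entry t f)) = trace_upto n t 1"
    by (simp add: trace_upto_def diag_fps_const)
  moreover have "fps_eq_upto n ((\<Prod>j=1..n. (1 - fps_X ^ j) ^ (t * t)) * trace_upto n t (fps_X ^ n))
      ((\<Prod>j=1..n. (1 - fps_X ^ j) ^ (t * t)) * (\<Sum>f\<in>parts_upto n. fps_X ^ part_size f))"
    by (intro fps_eq_upto_mult fps_eq_upto_refl trace_upto_limit)
  ultimately show ?thesis using fps_eq_upto_trans[OF trace_upto_iterate] by simp
qed

section \<open>Determinants and strips\<close>

text \<open>Determinant of a matrix given by its entry function, so that entries can be rewritten
  without carrying matrix dimensions along.\<close>

definition fdet :: "nat \<Rightarrow> (nat \<Rightarrow> nat \<Rightarrow> 'a::comm_ring_1) \<Rightarrow> 'a" where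
  "fdet n F = Determinant.det (mat n n (\<lambda>(i, j). F i j))"

lemma permutes_lessThan:
  assumes "p permutes {0..<n}" "i < (n::nat)"
  shows "p i < n" "Hilbert_Choice.inv p i < n"
  using permutes_in_image[OF assms(1), of i] permutes_in_image[OF permutes_inv[OF assms(1)], of i] assms(2)
  by auto

lemma fdet_leibniz:
  "fdet n F = (\<Sum>p | p permutes {0..<n}. of_int (sign p) * (\<Prod>i=0..<n. F i (p i)))"
  unfolding fdet_def
  by (subst det_def'[of _ n], simp, intro sum.cong refl arg_cong2[of _ _ _ _ "(*)"] prod.cong)
     (auto simp: permutes_lessThan)

lemma fdet_cong:
  "(\<And>i j. i < n \<Longrightarrow> j < n \<Longrightarrow> F i j = G i j) \<Longrightarrow> fdet n F = fdet n G"
  unfolding fdet_def by (rule arg_cong[of _ _ Determinant.det]) (auto)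

lemma fdet_transpose: "fdet n (\<lambda>i j. F j i) = fdet n F"
proof -
  have "mat n n (\<lambda>(i, j). F j i) = transpose_mat (mat n n (\<lambda>(i, j). F i j))"
    by (auto)
  then show ?thesis unfolding fdet_def by (simp add: Determinant.det_transpose[of _ n])
qed

lemma fdet_mult:
  "fdet n (\<lambda>i j. \<Sum>k<n. F i k * G k j) = fdet n F * fdet n G"
proof -
  have "mat n n (\<lambda>(i, j). \<Sum>k<n. F i k * G k j) = mat n n (\<lambda>(i, j). F i j) * mat n n (\<lambda>(i, j). G i j)"
    by (auto simp: scalar_prod_def atLeast0LessThan)
  then show ?thesis unfolding fdet_def by (simp add: Determinant.det_mult[of _ n])
qed

lemma fdet_upper_unitriangular:
  assumes "\<And>i. i < n \<Longrightarrow> F i i = 1" "\<And>i j. j < i \<Longrightarrow> i < n \<Longrightarrow> F i j = 0"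
  shows "fdet n F = 1"
proof -
  let ?A = "mat n n (\<lambda>(i, j). F i j)"
  have "diag_mat ?A = map (\<lambda>_. 1) [0..<n]"
    using assms(1) by (auto simp: diag_mat_def)
  moreover have "Determinant.det ?A = prod_list (diag_mat ?A)"
    by (rule det_upper_triangular[of _ n]) (auto simp: assms(2) upper_triangular_def)
  ultimately show ?thesis by (simp add: fdet_def prod_list_replicate map_replicate_const)
qed

lemma fdet_identical_rows:
  assumes "i < n" "j < n" "i \<noteq> j" "\<And>k. F i k = F j k"
  shows "fdet n F = 0"
  unfolding fdet_def
  by (rule det_identical_rows[of _ n i j]) (use assms in \<open>auto simp: row_def intro!: eq_vecI\<close>)

lemma fdet_permute_rows:
  assumes "p permutes {0..<n}"
  shows "fdet n (\<lambda>i j. F (p i) j) = of_int (sign p) * fdet n F"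
proof -
  have "mat n n (\<lambda>(i, j). F (p i) j) = mat n n (\<lambda>(i, j). mat n n (\<lambda>(i, j). F i j) $$ (p i, j))"
    using assms by (auto simp: permutes_lessThan)
  then show ?thesis unfolding fdet_def using det_permute_rows[OF _ assms, of "mat n n (\<lambda>(i, j). F i j)"]
    by simp
qed

lemma fdet_scale:
  "fdet n (\<lambda>i j. x i * F i j * y j) = (\<Prod>i<n. x i) * fdet n F * (\<Prod>j<n. y j)"
proof -
  have "(\<Prod>i=0..<n. x i * F i (p i) * y (p i)) = (\<Prod>i<n. x i) * (\<Prod>i=0..<n. F i (p i)) * (\<Prod>j<n. y j)"
    if "p permutes {0..<n}" for p
    using prod.permute[OF that, of y] by (simp add: prod.distrib atLeast0LessThan o_def)
  then show ?thesis
    unfolding fdet_leibniz sum_distrib_left sum_distrib_right by (intro sum.cong refl) (simp add: mult_ac)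
qed

lemma permutes_increasing_imp_id:
  assumes p: "p permutes {0..<n::nat}" and "\<And>i j. i < j \<Longrightarrow> j < n \<Longrightarrow> p i < p j"
  shows "p = id"
proof (rule permutes_natset_ge[OF p], rule ballI)
  fix i assume "i \<in> {0..<n}"
  then show "i \<le> p i"
  proof (induction i)
    case (Suc i)
    then have "i \<le> p i" "p i < p (Suc i)" using assms(2)[of i "Suc i"] by auto
    then show ?case by simp
  qed simp
qed

text \<open>By the hypothesis, a nonvanishing term of the Leibniz formula belongs to an increasing
  permutation, and the identity is the only one. Strip matrices satisfy this because the beta
  numbers on both sides are strictly decreasing.\<close>

lemma fdet_only_diagonal:
  assumes "\<And>i i' j j'. i < i' \<Longrightarrow> i' < n \<Longrightarrow> j < n \<Longrightarrow> j' < n \<Longrightarrow> j \<noteq> j' \<Longrightarrow>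
             F i j \<noteq> 0 \<Longrightarrow> F i' j' \<noteq> 0 \<Longrightarrow> j < j'"
  shows "fdet n F = (\<Prod>i<n. F i i)"
proof -
  have "(\<Prod>i=0..<n. F i (p i)) = 0" if p: "p permutes {0..<n}" "p \<noteq> id" for p
  proof (rule ccontr)
    assume nz: "(\<Prod>i=0..<n. F i (p i)) \<noteq> 0"
    have nz': "F i (p i) \<noteq> 0" if "i < n" for i
    proof
      assume "F i (p i) = 0"
      then have "(\<Prod>i=0..<n. F i (p i)) = 0" using that prod.remove[of "{0..<n}" i "\<lambda>i. F i (p i)"] by simp
      with nz show False by contradiction
    qed
    have "p i < p j" if "i < j" "j < n" for i j
      using assms[of i j "p i" "p j"] nz' that permutes_lessThan[OF p(1)] permutes_inj[OF p(1)]
      by (metis inj_eq less_trans nat_neq_iff)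
    with p show False using permutes_increasing_imp_id by blast
  qed
  then have "fdet n F = (\<Sum>p | p permutes {0..<n}. if p = id then of_int (sign p) * (\<Prod>i=0..<n. F i (p i)) else 0)"
    unfolding fdet_leibniz by (intro sum.cong refl) auto
  also have "\<dots> = (\<Prod>i<n. F i i)"
    by (simp add: finite_permutations permutes_id atLeast0LessThan sign_id)
  finally show ?thesis .
qed

text \<open>
  The numbers \<open>beta N f i\<close> for \<open>i < N\<close> are strictly decreasing, and as \<open>f\<close> ranges over \<open>pbox N C\<close> they
  run through the \<open>N\<close>-element subsets of \<open>{0..<N + C}\<close>; this turns sums over partitions into
  Cauchy--Binet sums.
\<close>

definition beta :: "nat \<Rightarrow> (nat \<Rightarrow> nat) \<Rightarrow> nat \<Rightarrow> nat" where
  "beta N f i = f i + (N - 1 - i)"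

lemma beta_less:
  assumes "antimono f" "i < j" "j < N"
  shows "beta N f j < beta N f i"
  using antimonoD[OF assms(1), of i j] assms(2,3) unfolding beta_def by simp

lemma beta_eq_iff: "beta N f i = beta N g i \<longleftrightarrow> f i = g i"
  by (simp add: beta_def)

lemma beta_bound: "f \<in> pbox N C \<Longrightarrow> i < N \<Longrightarrow> beta N f i < N + C"
  using pbox_le[of f N C i] by (simp add: beta_def)

lemma beta_lessD:
  assumes "antimono f" "i < N" "j < N" "beta N f j < beta N f i"
  shows "i < j"
  using assms beta_less[of f j i N] by (metis less_asym nat_neq_iff)

lemma injective_sorted:
  fixes h :: "nat \<Rightarrow> nat"
  assumes "inj_on h {0..<N}" "\<And>i. i < N \<Longrightarrow> h i < N + C"
  shows "\<exists>g\<in>pbox N C. \<exists>p. p permutes {0..<N} \<and> (\<forall>i<N. h i = beta N g (p i))"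
proof -
  \<comment> \<open>The rank of \<open>h i\<close> among the values in decreasing order; it is the
    identity from N on so that it can be a permutation of \<open>{0..<N}\<close>.\<close>
  define r where "r i = (if i < N then card {i'\<in>{0..<N}. h i < h i'} else i)" for i
  have r_less: "r i' < r i" if "h i < h i'" "i < N" "i' < N" for i i'
    using that by (auto simp: r_def intro!: psubset_card_mono)
  have rN: "r i < N" if "i < N" for i
  proof -
    have "card {i'\<in>{0..<N}. h i < h i'} \<le> card ({0..<N} - {i})" by (intro card_mono) auto
    then show ?thesis using that by (simp add: r_def)
  qed
  have inj: "inj_on r {0..<N}"
  proof (rule inj_onI)
    fix x y assume xy: "x \<in> {0..<N}" "y \<in> {0..<N}" "r x = r y"
    then have "h x = h y" using r_less[of x y] r_less[of y x] by (cases "h x" "h y" rule: linorder_cases) auto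
    then show "x = y" using assms(1) xy by (auto dest: inj_onD)
  qed
  have rp: "r permutes {0..<N}"
    using inj rN by (intro inj_on_nat_permutes) (auto simp: r_def)
  define q where "q = Hilbert_Choice.inv r"
  have qp: "q permutes {0..<N}" unfolding q_def by (rule permutes_inv[OF rp])
  have rq: "r (q j) = j" "q (r j) = j" for j
    using permutes_inverses[OF rp] by (auto simp: q_def)
  have qN: "q j < N" if "j < N" for j using permutes_lessThan(1)[OF qp that] .
  define e where "e j = h (q j)" for j
  have e_dec: "e j' < e j" if "j < j'" "j' < N" for j j'
  proof (rule ccontr)
    assume "\<not> ?thesis"
    moreover have "e j \<noteq> e j'"
    proof
      assume "e j = e j'"
      then have "q j = q j'" using assms(1) qN that by (auto simp: e_def dest: inj_onD)
      then show False using rq(1) that by (metis nat_neq_iff)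
    qed
    ultimately have "h (q j) < h (q j')" by (simp add: e_def)
    then have "r (q j') < r (q j)" using r_less qN that by auto
    then show False using rq that by simp
  qed
  \<comment> \<open>A strictly decreasing sequence lies above the staircase N - 1, ..., 0, so that
    subtracting the staircase in the definition of g truncates nothing.\<close>
  have e_ge: "N - 1 - j \<le> e j" if "j < N" for j
    using that
  proof (induction "N - 1 - j" arbitrary: j)
    case (Suc k)
    then have "k = N - 1 - Suc j" "Suc j < N" by auto
    then have "N - 1 - Suc j \<le> e (Suc j)" "e (Suc j) < e j" using Suc e_dec by auto
    then show ?case by simp
  qed simp
  define g where "g j = (if j < N then e j - (N - 1 - j) else 0)" for j
  have "g (Suc j) \<le> g j" for j
  proof (cases "Suc j < N")
    case True
    then show ?thesis using e_dec[of j "Suc j"] e_ge[of j] e_ge[of "Suc j"] by (simp add: g_def)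
  qed (simp add: g_def)
  moreover have "g 0 \<le> C"
  proof (cases "N = 0")
    case False
    then show ?thesis using assms(2)[of "q 0"] qN[of 0] by (simp add: g_def e_def)
  qed (simp add: g_def)
  ultimately have gb: "g \<in> pbox N C" by (auto simp: pbox_def antimono_iff_le_Suc g_def)
  have "h i = beta N g (r i)" if "i < N" for i
    using rN[OF that] e_ge[of "r i"] rq(2)[of i] by (simp add: beta_def g_def e_def)
  with gb rp show ?thesis by blast
qed

text \<open>Multilinear expansion over all choices h of rows of b. A repeated row gives 0; an
  injective h is, in exactly one way, a beta sequence composed with a permutation, and the sign of
  that permutation assembles the entries of a into a determinant.\<close>

lemma cauchy_binet:
  fixes a b :: "nat \<Rightarrow> nat \<Rightarrow> 'a::comm_ring_1"
  shows "(\<Sum>g\<in>pbox N C. fdet N (\<lambda>i j. a i (beta N g j)) * fdet N (\<lambda>i j. b (beta N g i) j)) =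
         fdet N (\<lambda>i j. \<Sum>m<N+C. a i m * b m j)"
proof -
  let ?P = "{p. p permutes {0..<N}}"
  let ?E = "Pi\<^sub>E {0..<N} (\<lambda>_. {..<N+C})"
  let ?T = "\<lambda>h. (\<Prod>i=0..<N. a i (h i)) * fdet N (\<lambda>i j. b (h i) j)"
  let ?J = "{h\<in>?E. inj_on h {0..<N}}"
  let ?r = "\<lambda>(g, p). restrict (\<lambda>i. beta N g (p i)) {0..<N}"
  have "fdet N (\<lambda>i j. \<Sum>m<N+C. a i m * b m j) =
      (\<Sum>p\<in>?P. of_int (sign p) * (\<Sum>h\<in>?E. \<Prod>i=0..<N. a i (h i) * b (h i) (p i)))"
    unfolding fdet_leibniz by (intro sum.cong refl arg_cong2[of _ _ _ _ "(*)"] prod_sum_PiE) auto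
  also have "\<dots> = (\<Sum>h\<in>?E. ?T h)"
    unfolding fdet_leibniz sum_distrib_left
    by (subst sum.swap) (simp add: prod.distrib mult_ac)
  also have "\<dots> = (\<Sum>h\<in>?J. ?T h)"
  proof (rule sum.mono_neutral_right)
    show "finite ?E" by (intro finite_PiE) auto
    show "\<forall>h\<in>?E - ?J. ?T h = 0"
    proof
      fix h assume "h \<in> ?E - ?J"
      then obtain i j where "i < N" "j < N" "i \<noteq> j" "h i = h j" by (auto simp: inj_on_def)
      then have "fdet N (\<lambda>i j. b (h i) j) = 0" by (intro fdet_identical_rows[of i N j]) auto
      then show "?T h = 0" by simp
    qed
  qed auto
  also have "\<dots> = (\<Sum>gp\<in>pbox N C \<times> ?P. ?T (?r gp))"
  proof (rule sum.reindex_bij_betw[symmetric], rule bij_betw_imageI)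
    show "inj_on ?r (pbox N C \<times> ?P)"
    proof (rule inj_onI, clarify)
      fix g p g' p'
      assume g: "g \<in> pbox N C" "g' \<in> pbox N C" and p: "p permutes {0..<N}" "p' permutes {0..<N}"
        and eq: "restrict (\<lambda>i. beta N g (p i)) {0..<N} = restrict (\<lambda>i. beta N g' (p' i)) {0..<N}"
      have e: "beta N g (p i) = beta N g' (p' i)" if "i < N" for i
        using fun_cong[OF eq, of i] that by simp
      define q where "q = p' \<circ> Hilbert_Choice.inv p"
      have q: "q permutes {0..<N}" unfolding q_def by (intro permutes_compose permutes_inv p)
      have e': "beta N g j = beta N g' (q j)" if "j < N" for j
        using e[of "Hilbert_Choice.inv p j"] permutes_lessThan(2)[OF p(1) that] permutes_inverses[OF p(1)]
        by (simp add: q_def)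
      have "q i < q j" if "i < j" "j < N" for i j
        using beta_less[OF pbox_antimono[OF g(1)] that] e'[of i] e'[of j] that
          beta_lessD[OF pbox_antimono[OF g(2)], of "q i" N "q j"] permutes_lessThan(1)[OF q] by simp
      then have "q = id" by (rule permutes_increasing_imp_id[OF q])
      have "g j = g' j" for j
      proof (cases "j < N")
        case True
        then show ?thesis using e'[of j] \<open>q = id\<close> by (simp add: beta_eq_iff)
      qed (use g pbox_zero in \<open>metis not_le\<close>)
      moreover have "p' = p"
      proof -
        have "p' = q \<circ> p" using permutes_inverses[OF p(1)] by (auto simp: q_def fun_eq_iff)
        then show ?thesis using \<open>q = id\<close> by simp
      qed
      ultimately show "g = g' \<and> p = p'" by auto
    qed
    show "?r ` (pbox N C \<times> ?P) = ?J"
    proof (intro equalityI subsetI)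
      fix h assume "h \<in> ?r ` (pbox N C \<times> ?P)"
      then obtain g p where gp: "g \<in> pbox N C" "p permutes {0..<N}"
        and h: "h = restrict (\<lambda>i. beta N g (p i)) {0..<N}" by auto
      have "h \<in> ?E" using gp beta_bound permutes_lessThan(1)[OF gp(2)] by (auto simp: h)
      moreover have "inj_on h {0..<N}"
      proof (rule inj_onI)
        fix x y assume xy: "x \<in> {0..<N}" "y \<in> {0..<N}" "h x = h y"
        then have "p x < N" "p y < N" "beta N g (p x) = beta N g (p y)"
          using permutes_lessThan(1)[OF gp(2)] by (auto simp: h)
        then have "p x = p y" using beta_less[OF pbox_antimono[OF gp(1)]] by (metis nat_neq_iff)
        then show "x = y" using permutes_inj[OF gp(2)] by (simp add: inj_eq)
      qed
      ultimately show "h \<in> ?J" by simp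
    next
      fix h assume h: "h \<in> ?J"
      then obtain g p where "g \<in> pbox N C" "p permutes {0..<N}" "\<forall>i<N. h i = beta N g (p i)"
        using injective_sorted[of h N C] by (auto simp: PiE_iff)
      moreover from this(3) have "h = restrict (\<lambda>i. beta N g (p i)) {0..<N}"
        using h by (auto simp: PiE_def extensional_def fun_eq_iff)
      ultimately show "h \<in> ?r ` (pbox N C \<times> ?P)" by force
    qed
  qed
  also have "\<dots> = (\<Sum>g\<in>pbox N C. \<Sum>p\<in>?P. ?T (?r (g, p)))"
    unfolding sum.cartesian_product by (intro sum.cong refl) (auto split: prod.splits)
  also have "\<dots> = (\<Sum>g\<in>pbox N C. fdet N (\<lambda>i j. a i (beta N g j)) * fdet N (\<lambda>i j. b (beta N g i) j))"
  proof (rule sum.cong[OF refl])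
    fix g assume "g \<in> pbox N C"
    have "?T (?r (g, p)) = of_int (sign p) * (\<Prod>i=0..<N. a i (beta N g (p i))) * fdet N (\<lambda>i j. b (beta N g i) j)"
      if "p \<in> ?P" for p
    proof -
      have "fdet N (\<lambda>i j. b (?r (g, p) i) j) = fdet N (\<lambda>i j. b (beta N g (p i)) j)"
        by (rule fdet_cong) simp
      also have "\<dots> = of_int (sign p) * fdet N (\<lambda>i j. b (beta N g i) j)"
        using that by (intro fdet_permute_rows[where F = "\<lambda>i j. b (beta N g i) j"]) simp
      finally show ?thesis by (simp add: mult_ac)
    qed
    then show "(\<Sum>p\<in>?P. ?T (?r (g, p))) = fdet N (\<lambda>i j. a i (beta N g j)) * fdet N (\<lambda>i j. b (beta N g i) j)"
      by (subst fdet_leibniz[of N "\<lambda>i j. a i (beta N g j)"]) (simp add: sum_distrib_right)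
  qed
  finally show ?thesis by simp
qed

section \<open>Strips as minors of triangular Toeplitz matrices\<close>

text \<open>The sequence c is the symbol, read as a power series in an auxiliary variable z;
  products of the matrices correspond to products of the symbols.\<close>

definition toeplitz :: "(nat \<Rightarrow> 'a::comm_ring_1) \<Rightarrow> nat \<Rightarrow> nat \<Rightarrow> 'a" where
  "toeplitz c k m = (if m \<le> k then c (k - m) else 0)"

lemma all_rows_iff:
  fixes N :: nat
  assumes "\<And>i. N \<le> i \<Longrightarrow> P i"
  shows "(\<forall>i. P i) \<longleftrightarrow> (\<forall>i<N. P i)"
  by (metis assms not_le)

lemma prod_of_bool: "(\<Prod>i<N. of_bool (P i)) = (of_bool (\<forall>i<N. P i) :: 'a::comm_ring_1)" for N :: nat
  by (induction N) (auto simp: less_Suc_eq)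

lemma eq_toeplitz:
  assumes "f \<in> pbox N C" "g \<in> pbox N C"
  shows "(if f = g then 1 else 0) =
         (fdet N (\<lambda>i j. toeplitz (\<lambda>k. of_bool (k = 0)) (beta N f i) (beta N g j)) :: 'a::comm_ring_1)"
proof -
  have F: "toeplitz (\<lambda>k. of_bool (k = 0)) k m = (of_bool (k = m) :: 'a)" for k m
    by (auto simp: toeplitz_def)
  have "fdet N (\<lambda>i j. of_bool (beta N f i = beta N g j)) = (\<Prod>i<N. of_bool (beta N f i = beta N g i) :: 'a)"
  proof (rule fdet_only_diagonal)
    fix i i' j j' assume *: "i < i'" "i' < N" "j < N" "j' < N"
      "of_bool (beta N f i = beta N g j) \<noteq> (0 :: 'a)" "of_bool (beta N f i' = beta N g j') \<noteq> (0 :: 'a)"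
    then have "beta N g j' < beta N g j" using beta_less[OF pbox_antimono[OF assms(1)], of i i' N] by simp
    then show "j < j'" using beta_lessD[OF pbox_antimono[OF assms(2)]] * by blast
  qed
  also have "\<dots> = of_bool (\<forall>i<N. f i = g i)"
    by (simp add: prod_of_bool beta_eq_iff)
  also have "(\<forall>i<N. f i = g i) \<longleftrightarrow> f = g"
    unfolding fun_eq_iff using all_rows_iff[of N "\<lambda>i. f i = g i"] pbox_zero[OF assms(1)] pbox_zero[OF assms(2)] by simp
  finally show ?thesis unfolding F by simp
qed

text \<open>The symbol is 1 - z. With only two nonzero diagonals, the strictly decreasing beta
  numbers leave just the diagonal term of the expansion.\<close>

lemma vstep_toeplitz:
  assumes "f \<in> pbox N C" "g \<in> pbox N C"
  shows "vstep (- 1) f g =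
         (fdet N (\<lambda>i j. toeplitz (\<lambda>k. if k = 0 then 1 else if k = 1 then - 1 else 0) (beta N f i) (beta N g j)) :: 'a::comm_ring_1)"
    (is "_ = fdet N ?F")
proof -
  have nz: "beta N g j \<le> beta N f i \<and> beta N f i \<le> beta N g j + 1" if "?F i j \<noteq> 0" for i j
    using that by (auto simp: toeplitz_def split: if_splits)
  have diag_entry: "fdet N ?F = (\<Prod>i<N. ?F i i)"
  proof (rule fdet_only_diagonal)
    fix i i' j j' assume *: "i < i'" "i' < N" "j < N" "j' < N" "j \<noteq> j'" "?F i j \<noteq> 0" "?F i' j' \<noteq> 0"
    have "beta N f i' < beta N f i" using beta_less[OF pbox_antimono[OF assms(1)]] * by blast
    then have "beta N g j' \<le> beta N g j" using nz[OF *(6)] nz[OF *(7)] by simp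
    moreover have "beta N g j' \<noteq> beta N g j"
      using beta_less[OF pbox_antimono[OF assms(2)]] *(3-5) by (metis nat_neq_iff)
    ultimately show "j < j'" using beta_lessD[OF pbox_antimono[OF assms(2)], of j N j'] * by simp
  qed
  have Fii: "?F i i = (if g i \<le> f i \<and> f i \<le> g i + 1 then (- 1) ^ (f i - g i) else 0)" for i
    by (auto simp: toeplitz_def beta_def le_Suc_eq)
  have V: "vstrip f g \<longleftrightarrow> (\<forall>i<N. g i \<le> f i \<and> f i \<le> g i + 1)"
    unfolding vstrip_def by (rule all_rows_iff) (simp add: pbox_zero[OF assms(1)] pbox_zero[OF assms(2)])
  show ?thesis
  proof (cases "vstrip f g")
    case True
    then have "part_size f - part_size g = (\<Sum>i<N. f i - g i)"
      using pbox_zero[OF assms(1)] by (intro part_size_diff_eq) (auto simp: vstrip_def)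
    then show ?thesis using True V unfolding diag_entry Fii by (simp add: vstep_def power_sum)
  next
    case False
    then obtain i where "i < N" "\<not> (g i \<le> f i \<and> f i \<le> g i + 1)" using V by blast
    then have "(\<Prod>i<N. ?F i i) = 0" using prod.remove[of "{..<N}" i "\<lambda>i. ?F i i"] Fii[of i] by auto
    then show ?thesis using False unfolding diag_entry by (simp add: vstep_def)
  qed
qed

text \<open>The symbol is 1/(1 - z), a full triangle of ones, where many terms of the expansion are
  nonzero. Subtracting from each row the next one leaves the indicators of
  \<open>beta N f (Suc k) < beta N g j \<le> beta N f k\<close>, for which only the diagonal term
  survives; the unitriangular factor \<open>?U\<close> undoes the subtraction.\<close>

lemma hstep_toeplitz:
  assumes "f \<in> pbox N C" "g \<in> pbox N C"
  shows "hstep 1 f g = (fdet N (\<lambda>i j. toeplitz (\<lambda>_. 1) (beta N f i) (beta N g j)) :: 'a::comm_ring_1)"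
proof -
  \<comment> \<open>The artificial zero row at index N makes the last difference equal to the last
    row.\<close>
  define E :: "nat \<Rightarrow> nat \<Rightarrow> 'a" where "E k j = (if k < N then of_bool (beta N g j \<le> beta N f k) else 0)" for k j
  let ?U = "\<lambda>i k. of_bool (i \<le> k) :: 'a" and ?D = "\<lambda>k j. E k j - E (Suc k) j"
  have D: "?D k j = of_bool (beta N g j \<le> beta N f k \<and> (Suc k < N \<longrightarrow> beta N f (Suc k) < beta N g j))"
    if "k < N" for k j
    using that beta_less[OF pbox_antimono[OF assms(1)], of k "Suc k" N] by (auto simp: E_def)
  have "toeplitz (\<lambda>_. 1) (beta N f i) (beta N g j) = (\<Sum>k<N. ?U i k * ?D k j)" if "i < N" for i j
  proof -
    have "(\<Sum>k<N. ?U i k * ?D k j) = (\<Sum>k=i..<N. ?D k j)"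
      by (intro sum.mono_neutral_cong_right) auto
    also have "\<dots> = E i j - E N j"
      using sum_Suc_diff'[of i N "\<lambda>k. - E k j"] that by simp
    finally show ?thesis using that by (simp add: E_def toeplitz_def)
  qed
  then have "fdet N (\<lambda>i j. toeplitz (\<lambda>_. 1) (beta N f i) (beta N g j)) = fdet N (\<lambda>i j. \<Sum>k<N. ?U i k * ?D k j)"
    by (rule fdet_cong)
  also have "\<dots> = fdet N ?U * fdet N ?D" by (rule fdet_mult)
  also have "fdet N ?U = 1" by (rule fdet_upper_unitriangular) auto
  also have "fdet N ?D = (\<Prod>i<N. ?D i i)"
  proof (rule fdet_only_diagonal)
    fix i i' j j' assume *: "i < i'" "i' < N" "j < N" "j' < N" "?D i j \<noteq> 0" "?D i' j' \<noteq> 0"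
    have "beta N f i' \<le> beta N f (Suc i)"
      using beta_less[OF pbox_antimono[OF assms(1)], of "Suc i" i' N] * by (cases "i' = Suc i") auto
    moreover have "beta N f (Suc i) < beta N g j" "beta N g j' \<le> beta N f i'"
      using * D[of i j] D[of i' j'] by auto
    ultimately have "beta N g j' < beta N g j" by simp
    then show "j < j'" using beta_lessD[OF pbox_antimono[OF assms(2)]] * by blast
  qed
  also have "\<dots> = (\<Prod>i<N. of_bool (g i \<le> f i \<and> f (Suc i) \<le> g i))"
  proof (intro prod.cong refl)
    fix i assume "i \<in> {..<N}"
    then show "?D i i = of_bool (g i \<le> f i \<and> f (Suc i) \<le> g i)"
      using pbox_zero[OF assms(1), of "Suc i"] by (cases "Suc i < N") (auto simp: D beta_def)
  qed
  also have "\<dots> = of_bool (hstrip f g)"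
    using all_rows_iff[of N "\<lambda>i. g i \<le> f i \<and> f (Suc i) \<le> g i"] pbox_zero[OF assms(1)] pbox_zero[OF assms(2)]
    by (simp add: prod_of_bool hstrip_def)
  finally show ?thesis by (simp add: hstep_def)
qed

primrec conv_pow :: "(nat \<Rightarrow> 'a::comm_ring_1) \<Rightarrow> nat \<Rightarrow> nat \<Rightarrow> 'a" where
  "conv_pow c 0 k = of_bool (k = 0)"
| "conv_pow c (Suc t) k = (\<Sum>j\<le>k. c (k - j) * conv_pow c t j)"

lemma toeplitz_mult:
  assumes "k < M"
  shows "(\<Sum>m<M. toeplitz c k m * toeplitz d m l) = toeplitz (\<lambda>k. \<Sum>j\<le>k. c (k - j) * d j) k l"
proof (cases "l \<le> k")
  case True
  have "(\<Sum>m<M. toeplitz c k m * toeplitz d m l) = (\<Sum>m\<in>{l..k}. c (k - m) * d (m - l))"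
    using assms by (intro sum.mono_neutral_cong_right) (auto simp: toeplitz_def)
  also have "\<dots> = (\<Sum>j\<le>k - l. c (k - l - j) * d j)"
    using True by (intro sum.reindex_bij_witness[where i = "\<lambda>j. j + l" and j = "\<lambda>m. m - l"]) auto
  finally show ?thesis using True by (simp add: toeplitz_def)
next
  case False
  then show ?thesis by (auto simp: toeplitz_def intro!: sum.neutral)
qed

text \<open>Composition of strips is Cauchy-Binet for the minors, so a chain of t strips belongs to
  the t-th power of the symbol.\<close>

lemma chain_toeplitz:
  fixes s :: "(nat \<Rightarrow> nat) \<Rightarrow> (nat \<Rightarrow> nat) \<Rightarrow> 'a::comm_ring_1"
  assumes s: "\<And>f g. f \<in> pbox N C \<Longrightarrow> g \<in> pbox N C \<Longrightarrow>
      s f g = fdet N (\<lambda>i j. toeplitz c (beta N f i) (beta N g j))"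
    and le: "\<And>f e. s f e \<noteq> 0 \<Longrightarrow> e \<le> f"
    and fg: "f \<in> pbox N C" "g \<in> pbox N C"
  shows "chain s t f g = fdet N (\<lambda>i j. toeplitz (conv_pow c t) (beta N f i) (beta N g j))"
  using fg(1)
proof (induction t arbitrary: f)
  case 0
  have "conv_pow c 0 = (\<lambda>k. of_bool (k = 0))" by (simp add: fun_eq_iff)
  moreover have "chain s 0 f g = (if f = g then 1 else 0)" by (rule chain.simps(1))
  ultimately show ?case using eq_toeplitz[OF 0(1) fg(2), where 'a = 'a] by (simp only:)
next
  case (Suc t)
  have "chain s (Suc t) f g = (\<Sum>e\<in>pbox N C. s f e * chain s t e g)"
    using Suc.prems le by (intro chain_Suc_superset) (auto simp: finite_pbox pbox_antimono dest: subpartsI_pbox)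
  also have "\<dots> = (\<Sum>e\<in>pbox N C. fdet N (\<lambda>i j. toeplitz c (beta N f i) (beta N e j)) *
      fdet N (\<lambda>i j. toeplitz (conv_pow c t) (beta N e i) (beta N g j)))"
    using Suc s by (intro sum.cong refl) auto
  also have "\<dots> = fdet N (\<lambda>i j. \<Sum>m<N+C. toeplitz c (beta N f i) m * toeplitz (conv_pow c t) m (beta N g j))"
    by (rule cauchy_binet[of N "\<lambda>i. toeplitz c (beta N f i)" "\<lambda>m j. toeplitz (conv_pow c t) m (beta N g j)"])
  also have "\<dots> = fdet N (\<lambda>i j. toeplitz (conv_pow c (Suc t)) (beta N f i) (beta N g j))"
  proof (rule fdet_cong)
    fix i j assume "i < N"
    have "conv_pow c (Suc t) = (\<lambda>k. \<Sum>j\<le>k. c (k - j) * conv_pow c t j)" by (simp add: fun_eq_iff)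
    then show "(\<Sum>m<N+C. toeplitz c (beta N f i) m * toeplitz (conv_pow c t) m (beta N g j)) =
        toeplitz (conv_pow c (Suc t)) (beta N f i) (beta N g j)"
      using toeplitz_mult[OF beta_bound[OF Suc.prems \<open>i < N\<close>]] by (simp only:)
  qed
  finally show ?case .
qed

lemma conv_pow_ones: "conv_pow (\<lambda>_. 1) (Suc s) k = (of_nat (s + k choose k) :: 'a::comm_ring_1)"
proof (induction s arbitrary: k)
  case 0 then show ?case by simp
next
  case (Suc s)
  have "conv_pow (\<lambda>_. 1) (Suc (Suc s)) k = (\<Sum>j\<le>k. of_nat (s + j choose j) :: 'a)"
    by (subst conv_pow.simps(2)) (simp add: Suc del: conv_pow.simps)
  also have "\<dots> = of_nat (Suc s + k choose k)"
    by (simp only: of_nat_sum[symmetric] sum_choose_lower add_Suc)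
  finally show ?case .
qed

lemma conv_pow_diff:
  fixes c :: "nat \<Rightarrow> 'a::comm_ring_1"
  assumes c: "c 0 = 1" "c (Suc 0) = - 1" "\<And>k. 2 \<le> k \<Longrightarrow> c k = 0"
  shows "conv_pow c t k = (- 1) ^ k * of_nat (t choose k)"
proof (induction t arbitrary: k)
  case 0 then show ?case by (cases k) auto
next
  case (Suc t)
  show ?case
  proof (cases k)
    case 0 then show ?thesis using Suc[of 0] c(1) by simp
  next
    case k: (Suc k')
    have "conv_pow c (Suc t) k = (\<Sum>j\<in>{k', Suc k'}. c (k - j) * conv_pow c t j)"
      unfolding conv_pow.simps k
    proof (rule sum.mono_neutral_right)
      show "\<forall>j\<in>{..Suc k'} - {k', Suc k'}. c (Suc k' - j) * conv_pow c t j = 0"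
      proof
        fix j assume "j \<in> {..Suc k'} - {k', Suc k'}"
        then have "2 \<le> Suc k' - j" by auto
        then show "c (Suc k' - j) * conv_pow c t j = 0" using c(3) by simp
      qed
    qed auto
    also have "\<dots> = - conv_pow c t k' + conv_pow c t (Suc k')"
      using k c by simp
    also have "\<dots> = (- 1) ^ k * of_nat (Suc t choose k)"
      unfolding Suc.IH k by (simp add: algebra_simps)
    finally show ?thesis .
  qed
qed

text \<open>With t = s + 1 the kernel has generating function (1-z)^(-t) (1-w)^t / (1-zw). The
  operator z d/dz - w d/dw annihilates 1/(1-zw), and z/(1-z) + w/(1-w) + 1 = (1-zw) / ((1-z)(1-w));
  so applying z d/dz - w d/dw + t yields t (1-z)^(-t-1) (1-w)^(t-1), whose coefficients are the
  right-hand side. The induction is the coefficient version: splitting off m = 0 lowers l and l'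
  together and leaves l - l' unchanged. The bound on M ensures that all nonzero terms are
  summed.\<close>

lemma kernel_identity:
  fixes s :: nat and l l' :: nat
  defines "a \<equiv> \<lambda>k. of_nat (s + k choose k) :: rat" and "b \<equiv> \<lambda>k. (- 1) ^ k * of_nat (Suc s choose k) :: rat"
    and "A \<equiv> \<lambda>k. of_nat (Suc s + k choose k) :: rat" and "B \<equiv> \<lambda>k. (- 1) ^ k * of_nat (s choose k) :: rat"
  assumes "min l l' < M"
  shows "(of_nat l - of_nat l' + of_nat (Suc s)) * (\<Sum>m<M. toeplitz a l m * toeplitz b l' m) =
         of_nat (Suc s) * A l * B l'"
  using assms(5)
proof (induction M arbitrary: l l')
  case 0 then show ?case by simp
next
  case (Suc M)
  have A: "A (Suc k) = A k + a (Suc k)" "of_nat (Suc k) * a (Suc k) = of_nat (Suc s) * A k" for k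
  proof -
    show "A (Suc k) = A k + a (Suc k)" by (simp add: A_def a_def)
    have "Suc k * (s + Suc k choose Suc k) = Suc s * (Suc s + k choose k)"
      using Suc_times_binomial_add[of k s] by (simp add: add.commute del: binomial_Suc_Suc mult_Suc)
    then show "of_nat (Suc k) * a (Suc k) = of_nat (Suc s) * A k"
      unfolding a_def A_def by (metis of_nat_mult)
  qed
  have B: "B (Suc k) = B k + b (Suc k)" "of_nat (Suc k) * b (Suc k) = - (of_nat (Suc s) * B k)" for k
  proof -
    show "B (Suc k) = B k + b (Suc k)" by (simp add: B_def b_def algebra_simps)
    have "Suc k * (Suc s choose Suc k) = Suc s * (s choose k)" by (rule Suc_times_binomial)
    then have "of_nat (Suc k) * of_nat (Suc s choose Suc k) = (of_nat (Suc s) * of_nat (s choose k) :: rat)"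
      by (metis of_nat_mult)
    then show "of_nat (Suc k) * b (Suc k) = - (of_nat (Suc s) * B k)"
      unfolding b_def B_def by (simp add: mult_ac)
  qed
  have z: "a 0 = 1" "A 0 = 1" "b 0 = 1" "B 0 = 1" by (simp_all add: a_def A_def b_def B_def)
  let ?t = "of_nat (Suc s) :: rat"
  have split: "(\<Sum>m<Suc M. toeplitz a l m * toeplitz b l' m) =
      a l * b l' + (\<Sum>m<M. toeplitz a l (Suc m) * toeplitz b l' (Suc m))"
    by (subst sum.lessThan_Suc_shift) (simp add: toeplitz_def)
  show ?case
  proof (cases "l = 0 \<or> l' = 0")
    case True
    then have "(\<Sum>m<M. toeplitz a l (Suc m) * toeplitz b l' (Suc m)) = 0"
      by (auto simp: toeplitz_def)
    moreover have "(of_nat l - of_nat l' + ?t) * (a l * b l') = ?t * A l * B l'"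
    proof (cases l)
      case 0
      then show ?thesis
      proof (cases l')
        case (Suc k)
        have "(?t - of_nat (Suc k)) * b (Suc k) = ?t * (B k + b (Suc k))"
          using B(2)[of k] by (simp only: left_diff_distrib distrib_left)
        with 0 Suc show ?thesis using z B(1)[of k] by simp
      qed (use z in simp)
    next
      case (Suc k)
      with True have "l' = 0" by simp
      have "(of_nat (Suc k) + ?t) * a (Suc k) = ?t * (A k + a (Suc k))"
        using A(2)[of k] by (simp only: distrib_right distrib_left)
      with Suc \<open>l' = 0\<close> show ?thesis using z A(1)[of k] by simp
    qed
    ultimately show ?thesis unfolding split by simp
  next
    case False
    then obtain k k' where k: "l = Suc k" "l' = Suc k'" by (metis not0_implies_Suc)
    have tz: "toeplitz c (Suc x) (Suc m) = toeplitz c x m" for c :: "nat \<Rightarrow> rat" and x m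
      by (simp add: toeplitz_def)
    define S where "S = (\<Sum>m<M. toeplitz a k m * toeplitz b k' m)"
    have S: "(of_nat k - of_nat k' + ?t) * S = ?t * A k * B k'"
      unfolding S_def using Suc.prems k by (intro Suc.IH) auto
    have "(of_nat (Suc k) - of_nat (Suc k') + ?t) * (a (Suc k) * b (Suc k') + S) =
       (of_nat (Suc k) * a (Suc k)) * b (Suc k') - a (Suc k) * (of_nat (Suc k') * b (Suc k')) + ?t * a (Suc k) * b (Suc k') +
       (of_nat k - of_nat k' + ?t) * S"
      by (simp add: algebra_simps)
    also have "\<dots> = ?t * (A k + a (Suc k)) * (B k' + b (Suc k'))"
      unfolding A(2) B(2) S by (simp add: algebra_simps)
    finally show ?thesis unfolding split unfolding k tz A(1) B(1) S_def .
  qed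
qed

section \<open>The diagonal entries in closed form\<close>

lemma fdet_pivot:
  assumes "\<And>i. i < n \<Longrightarrow> F (Suc i) 0 = 0"
  shows "fdet (Suc n) F = F 0 0 * fdet n (\<lambda>i j. F (Suc i) (Suc j) :: 'a::idom)"
proof -
  let ?A = "mat 1 1 (\<lambda>(i, j). F i j)" and ?B = "mat 1 n (\<lambda>(i, j). F i (Suc j))"
    and ?D = "mat n n (\<lambda>(i, j). F (Suc i) (Suc j))"
  have "mat (Suc n) (Suc n) (\<lambda>(i, j). F i j) = four_block_mat ?A ?B (0\<^sub>m n 1) ?D"
    using assms by (intro eq_matI) (auto simp: less_Suc_eq_0_disj)
  moreover have "Determinant.det (four_block_mat ?A ?B (0\<^sub>m n 1) ?D) = Determinant.det ?A * Determinant.det ?D"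
    by (rule det_four_block_mat_lower_left_zero_col) auto
  moreover have "Determinant.det ?A = F 0 0"
    by (simp add: det_single)
  ultimately show ?thesis by (simp add: fdet_def)
qed

text \<open>Elimination of the first column with pivot \<open>F 0 0\<close>: the factor
  \<open>L\<close> is unitriangular up to transposition, and the first column of \<open>W\<close>
  contains only the pivot.\<close>

lemma fdet_schur:
  fixes F :: "nat \<Rightarrow> nat \<Rightarrow> 'a::field"
  assumes "F 0 0 \<noteq> 0"
  shows "fdet (Suc n) F = F 0 0 * fdet n (\<lambda>i j. F (Suc i) (Suc j) - F (Suc i) 0 / F 0 0 * F 0 (Suc j))"
proof -
  define L where "L i k = (if i = k then 1 else if k = 0 then F i 0 / F 0 0 else 0)" for i k :: nat
  define W where "W k j = (if k = 0 then F 0 j else F k j - F k 0 / F 0 0 * F 0 j)" for k j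
  have "F i j = (\<Sum>k<Suc n. L i k * W k j)" if "i < Suc n" for i j
  proof -
    have "(\<Sum>k<Suc n. L i k * W k j) = (\<Sum>k\<in>{0, i}. L i k * W k j)"
      using that by (intro sum.mono_neutral_right) (auto simp: L_def)
    then show ?thesis by (cases "i = 0") (auto simp: L_def W_def)
  qed
  then have "fdet (Suc n) F = fdet (Suc n) (\<lambda>i j. \<Sum>k<Suc n. L i k * W k j)" by (rule fdet_cong)
  also have "\<dots> = fdet (Suc n) L * fdet (Suc n) W" by (rule fdet_mult)
  also have "fdet (Suc n) L = fdet (Suc n) (\<lambda>i j. L j i)" by (rule fdet_transpose[symmetric])
  also have "\<dots> = 1" by (rule fdet_upper_unitriangular) (auto simp: L_def)
  also have "fdet (Suc n) W = W 0 0 * fdet n (\<lambda>i j. W (Suc i) (Suc j))"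
    using assms by (intro fdet_pivot) (auto simp: W_def)
  finally show ?thesis by (simp add: W_def)
qed

text \<open>The Schur complement of the first entry is again a Cauchy matrix, with rows scaled by
  (x_i - x_0) / (x_i + y_0) and columns by (y_j - y_0) / (x_0 + y_j).\<close>

lemma cauchy_determinant:
  fixes x y :: "nat \<Rightarrow> 'a::field"
  assumes "\<And>i j. i < n \<Longrightarrow> j < n \<Longrightarrow> x i + y j \<noteq> 0"
  shows "fdet n (\<lambda>i j. 1 / (x i + y j)) =
    (\<Prod>i<n. \<Prod>j<i. (x i - x j) * (y i - y j)) / (\<Prod>i<n. \<Prod>j<n. x i + y j)"
  using assms
proof (induction n arbitrary: x y)
  case 0 then show ?case by (simp add: fdet_leibniz)
next
  case (Suc n)
  note nz = Suc.prems
  let ?x = "\<lambda>i. x (Suc i)" and ?y = "\<lambda>j. y (Suc j)"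
  have "fdet (Suc n) (\<lambda>i j. 1 / (x i + y j)) = 1 / (x 0 + y 0) *
      fdet n (\<lambda>i j. 1 / (?x i + ?y j) - 1 / (?x i + y 0) / (1 / (x 0 + y 0)) * (1 / (x 0 + ?y j)))"
    using nz[of 0 0] by (intro fdet_schur) simp
  also have "fdet n (\<lambda>i j. 1 / (?x i + ?y j) - 1 / (?x i + y 0) / (1 / (x 0 + y 0)) * (1 / (x 0 + ?y j))) =
      fdet n (\<lambda>i j. (?x i - x 0) / (?x i + y 0) * (1 / (?x i + ?y j)) * ((?y j - y 0) / (x 0 + ?y j)))"
  proof (rule fdet_cong)
    fix i j assume "i < n" "j < n"
    then have "?x i + ?y j \<noteq> 0" "?x i + y 0 \<noteq> 0" "x 0 + ?y j \<noteq> 0" "x 0 + y 0 \<noteq> 0" using nz by auto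
    then show "1 / (?x i + ?y j) - 1 / (?x i + y 0) / (1 / (x 0 + y 0)) * (1 / (x 0 + ?y j)) =
        (?x i - x 0) / (?x i + y 0) * (1 / (?x i + ?y j)) * ((?y j - y 0) / (x 0 + ?y j))"
      by (simp add: divide_simps) (simp add: algebra_simps)
  qed
  also have "\<dots> = (\<Prod>i<n. (?x i - x 0) / (?x i + y 0)) * fdet n (\<lambda>i j. 1 / (?x i + ?y j)) * (\<Prod>j<n. (?y j - y 0) / (x 0 + ?y j))"
    by (rule fdet_scale)
  also have "fdet n (\<lambda>i j. 1 / (?x i + ?y j)) =
     (\<Prod>i<n. \<Prod>j<i. (?x i - ?x j) * (?y i - ?y j)) / (\<Prod>i<n. \<Prod>j<n. ?x i + ?y j)"
    using nz by (intro Suc.IH) auto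
  finally have eq: "fdet (Suc n) (\<lambda>i j. 1 / (x i + y j)) = 1 / (x 0 + y 0) *
     ((\<Prod>i<n. (?x i - x 0) / (?x i + y 0)) *
      ((\<Prod>i<n. \<Prod>j<i. (?x i - ?x j) * (?y i - ?y j)) / (\<Prod>i<n. \<Prod>j<n. ?x i + ?y j)) *
      (\<Prod>j<n. (?y j - y 0) / (x 0 + ?y j)))" .
  have num: "(\<Prod>i<Suc n. \<Prod>j<i. (x i - x j) * (y i - y j)) =
      (\<Prod>i<n. ?x i - x 0) * (\<Prod>i<n. ?y i - y 0) * (\<Prod>i<n. \<Prod>j<i. (?x i - ?x j) * (?y i - ?y j))"
    by (simp add: prod.lessThan_Suc_shift prod.distrib mult_ac del: prod.lessThan_Suc)
  have den: "(\<Prod>i<Suc n. \<Prod>j<Suc n. x i + y j) =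
      (x 0 + y 0) * (\<Prod>i<n. ?x i + y 0) * (\<Prod>j<n. x 0 + ?y j) * (\<Prod>i<n. \<Prod>j<n. ?x i + ?y j)"
    by (simp add: prod.lessThan_Suc_shift prod.distrib mult_ac del: prod.lessThan_Suc)
  show ?case unfolding eq num den by (simp add: prod_dividef mult_ac)
qed

lemma prod_square:
  fixes g :: "nat \<Rightarrow> nat \<Rightarrow> 'a::comm_ring_1"
  shows "(\<Prod>i<n. \<Prod>j<n. g i j) = (\<Prod>i<n. g i i) * (\<Prod>i<n. \<Prod>j<i. g i j * g j i)"
  by (induction n) (simp_all add: prod.distrib mult_ac)

section \<open>Diagonal entries in terms of beta numbers\<close>

text \<open>Stated for t = s + 1, where the coefficients of (1-z)^(-t) are binomials free of
  subtraction. Transposing the vertical minor lets Cauchy-Binet contract over the common g.\<close>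

lemma diag_toeplitz:
  assumes f: "f \<in> pbox N C"
  shows "diag_entry (Suc s) f = fdet N (\<lambda>i j. \<Sum>m<N+C.
     toeplitz (\<lambda>k. of_nat (s + k choose k)) (beta N f i) m *
     toeplitz (\<lambda>k. (- 1) ^ k * of_nat (Suc s choose k)) (beta N f j) m)"
proof -
  let ?v = "\<lambda>k. if k = 0 then 1 else if k = 1 then - 1 else (0 :: rat)"
  let ?a = "\<lambda>k. of_nat (s + k choose k) :: rat" and ?b = "\<lambda>k. (- 1) ^ k * of_nat (Suc s choose k) :: rat"
  have a: "conv_pow (\<lambda>_. 1) (Suc s) = ?a" by (rule ext) (rule conv_pow_ones)
  have b: "conv_pow ?v (Suc s) = ?b" by (rule ext) (rule conv_pow_diff, auto)
  have H: "chain (hstep 1) (Suc s) f g = fdet N (\<lambda>i j. toeplitz ?a (beta N f i) (beta N g j))"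
    if "g \<in> pbox N C" for g
    unfolding a[symmetric] by (rule chain_toeplitz[OF hstep_toeplitz hstep_le f that])
  have V: "chain (vstep (- 1)) (Suc s) f g = fdet N (\<lambda>i j. toeplitz ?b (beta N f j) (beta N g i))"
    if "g \<in> pbox N C" for g
    unfolding b[symmetric] fdet_transpose[of N "\<lambda>i j. toeplitz (conv_pow ?v (Suc s)) (beta N f i) (beta N g j)"]
    by (rule chain_toeplitz[OF vstep_toeplitz vstep_le f that])
  have "diag_entry (Suc s) f = (\<Sum>g\<in>pbox N C. chain (hstep 1) (Suc s) f g * chain (vstep (- 1)) (Suc s) f g)"
    unfolding diag_entry_def
  proof (rule sum.mono_neutral_left[OF finite_pbox subpartsI_pbox[OF f]], rule ballI)
    fix g assume "g \<in> pbox N C - subparts f"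
    then have "chain (hstep 1 :: _ \<Rightarrow> _ \<Rightarrow> rat) (Suc s) f g = 0"
      using chain_nonzero_subparts pbox_antimono[OF f] by blast
    then show "chain (hstep 1) (Suc s) f g * chain (vstep (- 1)) (Suc s) f g = (0 :: rat)" by (simp only: mult_zero_left)
  qed
  also have "\<dots> = (\<Sum>g\<in>pbox N C. fdet N (\<lambda>i j. toeplitz ?a (beta N f i) (beta N g j)) *
      fdet N (\<lambda>i j. toeplitz ?b (beta N f j) (beta N g i)))"
    by (intro sum.cong refl) (simp only: H V)
  also have "\<dots> = fdet N (\<lambda>i j. \<Sum>m<N+C. toeplitz ?a (beta N f i) m * toeplitz ?b (beta N f j) m)"
    by (rule cauchy_binet[of N "\<lambda>i. toeplitz ?a (beta N f i)" "\<lambda>m j. toeplitz ?b (beta N f j) m"])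
  finally show ?thesis .
qed

text \<open>With t = s + 1, each c contributes (c + t)/c from the first binomial and (c - t)/c from
  the signed second one. The left side is the product of the row and column scalings of the kernel
  at one beta number l.\<close>

lemma binomial_pair_prod:
  "of_nat (Suc s + l choose l) * ((- 1) ^ l * of_nat (s choose l)) =
     (\<Prod>c=1..l. 1 - (of_nat (Suc s))\<^sup>2 / (of_nat c)\<^sup>2 :: rat)"
proof (induction l)
  case (Suc l)
  let ?A = "\<lambda>l. of_nat (Suc s + l choose l) :: rat" and ?B = "\<lambda>l. (- 1) ^ l * of_nat (s choose l) :: rat"
  have "Suc l * (Suc s + Suc l choose Suc l) = (Suc s + Suc l) * (Suc s + l choose l)"
    using Suc_times_binomial[of l "Suc s + l"] by simp
  then have A: "of_nat (Suc l) * ?A (Suc l) = (of_nat (Suc s) + of_nat (Suc l)) * ?A l"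
    by (metis of_nat_mult of_nat_add)
  have C: "of_nat (Suc l) * of_nat (s choose Suc l) = ((of_nat s - of_nat l) * of_nat (s choose l) :: rat)"
  proof (cases "l \<le> s")
    case True
    have "Suc l * (s choose Suc l) = (s - l) * (s choose l)"
      by (metis binomial_absorb_comp binomial_absorption mult.commute)
    then show ?thesis using True by (metis of_nat_mult of_nat_diff)
  qed (simp add: binomial_eq_0)
  have "of_nat (Suc l) * ?B (Suc l) = - ((- 1) ^ l * (of_nat (Suc l) * of_nat (s choose Suc l)))"
    by (simp add: mult_ac del: of_nat_Suc)
  also have "\<dots> = (of_nat (Suc l) - of_nat (Suc s)) * ?B l"
    unfolding C by (simp add: algebra_simps)
  finally have B: "of_nat (Suc l) * ?B (Suc l) = (of_nat (Suc l) - of_nat (Suc s)) * ?B l" .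
  have "(of_nat (Suc l))\<^sup>2 * (?A (Suc l) * ?B (Suc l)) = (of_nat (Suc l) * ?A (Suc l)) * (of_nat (Suc l) * ?B (Suc l))"
    by (simp add: power2_eq_square mult_ac del: binomial_Suc_Suc)
  also have "\<dots> = ((of_nat (Suc l))\<^sup>2 - (of_nat (Suc s))\<^sup>2) * (?A l * ?B l)"
    unfolding A B by (simp add: power2_eq_square algebra_simps del: binomial_Suc_Suc)
  finally have "?A (Suc l) * ?B (Suc l) = (?A l * ?B l) * (1 - (of_nat (Suc s))\<^sup>2 / (of_nat (Suc l))\<^sup>2)"
    by (simp add: field_simps del: binomial_Suc_Suc of_nat_Suc)
  then show ?case unfolding Suc by (simp del: binomial_Suc_Suc of_nat_Suc)
qed simp

text \<open>Cauchy's determinant with x_i = t + l_i and y_j = - l_j, where l_i are the beta numbers.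
  Its diagonal denominators cancel the N factors t, each pair j < i contributes the inverse of 1 -
  t^2 / (l_j - l_i)^2, and the row and column scalings give the right-hand side. All l_i lie below N
  + C and thus below t, so no denominator t + l_i - l_j vanishes.\<close>

lemma diag_beta:
  assumes f: "f \<in> pbox N C" and t: "N + C \<le> t"
  shows "diag_entry t f * (\<Prod>i<N. \<Prod>j<i. 1 - (of_nat t)\<^sup>2 / (of_nat (beta N f j - beta N f i))\<^sup>2) =
         (\<Prod>i<N. \<Prod>c=1..beta N f i. 1 - (of_nat t)\<^sup>2 / (of_nat c)\<^sup>2)"
proof (cases "N = 0")
  case True
  \<comment> \<open>Without rows t may be 0, whereas the kernel formula requires t = s + 1.\<close>
  have "subparts f = {f}" if "N = 0"
  proof -
    have "g = f" if "g \<in> subparts f" for g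
    proof
      fix i show "g i = f i" using pbox_zero[OF f, of i] subpartsI_pbox[OF f] that pbox_zero[of g N C i] \<open>N = 0\<close> by auto
    qed
    then show ?thesis using subparts_refl[OF pbox_antimono[OF f]] by auto
  qed
  then have "diag_entry t f = 1" using True f by (simp add: diag_entry_def chain_hstep_self chain_vstep_self)
  then show ?thesis using True by simp
next
  case False
  then obtain s where s: "t = Suc s" using t by (cases t) auto
  let ?t = "of_nat t :: rat" and ?l = "\<lambda>i. of_nat (beta N f i) :: rat"
  let ?A = "\<lambda>k. of_nat (Suc s + k choose k) :: rat" and ?B = "\<lambda>k. (- 1) ^ k * of_nat (s choose k) :: rat"
  have bt: "beta N f i < t" if "i < N" for i using beta_bound[OF f that] t by simp
  have nz: "?t + ?l i - ?l j \<noteq> 0" if "i < N" "j < N" for i j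
  proof -
    have "?t + ?l i > ?l j" using bt[OF that(2)] by (simp flip: of_nat_add)
    then show ?thesis by simp
  qed
  have "diag_entry t f = fdet N (\<lambda>i j. (?t * ?A (beta N f i)) * (1 / ((?t + ?l i) + (- ?l j))) * ?B (beta N f j))"
    unfolding s diag_toeplitz[OF f]
  proof (rule fdet_cong)
    fix i j assume ij: "i < N" "j < N"
    let ?K = "\<Sum>m<N+C. toeplitz (\<lambda>k. of_nat (s + k choose k)) (beta N f i) m *
     toeplitz (\<lambda>k. (- 1) ^ k * of_nat (Suc s choose k)) (beta N f j) m :: rat"
    have "min (beta N f i) (beta N f j) < N + C" using beta_bound[OF f ij(1)] by simp
    then have "(?l i - ?l j + ?t) * ?K = ?t * ?A (beta N f i) * ?B (beta N f j)"
      unfolding s by (rule kernel_identity[of "beta N f i" "beta N f j" "N + C" s])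
    moreover have "?l i - ?l j + ?t \<noteq> 0" using nz[OF ij] by (simp add: algebra_simps)
    ultimately have "?K = ?t * ?A (beta N f i) * ?B (beta N f j) / (?l i - ?l j + ?t)"
      by (simp only: mult.commute[of "?l i - ?l j + ?t"] eq_divide_eq) simp
    then show "?K = of_nat (Suc s) * ?A (beta N f i) * (1 / (of_nat (Suc s) + ?l i + (- ?l j))) * ?B (beta N f j)"
      unfolding s by (simp add: algebra_simps del: of_nat_Suc binomial_Suc_Suc)
  qed
  also have "\<dots> = (\<Prod>i<N. ?t * ?A (beta N f i)) * fdet N (\<lambda>i j. 1 / ((?t + ?l i) + (- ?l j))) * (\<Prod>i<N. ?B (beta N f i))"
    by (rule fdet_scale)
  also have "fdet N (\<lambda>i j. 1 / ((?t + ?l i) + (- ?l j))) =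
      (\<Prod>i<N. \<Prod>j<i. ((?t + ?l i) - (?t + ?l j)) * (- ?l i - - ?l j)) / (\<Prod>i<N. \<Prod>j<N. (?t + ?l i) + (- ?l j))"
    using nz by (intro cauchy_determinant[where x = "\<lambda>i. ?t + ?l i" and y = "\<lambda>j. - ?l j"]) simp
  also have "(\<Prod>i<N. \<Prod>j<N. (?t + ?l i) + (- ?l j)) =
     (\<Prod>i<N. ?t) * (\<Prod>i<N. \<Prod>j<i. (?t + ?l i + - ?l j) * (?t + ?l j + - ?l i))"
    by (subst prod_square) simp
  finally have D: "diag_entry t f = (\<Prod>i<N. ?t * ?A (beta N f i)) *
     ((\<Prod>i<N. \<Prod>j<i. ((?t + ?l i) - (?t + ?l j)) * (- ?l i - - ?l j)) /
      ((\<Prod>i<N. ?t) * (\<Prod>i<N. \<Prod>j<i. (?t + ?l i + - ?l j) * (?t + ?l j + - ?l i)))) * (\<Prod>i<N. ?B (beta N f i))" .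
  have fac: "((?t + ?l i) - (?t + ?l j)) * (- ?l i - - ?l j) / ((?t + ?l i + - ?l j) * (?t + ?l j + - ?l i)) *
      (1 - ?t\<^sup>2 / (of_nat (beta N f j - beta N f i))\<^sup>2) = 1" if "i < N" "j < i" for i j
  proof -
    have lt: "beta N f i < beta N f j" using beta_less[OF pbox_antimono[OF f]] that by blast
    then have d: "of_nat (beta N f j - beta N f i) = ?l j - ?l i" "?l j - ?l i \<noteq> 0" by (simp_all add: of_nat_diff)
    have n: "?t + ?l i - ?l j \<noteq> 0" "?t + ?l j - ?l i \<noteq> 0" using nz that by auto
    have "(?l j - ?l i)\<^sup>2 - ?t\<^sup>2 = - ((?t + ?l i - ?l j) * (?t + ?l j - ?l i))"
      by (simp add: power2_eq_square algebra_simps)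
    then have "1 - ?t\<^sup>2 / (?l j - ?l i)\<^sup>2 = - ((?t + ?l i - ?l j) * (?t + ?l j - ?l i)) / (?l j - ?l i)\<^sup>2"
      using d(2) by (simp add: diff_divide_eq_iff)
    moreover have "((?t + ?l i) - (?t + ?l j)) * (- ?l i - - ?l j) = - ((?l j - ?l i)\<^sup>2)"
      by (simp add: power2_eq_square algebra_simps)
    ultimately show ?thesis unfolding d(1) using n d(2) by simp
  qed
  have t0: "(\<Prod>i<N. ?t) \<noteq> 0" using s by simp
  have "diag_entry t f * (\<Prod>i<N. \<Prod>j<i. 1 - ?t\<^sup>2 / (of_nat (beta N f j - beta N f i))\<^sup>2) =
      (\<Prod>i<N. ?A (beta N f i) * ?B (beta N f i)) *
      (\<Prod>i<N. \<Prod>j<i. ((?t + ?l i) - (?t + ?l j)) * (- ?l i - - ?l j) / ((?t + ?l i + - ?l j) * (?t + ?l j + - ?l i)) *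
      (1 - ?t\<^sup>2 / (of_nat (beta N f j - beta N f i))\<^sup>2))"
  proof -
    have "P * A * (X / (P * Y)) * B * Z = A * B * (X / Y * Z)" if "P \<noteq> 0" for P A B X Y Z :: rat
      using that by simp
    from this[OF t0] show ?thesis unfolding D by (simp only: prod.distrib prod_dividef)
  qed
  also have "(\<Prod>i<N. \<Prod>j<i. ((?t + ?l i) - (?t + ?l j)) * (- ?l i - - ?l j) / ((?t + ?l i + - ?l j) * (?t + ?l j + - ?l i)) *
      (1 - ?t\<^sup>2 / (of_nat (beta N f j - beta N f i))\<^sup>2)) = 1"
    by (intro prod.neutral ballI fac) auto
  also have "(\<Prod>i<N. ?A (beta N f i) * ?B (beta N f i)) = (\<Prod>i<N. \<Prod>c=1..beta N f i. 1 - ?t\<^sup>2 / (of_nat c)\<^sup>2)"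
    unfolding s by (intro prod.cong refl binomial_pair_prod)
  finally show ?thesis by simp
qed

section \<open>Hook lengths\<close>

definition row_fun :: "nat list \<Rightarrow> nat \<Rightarrow> nat" where
  "row_fun \<mu> i = (if i < length \<mu> then \<mu> ! i else 0)"

lemma row_fun_antimono: "sorted_wrt (\<ge>) \<mu> \<Longrightarrow> antimono (row_fun \<mu>)"
  by (auto simp: antimono_iff_le_Suc row_fun_def sorted_wrt_iff_nth_less)

lemma row_fun_pbox:
  assumes "\<mu> \<in> partitions_of n" "length \<mu> \<le> R"
  shows "row_fun \<mu> \<in> pbox R n"
proof -
  have "row_fun \<mu> 0 \<le> sum_list \<mu>" by (cases \<mu>) (auto simp: row_fun_def)
  then show ?thesis using assms row_fun_antimono[of \<mu>]
    by (auto simp: pbox_def partitions_of_def row_fun_def)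
qed

lemma partitions_length: "\<mu> \<in> partitions_of n \<Longrightarrow> length \<mu> \<le> n"
proof -
  have "\<forall>x\<in>set \<mu>. 1 \<le> x \<Longrightarrow> length \<mu> \<le> sum_list \<mu>" for \<mu> :: "nat list"
    by (induction \<mu>) auto
  then show "\<mu> \<in> partitions_of n \<Longrightarrow> length \<mu> \<le> n" by (auto simp: partitions_of_def)
qed

lemma part_size_rows: "part_size (row_fun \<mu>) = sum_list \<mu>"
proof -
  have "part_size (row_fun \<mu>) = (\<Sum>i<length \<mu>. row_fun \<mu> i)" by (rule part_size_eq) (simp add: row_fun_def)
  then show ?thesis by (simp add: row_fun_def sum_list_sum_nth atLeast0LessThan)
qed

lemma row_fun_bij: "bij_betw row_fun (partitions_of n) {f \<in> parts_upto m. part_size f = n}" if "n \<le> m"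
proof (rule bij_betw_imageI)
  show "inj_on row_fun (partitions_of n)"
  proof (rule inj_onI)
    fix \<mu> \<nu> assume mn: "\<mu> \<in> partitions_of n" "\<nu> \<in> partitions_of n" "row_fun \<mu> = row_fun \<nu>"
    have pos: "i < length \<xi> \<longleftrightarrow> row_fun \<xi> i \<noteq> 0" if "\<xi> \<in> partitions_of n" for \<xi> i
      using that by (auto simp: row_fun_def partitions_of_def dest!: bspec[OF _ nth_mem])
    have "i < length \<mu> \<longleftrightarrow> i < length \<nu>" for i using pos mn by metis
    then have len: "length \<mu> = length \<nu>" by (metis nat_neq_iff)
    moreover have "\<mu> ! i = \<nu> ! i" if "i < length \<mu>" for i
      using fun_cong[OF mn(3), of i] that len by (simp add: row_fun_def)
    ultimately show "\<mu> = \<nu>" by (rule nth_equalityI)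
  qed
  show "row_fun ` partitions_of n = {f \<in> parts_upto m. part_size f = n}"
  proof (intro equalityI subsetI)
    fix f assume "f \<in> row_fun ` partitions_of n"
    then obtain \<mu> where "\<mu> \<in> partitions_of n" "f = row_fun \<mu>" by auto
    then show "f \<in> {f \<in> parts_upto m. part_size f = n}"
      using row_fun_pbox[of \<mu> n "length \<mu>"] part_size_rows[of \<mu>] that
      by (auto simp: partitions_of_def intro: parts_uptoI)
  next
    fix f assume "f \<in> {f \<in> parts_upto m. part_size f = n}"
    then have f: "f \<in> pbox m m" "part_size f = n" by (auto simp: parts_upto_def)
    define L where "L = (LEAST i. f i = 0)"
    have L0: "f L = 0" unfolding L_def by (rule LeastI[of _ m]) (rule pbox_zero[OF f(1)], simp)
    have nz: "f i \<noteq> 0" if "i < L" for i using that not_less_Least unfolding L_def by blast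
    have z: "f i = 0" if "L \<le> i" for i using antimonoD[OF pbox_antimono[OF f(1)] that] L0 by simp
    let ?\<mu> = "map f [0..<L]"
    have r: "row_fun ?\<mu> = f" using z by (auto simp: row_fun_def fun_eq_iff)
    have "sum_list ?\<mu> = n" using part_size_rows[of ?\<mu>] r f(2) by simp
    moreover have "sorted_wrt (\<ge>) ?\<mu>"
      using antimonoD[OF pbox_antimono[OF f(1)]] by (auto simp: sorted_wrt_iff_nth_less)
    ultimately have "?\<mu> \<in> partitions_of n" using nz by (auto simp: partitions_of_def Suc_leI)
    with r show "f \<in> row_fun ` partitions_of n" by force
  qed
qed

lemma hook_length_rows:
  assumes "c < row_fun \<mu> i"
  shows "hook_length \<mu> (i, c) = row_fun \<mu> i - c + card {j. i < j \<and> c < row_fun \<mu> j}"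
proof -
  have il: "i < length \<mu>" using assms by (auto simp: row_fun_def split: if_splits)
  have fin: "finite {j. i < j \<and> c < row_fun \<mu> j}"
    by (rule finite_subset[of _ "{..<length \<mu>}"]) (auto simp: row_fun_def split: if_splits)
  have "hook \<mu> (i, c) = Pair i ` {c..<row_fun \<mu> i} \<union> (\<lambda>j. (j, c)) ` {j. i < j \<and> c < row_fun \<mu> j}"
    using assms il by (auto simp: hook_def young_diagram_def row_fun_def split: if_splits)
  moreover have "card \<dots> = card (Pair i ` {c..<row_fun \<mu> i}) + card ((\<lambda>j. (j, c)) ` {j. i < j \<and> c < row_fun \<mu> j})"
    using fin by (intro card_Un_disjoint) auto
  ultimately show ?thesis unfolding hook_length_def by (simp add: card_image inj_on_def)
qed

text \<open>The hook lengths in a row and the differences of the first-column hook lengths below it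
  partition an initial segment of the positive integers.\<close>

lemma hook_row_product:
  fixes \<phi> :: "nat \<Rightarrow> 'a::comm_ring_1"
  assumes f: "f \<in> pbox N C" and i: "i < N"
  shows "(\<Prod>c<f i. \<phi> (f i - c + card {j. i < j \<and> c < f j})) * (\<Prod>j\<in>{i<..<N}. \<phi> (beta N f i - beta N f j)) =
    (\<Prod>c=1..beta N f i. \<phi> c)"
proof -
  define h where "h c = f i - c + card {j. i < j \<and> c < f j}" for c
  define d where "d j = beta N f i - beta N f j" for j
  have dec: "f j' \<le> f j" if "j \<le> j'" for j j' using antimonoD[OF pbox_antimono[OF f] that] .
  have sub: "{j. i < j \<and> c < f j} \<subseteq> {i<..<N}" for c
  proof
    fix j assume j: "j \<in> {j. i < j \<and> c < f j}"
    then have "\<not> N \<le> j" using pbox_zero[OF f, of j] by auto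
    with j show "j \<in> {i<..<N}" by simp
  qed
  have leg_fin: "finite {j. i < j \<and> c < f j}" for c using sub finite_subset by blast
  have leg_le: "card {j. i < j \<and> c < f j} \<le> N - 1 - i" for c
    using card_mono[OF _ sub[of c]] by simp
  have leg_mono: "card {j. i < j \<and> c' < f j} \<le> card {j. i < j \<and> c < f j}" if "c \<le> c'" for c c'
    using that by (intro card_mono leg_fin) auto
  have hdec: "h c' < h c" if "c < c'" "c' < f i" for c c'
    using leg_mono[of c c'] that by (simp add: h_def)
  have ddec: "d j < d j'" if "i < j" "j < j'" "j' < N" for j j'
    using beta_less[OF pbox_antimono[OF f], of j j' N] beta_less[OF pbox_antimono[OF f], of i j N] that
    by (simp add: d_def)
  have dj: "d j = f i - f j + (j - i)" if "i < j" "j < N" for j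
    using that dec[of i j] by (simp add: d_def beta_def)
  \<comment> \<open>If c < f j, the leg below column c reaches row j and the hook is longer than d
    j; otherwise the leg ends above row j and the hook is shorter.\<close>
  have ne: "h c \<noteq> d j" if "c < f i" "i < j" "j < N" for c j
  proof (cases "c < f j")
    case True
    have "{i<..j} \<subseteq> {j. i < j \<and> c < f j}"
    proof
      fix k assume "k \<in> {i<..j}"
      then show "k \<in> {j. i < j \<and> c < f j}" using True dec[of k j] by simp
    qed
    from card_mono[OF leg_fin this] have "j - i \<le> card {j. i < j \<and> c < f j}" by simp
    then have "d j < h c" using that True dec[of i j] dj[of j] by (simp add: h_def)
    then show ?thesis by simp
  next
    case False
    have "{j. i < j \<and> c < f j} \<subseteq> {i<..<j}"
    proof
      fix k assume k: "k \<in> {j. i < j \<and> c < f j}"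
      then have "\<not> j \<le> k" using dec[of j k] False by auto
      with k show "k \<in> {i<..<j}" by simp
    qed
    from card_mono[OF _ this] have "card {j. i < j \<and> c < f j} \<le> j - i - 1" by simp
    then have "h c < d j" using that False dj[of j] by (simp add: h_def)
    then show ?thesis by simp
  qed
  have injh: "inj_on h {..<f i}" 
  proof (rule inj_onI)
    fix c c' assume "c \<in> {..<f i}" "c' \<in> {..<f i}" "h c = h c'"
    then show "c = c'" using hdec[of c c'] hdec[of c' c] by (cases c c' rule: linorder_cases) auto
  qed
  have injd: "inj_on d {i<..<N}"
  proof (rule inj_onI)
    fix j j' assume "j \<in> {i<..<N}" "j' \<in> {i<..<N}" "d j = d j'"
    then show "j = j'" using ddec[of j j'] ddec[of j' j] by (cases j j' rule: linorder_cases) auto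
  qed
  have disj: "h ` {..<f i} \<inter> d ` {i<..<N} = {}" using ne by auto
  \<comment> \<open>Both sets lie in the interval, are disjoint, and together have f i + (N - 1 - i)
    elements, which is its size.\<close>
  have "h ` {..<f i} \<union> d ` {i<..<N} = {1..beta N f i}"
  proof (rule card_subset_eq)
    show "h ` {..<f i} \<union> d ` {i<..<N} \<subseteq> {1..beta N f i}"
    proof
      fix x assume "x \<in> h ` {..<f i} \<union> d ` {i<..<N}"
      then consider c where "c < f i" "x = h c" | j where "i < j" "j < N" "x = d j" by auto
      then show "x \<in> {1..beta N f i}"
      proof cases
        case 1 then show ?thesis using leg_le[of c] by (auto simp: h_def beta_def)
      next
        case 2 then show ?thesis using dj[of j] by (auto simp: d_def)
      qed
    qed
    have "card (h ` {..<f i} \<union> d ` {i<..<N}) = f i + (N - Suc i)"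
      using disj injh injd by (subst card_Un_disjoint) (auto simp: card_image)
    then show "card (h ` {..<f i} \<union> d ` {i<..<N}) = card {1..beta N f i}"
      by (simp add: beta_def)
  qed simp
  then have "(\<Prod>c=1..beta N f i. \<phi> c) = (\<Prod>x\<in>h ` {..<f i} \<union> d ` {i<..<N}. \<phi> x)" by simp
  also have "\<dots> = (\<Prod>x\<in>h ` {..<f i}. \<phi> x) * (\<Prod>x\<in>d ` {i<..<N}. \<phi> x)"
    using disj by (intro prod.union_disjoint) auto
  also have "\<dots> = (\<Prod>c<f i. \<phi> (h c)) * (\<Prod>j\<in>{i<..<N}. \<phi> (d j))"
    using injh injd by (simp add: prod.reindex)
  finally show ?thesis by (simp add: h_def d_def)
qed

lemma prod_triangle_swap:
  fixes g :: "nat \<Rightarrow> nat \<Rightarrow> 'a::comm_ring_1"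
  shows "(\<Prod>i<n. \<Prod>j<i. g j i) = (\<Prod>j<n. \<Prod>i\<in>{j<..<n}. g j i)"
proof (induction n)
  case (Suc n)
  have "{j<..<Suc n} = insert n {j<..<n}" if "j < n" for j using that by auto
  then have "(\<Prod>j<n. \<Prod>i\<in>{j<..<Suc n}. g j i) = (\<Prod>j<n. g j n * (\<Prod>i\<in>{j<..<n}. g j i))"
    by (intro prod.cong refl) simp
  moreover have "{n<..<Suc n} = {}" by auto
  ultimately show ?case using Suc by (simp add: prod.distrib mult_ac)
qed simp

lemma prod_hook_lengths:
  assumes "length \<mu> \<le> N"
  shows "(\<Prod>h\<in>#hook_lengths \<mu>. \<phi> h) =
     (\<Prod>i<N. \<Prod>c<row_fun \<mu> i. \<phi> (row_fun \<mu> i - c + card {j. i < j \<and> c < row_fun \<mu> j}) :: 'a::comm_ring_1)"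
proof -
  have Y: "young_diagram \<mu> = (SIGMA i:{..<N}. {..<row_fun \<mu> i})"
    using assms by (auto simp: young_diagram_def row_fun_def split: if_splits)
  have "(\<Prod>h\<in>#hook_lengths \<mu>. \<phi> h) = (\<Prod>u\<in>young_diagram \<mu>. \<phi> (hook_length \<mu> u))"
    by (simp add: hook_lengths_def prod_unfold_prod_mset image_mset.compositionality o_def)
  also have "\<dots> = (\<Prod>i<N. \<Prod>c<row_fun \<mu> i. \<phi> (hook_length \<mu> (i, c)))"
    unfolding Y by (subst prod.Sigma) (auto simp: case_prod_unfold)
  also have "\<dots> = (\<Prod>i<N. \<Prod>c<row_fun \<mu> i. \<phi> (row_fun \<mu> i - c + card {j. i < j \<and> c < row_fun \<mu> j}))"
    by (intro prod.cong refl) (simp add: hook_length_rows)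
  finally show ?thesis .
qed

text \<open>The product over c up to a beta number splits into the hooks of a row and the
  differences to later beta numbers; over all rows these differences form exactly the pair product
  \<open>?Q\<close> that accompanies the diagonal entry. In the n by n box all beta numbers are
  below 2 n, so the differences are positive and less than t, and \<open>?Q\<close> can be
  cancelled.\<close>

theorem diag_hooks:
  assumes \<mu>: "\<mu> \<in> partitions_of n" and t: "2 * n \<le> t"
  shows "diag_entry t (row_fun \<mu>) = (\<Prod>h\<in>#hook_lengths \<mu>. 1 - (of_nat t)\<^sup>2 / (of_nat h)\<^sup>2)"
proof -
  let ?f = "row_fun \<mu>" and ?\<phi> = "\<lambda>x. 1 - (of_nat t)\<^sup>2 / (of_nat x)\<^sup>2 :: rat"
  have f: "?f \<in> pbox n n" by (rule row_fun_pbox[OF \<mu> partitions_length[OF \<mu>]])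
  let ?Q = "\<Prod>i<n. \<Prod>j<i. ?\<phi> (beta n ?f j - beta n ?f i)"
  have "diag_entry t ?f * ?Q = (\<Prod>i<n. \<Prod>c=1..beta n ?f i. ?\<phi> c)"
    using t by (intro diag_beta[OF f]) simp
  also have "\<dots> = (\<Prod>i<n. (\<Prod>c<?f i. ?\<phi> (?f i - c + card {j. i < j \<and> c < ?f j})) *
      (\<Prod>j\<in>{i<..<n}. ?\<phi> (beta n ?f i - beta n ?f j)))"
    by (intro prod.cong refl hook_row_product[OF f, of _ ?\<phi>, symmetric]) auto
  also have "\<dots> = (\<Prod>h\<in>#hook_lengths \<mu>. ?\<phi> h) * ?Q"
    unfolding prod.distrib prod_triangle_swap prod_hook_lengths[OF partitions_length[OF \<mu>]] ..
  finally have eq: "diag_entry t ?f * ?Q = (\<Prod>h\<in>#hook_lengths \<mu>. ?\<phi> h) * ?Q" .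
  have "?\<phi> (beta n ?f j - beta n ?f i) \<noteq> 0" if "i < n" "j < i" for i j
  proof -
    have "beta n ?f i < beta n ?f j" "beta n ?f j < t"
      using beta_less[OF pbox_antimono[OF f] that(2,1)] beta_bound[OF f, of j] that t by auto
    then have "0 < beta n ?f j - beta n ?f i" "beta n ?f j - beta n ?f i < t" by auto
    then have "(of_nat (beta n ?f j - beta n ?f i))\<^sup>2 \<noteq> ((of_nat t)\<^sup>2 :: rat)"
      by (metis less_irrefl of_nat_eq_iff of_nat_power power2_eq_imp_eq zero_le)
    with \<open>0 < _\<close> show ?thesis by (simp add: field_simps del: of_nat_diff)
  qed
  then have "?Q \<noteq> 0" by simp
  with eq show ?thesis by simp
qed

section \<open>Generating functions over partitions\<close>

lemma fps_nth_sum_part_size: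
  assumes "n \<le> m"
  shows "fps_nth (\<Sum>f\<in>parts_upto m. fps_X ^ part_size f * fps_const (w f)) n =
     (\<Sum>\<mu>\<in>partitions_of n. w (row_fun \<mu>) :: 'a::comm_ring_1)"
proof -
  have "fps_nth (\<Sum>f\<in>parts_upto m. fps_X ^ part_size f * fps_const (w f)) n =
      (\<Sum>f\<in>parts_upto m. if part_size f = n then w f else 0)"
    by (simp add: fps_sum_nth fps_X_power_mult_nth) (intro sum.cong refl, auto)
  also have "\<dots> = (\<Sum>f | f \<in> parts_upto m \<and> part_size f = n. w f)"
    by (simp add: sum.If_cases finite_parts_upto Int_def)
  also have "\<dots> = (\<Sum>\<mu>\<in>partitions_of n. w (row_fun \<mu>))"
    by (rule sum.reindex_bij_betw[OF row_fun_bij[OF assms], symmetric])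
  finally show ?thesis .
qed

definition partition_gf :: "rat fps" where
  "partition_gf = Abs_fps (\<lambda>n. of_nat (num_partitions n))"

definition euler_prod :: "nat \<Rightarrow> rat fps" where
  "euler_prod a = (\<Prod>j=1..a. 1 - fps_X ^ j)"

lemma partition_gf_upto: "fps_eq_upto m (\<Sum>f\<in>parts_upto m. fps_X ^ part_size f) partition_gf"
  unfolding fps_eq_upto_def
proof (intro allI impI)
  fix i assume "i \<le> m"
  then show "fps_nth (\<Sum>f\<in>parts_upto m. fps_X ^ part_size f) i = fps_nth partition_gf i"
    using fps_nth_sum_part_size[of i m "\<lambda>_. 1 :: rat"] by (simp add: partition_gf_def num_partitions_def)
qed

lemma diag_hooks_gf:
  assumes "n \<le> a" "2 * a \<le> t"
  shows "(\<Sum>\<mu>\<in>partitions_of n. \<Prod>h\<in>#hook_lengths \<mu>. 1 - (of_nat t)\<^sup>2 / (of_nat h)\<^sup>2) =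
     fps_nth (euler_prod a ^ (t * t) * partition_gf) n"
proof -
  have "(\<Sum>\<mu>\<in>partitions_of n. \<Prod>h\<in>#hook_lengths \<mu>. 1 - (of_nat t)\<^sup>2 / (of_nat h)\<^sup>2) =
     (\<Sum>\<mu>\<in>partitions_of n. diag_entry t (row_fun \<mu>))"
    using assms by (intro sum.cong refl diag_hooks[where n = n, symmetric]) auto
  also have "\<dots> = fps_nth (\<Sum>f\<in>parts_upto a. fps_X ^ part_size f * fps_const (diag_entry t f)) n"
    by (rule fps_nth_sum_part_size[OF assms(1), symmetric])
  also have "\<dots> = fps_nth ((\<Prod>j=1..a. (1 - fps_X ^ j) ^ (t * t)) * (\<Sum>f\<in>parts_upto a. fps_X ^ part_size f)) n"
    using diag_generating_function[of a t] assms(1) unfolding fps_eq_upto_def by blast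
  also have "\<dots> = fps_nth (euler_prod a ^ (t * t) * partition_gf) n"
    using fps_eq_upto_mult[OF fps_eq_upto_refl partition_gf_upto[of a], of "euler_prod a ^ (t * t)"] assms(1)
    unfolding fps_eq_upto_def euler_prod_def prod_power_distrib by blast
  finally show ?thesis .
qed

text \<open>At \<open>t = 1\<close> only the empty partition contributes, which yields Euler's product for the
  partition generating function.\<close>

lemma diag_1:
  assumes "f \<in> pbox R C"
  shows "diag_entry 1 f = (if f = (\<lambda>_. 0) then 1 else 0)"
proof (cases "f = (\<lambda>_. 0)")
  case True
  then have "subparts f = {f}" by (auto simp: subparts_def le_fun_def fun_eq_iff monotone_def)
  with True assms show ?thesis
    using chain_hstep_self[OF assms, of "1 :: rat" 1] chain_vstep_self[OF assms, of "- 1 :: rat" 1]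
    by (simp only: diag_entry_def) simp
next
  case False
  \<comment> \<open>The exact number of rows is taken, so that all beta numbers are positive; for s
    = 0 the column factor \<open>0 choose l'\<close> of the kernel identity then vanishes at each of
    them.\<close>
  define N where "N = (LEAST i. f i = 0)"
  have N0: "f N = 0" unfolding N_def by (rule LeastI[of _ R]) (rule pbox_zero[OF assms], simp)
  have nz: "f i \<noteq> 0" if "i < N" for i using that not_less_Least unfolding N_def by blast
  have z: "f i = 0" if "N \<le> i" for i using antimonoD[OF pbox_antimono[OF assms] that] N0 by simp
  have fN: "f \<in> pbox N C" using assms z by (auto simp: pbox_def)
  have "0 < N" using z False by (metis le0 neq0_conv ext)
  let ?K = "\<lambda>l l'. \<Sum>m<N+C. toeplitz (\<lambda>k. of_nat (0 + k choose k)) l m *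
     toeplitz (\<lambda>k. (- 1) ^ k * of_nat (Suc 0 choose k)) l' m :: rat"
  \<comment> \<open>Row 0 has the largest beta number, so \<open>l - l' + 1\<close> is nonzero and
    the identity can be solved for the kernel: a whole row of the matrix is zero. For lower rows
    this factor may vanish, since t = 1 is not large.\<close>
  have zero: "?K (beta N f 0) (beta N f j) = 0" if "j < N" for j
  proof -
    have "beta N f j \<le> beta N f 0"
      using beta_less[OF pbox_antimono[OF assms], of 0 j N] that by (cases "j = 0") auto
    moreover have "0 < beta N f j" using nz[OF that] by (simp add: beta_def)
    ultimately have "of_nat (beta N f 0) - of_nat (beta N f j) + of_nat (Suc 0) \<noteq> (0 :: rat)"
      "(0 choose beta N f j) = 0"
      by (auto simp flip: of_nat_diff simp: binomial_eq_0)
    moreover have "min (beta N f 0) (beta N f j) < N + C" using beta_bound[OF fN that] by simp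
    note kernel_identity[OF this, of 0]
    ultimately show ?thesis by (simp add: binomial_eq_0)
  qed
  have "(\<Prod>i=0..<N. ?K (beta N f i) (beta N f (p i))) = 0" if "p permutes {0..<N}" for p
    using zero[OF permutes_lessThan(1)[OF that \<open>0 < N\<close>]] \<open>0 < N\<close>
    by (intro prod_zero) auto
  then have "diag_entry (Suc 0) f = 0" unfolding diag_toeplitz[OF fN] fdet_leibniz by (intro sum.neutral) auto
  with False show ?thesis by simp
qed

theorem euler_partition_gf: "fps_eq_upto a (euler_prod a * partition_gf) 1"
proof -
  have "fps_nth (\<Sum>f\<in>parts_upto a. fps_X ^ part_size f * fps_const (diag_entry 1 f)) i = fps_nth 1 i" if "i \<le> a" for i
  proof -
    have "(\<Sum>\<mu>\<in>partitions_of i. diag_entry 1 (row_fun \<mu>)) = (\<Sum>\<mu>\<in>partitions_of i. if \<mu> = [] then 1 else 0)"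
    proof (intro sum.cong refl)
      fix \<mu> assume \<mu>: "\<mu> \<in> partitions_of i"
      then have "row_fun \<mu> = (\<lambda>_. 0) \<longleftrightarrow> \<mu> = []"
        by (cases \<mu>) (auto simp: row_fun_def partitions_of_def fun_eq_iff intro!: exI[of _ 0])
      then show "diag_entry 1 (row_fun \<mu>) = (if \<mu> = [] then 1 else 0)"
        using diag_1[OF row_fun_pbox[OF \<mu> le_refl]] by simp
    qed
    also have "\<dots> = (if i = 0 then 1 else 0)"
      by (simp add: finite_partitions_of) (auto simp: partitions_of_def)
    finally show ?thesis using fps_nth_sum_part_size[OF that, of "diag_entry 1"] by simp
  qed
  then have "fps_eq_upto a 1 (\<Sum>f\<in>parts_upto a. fps_X ^ part_size f * fps_const (diag_entry 1 f))"
    by (simp add: fps_eq_upto_def)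
  moreover note diag_generating_function[of a 1]
  moreover have "fps_eq_upto a ((\<Prod>j=1..a. (1 - fps_X ^ j) ^ (1 * 1)) * (\<Sum>f\<in>parts_upto a. fps_X ^ part_size f))
     (euler_prod a * partition_gf)"
    unfolding euler_prod_def by (intro fps_eq_upto_mult partition_gf_upto) simp
  ultimately show ?thesis using fps_eq_upto_trans fps_eq_upto_sym by blast
qed

section \<open>The Nekrasov--Okounkov formula\<close>

lemma poly_eq_if_infinite:
  fixes p q :: "rat poly"
  assumes "inj g" "\<And>t::nat. T \<le> t \<Longrightarrow> poly p (g t) = poly q (g t)"
  shows "p = q"
proof (rule ccontr)
  assume "p \<noteq> q"
  then have "finite {x. poly (p - q) x = 0}" by (intro poly_roots_finite) simp
  moreover have "g ` {T..} \<subseteq> {x. poly (p - q) x = 0}" using assms(2) by auto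
  ultimately have "finite (g ` {T..})" by (rule rev_finite_subset)
  then have "finite {T..}" using assms(1) by (meson finite_imageD inj_on_subset subset_UNIV)
  then show False using infinite_Ici by blast
qed

lemma poly_eq_if_nat:
  fixes p q :: "rat poly"
  assumes "\<And>t::nat. poly p (of_nat t) = poly q (of_nat t)"
  shows "p = q"
  by (rule poly_eq_if_infinite[of of_nat 0]) (auto simp: assms inj_on_def)

section \<open>Rational powers of power series, polynomial in the exponent\<close>

definition binom_poly :: "nat \<Rightarrow> rat poly" where
  "binom_poly m = Polynomial.smult (1 / fact m) (\<Prod>i=0..<m. [:- of_nat i, 1:])"

lemma poly_binom_poly: "poly (binom_poly m) (of_nat z) = of_nat (z choose m)"
  by (simp add: binom_poly_def poly_prod binomial_gbinomial gbinomial_prod_rev)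

text \<open>The coefficient of degree i in the binomial series of (1 + (f - 1))^x, as a polynomial
  in x. If f has constant term 1, the terms with m > i start beyond degree i.\<close>

definition pow_poly :: "rat fps \<Rightarrow> nat \<Rightarrow> rat poly" where
  "pow_poly f i = (\<Sum>m\<le>i. Polynomial.smult (fps_nth ((f - 1) ^ m) i) (binom_poly m))"

text \<open>Since every coefficient is polynomial in x, the laws of powers need to be verified only
  for natural exponents.\<close>

definition fps_rat_pow :: "rat fps \<Rightarrow> rat \<Rightarrow> rat fps" where
  "fps_rat_pow f x = Abs_fps (\<lambda>i. poly (pow_poly f i) x)"

lemma fps_rat_pow_of_nat:
  assumes "fps_nth f 0 = 1"
  shows "fps_rat_pow f (of_nat z) = f ^ z"
proof (rule fps_ext)
  fix i
  let ?g = "f - 1"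
  have zero: "fps_nth (?g ^ m) i = 0" if "i < m" for m
    using assms that by (intro startsby_zero_power_prefix[rule_format]) auto
  have "f ^ z = (?g + 1) ^ z" by simp
  also have "\<dots> = (\<Sum>m\<le>z. of_nat (z choose m) * ?g ^ m)"
    by (subst binomial_ring) simp
  finally have "fps_nth (f ^ z) i = (\<Sum>m\<le>z. of_nat (z choose m) * fps_nth (?g ^ m) i)"
    by (simp add: fps_sum_nth fps_mult_of_nat_nth)
  also have "\<dots> = (\<Sum>m\<le>z + i. of_nat (z choose m) * fps_nth (?g ^ m) i)"
    by (rule sum.mono_neutral_left) (auto simp: binomial_eq_0)
  also have "\<dots> = (\<Sum>m\<le>i. of_nat (z choose m) * fps_nth (?g ^ m) i)"
    by (rule sum.mono_neutral_right) (auto simp: zero)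
  finally show "fps_nth (fps_rat_pow f (of_nat z)) i = fps_nth (f ^ z) i"
    by (simp add: fps_rat_pow_def pow_poly_def poly_sum poly_binom_poly mult.commute)
qed

lemma fps_rat_pow_add_nat:
  assumes "fps_nth f 0 = 1"
  shows "fps_rat_pow f (x + of_nat m) = fps_rat_pow f x * f ^ m"
proof (rule fps_ext)
  fix i
  let ?p = "pcompose (pow_poly f i) [:of_nat m, 1:]"
    and ?q = "\<Sum>j=0..i. pow_poly f j * [:fps_nth (f ^ m) (i - j):]"
  have "?p = ?q"
  proof (rule poly_eq_if_nat)
    fix t
    have "fps_nth (fps_rat_pow f (of_nat (m + t))) i = fps_nth (fps_rat_pow f (of_nat t) * f ^ m) i"
      unfolding fps_rat_pow_of_nat[OF assms] by (simp add: power_add mult.commute)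
    then show "poly ?p (of_nat t) = poly ?q (of_nat t)"
      by (simp add: fps_mult_nth fps_rat_pow_def poly_pcompose poly_sum mult.commute[of "fps_nth (f ^ m) _"])
  qed
  then have "poly ?p x = poly ?q x" by simp
  then show "fps_nth (fps_rat_pow f (x + of_nat m)) i = fps_nth (fps_rat_pow f x * f ^ m) i"
    by (simp add: fps_mult_nth fps_rat_pow_def poly_pcompose poly_sum add.commute mult.commute[of "fps_nth (f ^ m) _"])
qed

text \<open>A second interpolation: x is now a fixed rational and y varies, the natural values of y
  being the preceding law.\<close>

lemma fps_rat_pow_add:
  assumes "fps_nth f 0 = 1"
  shows "fps_rat_pow f (x + y) = fps_rat_pow f x * fps_rat_pow f y"
proof (rule fps_ext)
  fix i
  let ?p = "pcompose (pow_poly f i) [:x, 1:]"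
    and ?q = "\<Sum>j=0..i. Polynomial.smult (poly (pow_poly f j) x) (pow_poly f (i - j))"
  have "?p = ?q"
  proof (rule poly_eq_if_nat)
    fix t
    have "fps_nth (fps_rat_pow f (x + of_nat t)) i = fps_nth (fps_rat_pow f x * fps_rat_pow f (of_nat t)) i"
      unfolding fps_rat_pow_add_nat[OF assms] fps_rat_pow_of_nat[OF assms] ..
    then show "poly ?p (of_nat t) = poly ?q (of_nat t)"
      by (simp add: fps_mult_nth fps_rat_pow_def poly_pcompose poly_sum)
  qed
  then have "poly ?p y = poly ?q y" by simp
  then show "fps_nth (fps_rat_pow f (x + y)) i = fps_nth (fps_rat_pow f x * fps_rat_pow f y) i"
    by (simp add: fps_mult_nth fps_rat_pow_def poly_pcompose poly_sum)
qed

lemma fps_rat_pow_mult: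
  assumes "fps_nth f 0 = 1" "fps_nth g 0 = 1"
  shows "fps_rat_pow (f * g) x = fps_rat_pow f x * fps_rat_pow g x"
proof (rule fps_ext)
  fix i
  let ?q = "\<Sum>j=0..i. pow_poly f j * pow_poly g (i - j)"
  have "pow_poly (f * g) i = ?q"
  proof (rule poly_eq_if_nat)
    fix t
    have "fps_nth (fps_rat_pow (f * g) (of_nat t)) i = fps_nth (fps_rat_pow f (of_nat t) * fps_rat_pow g (of_nat t)) i"
      using assms by (simp add: fps_rat_pow_of_nat power_mult_distrib)
    then show "poly (pow_poly (f * g) i) (of_nat t) = poly ?q (of_nat t)"
      by (simp add: fps_mult_nth fps_rat_pow_def poly_sum)
  qed
  then show "fps_nth (fps_rat_pow (f * g) x) i = fps_nth (fps_rat_pow f x * fps_rat_pow g x) i"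
    by (simp add: fps_mult_nth fps_rat_pow_def poly_sum)
qed

lemma fps_rat_pow_0: "fps_nth f 0 = 1 \<Longrightarrow> fps_rat_pow f 0 = 1"
  using fps_rat_pow_of_nat[of f 0] by simp

lemma fps_rat_pow_1: "fps_nth f 0 = 1 \<Longrightarrow> fps_rat_pow f 1 = f"
  using fps_rat_pow_of_nat[of f 1] by simp

lemma fps_rat_pow_minus:
  assumes "fps_nth f 0 = 1"
  shows "fps_rat_pow f x * fps_rat_pow f (- x) = 1"
  using fps_rat_pow_add[OF assms, of x "- x"] fps_rat_pow_0[OF assms] by simp

lemma powi_fps_rat_pow:
  assumes "fps_nth f 0 = 1"
  shows "f powi k = fps_rat_pow f (of_int k)"
proof (cases "0 \<le> k")
  case True
  then show ?thesis
    using fps_rat_pow_of_nat[OF assms, of "nat k"] by (simp add: power_int_def)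
next
  case False
  have "f ^ nat (- k) * fps_rat_pow f (of_int k) = 1"
    using fps_rat_pow_minus[OF assms, of "of_nat (nat (- k))"] False
    unfolding fps_rat_pow_of_nat[OF assms] by simp
  then have "inverse (f ^ nat (- k)) = fps_rat_pow f (of_int k)"
    by (intro fps_inverse_unique) 
  moreover have "fps_nth (f ^ nat (- k)) 0 \<noteq> 0" using assms by (simp add: fps_power_zeroth)
  ultimately show ?thesis using False by (simp add: power_int_def fps_inverse_power)
qed

lemma fps_rat_pow_nth_0: "fps_nth f 0 = 1 \<Longrightarrow> fps_nth (fps_rat_pow f x) 0 = 1"
  by (simp add: fps_rat_pow_def pow_poly_def binom_poly_def)

lemma one_divide_powi:
  assumes "fps_nth f 0 = 1"
  shows "1 / f powi k = fps_rat_pow f (- of_int k)"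
proof -
  have "inverse (fps_rat_pow f (of_int k)) = fps_rat_pow f (- of_int k)"
    by (intro fps_inverse_unique fps_rat_pow_minus assms)
  then show ?thesis using assms
    by (simp add: powi_fps_rat_pow fps_divide_unit fps_rat_pow_nth_0)
qed

lemma fps_prod_nth_0:
  "(\<And>x. x \<in> A \<Longrightarrow> fps_nth (f x) 0 = 1) \<Longrightarrow> fps_nth (\<Prod>x\<in>A. f x) 0 = (1 :: rat)"
  by (induction A rule: infinite_finite_induct) auto

lemma euler_prod_nth_0: "fps_nth (euler_prod a) 0 = 1"
  unfolding euler_prod_def by (intro fps_prod_nth_0) auto

lemma poly_prod_mset': "poly (\<Prod>h\<in>#M. p h) x = (\<Prod>h\<in>#M. poly (p h) x)"
  by (induction M) auto

text \<open>Interpolation at z = t^2 and evaluation at z = - k give the power - k of the Euler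
  product times the partition generating function. One further Euler factor turns that function into
  1 up to degree a, which moves the exponent to - (k + 1). The finite product suffices because n
  \<le> a.\<close>

theorem nekrasov_okounkov:
  assumes "n \<le> a"
  shows "(\<Sum>\<mu>\<in>partitions_of n. \<Prod>h\<in>#hook_lengths \<mu>. 1 + of_int k / (of_nat h)\<^sup>2) =
         fps_nth (fps_rat_pow (euler_prod a) (- of_int (k + 1))) n"
proof -
  let ?\<Phi> = "euler_prod a"
  define L where "L = (\<Sum>\<mu>\<in>partitions_of n. \<Prod>h\<in>#hook_lengths \<mu>. [:1, - (1 / (of_nat h)\<^sup>2):] :: rat poly)"
  define R where "R = (\<Sum>i=0..n. pow_poly ?\<Phi> i * [:fps_nth partition_gf (n - i):])"
  have L: "poly L z = (\<Sum>\<mu>\<in>partitions_of n. \<Prod>h\<in>#hook_lengths \<mu>. 1 - z / (of_nat h)\<^sup>2)" for z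
    by (simp add: L_def poly_sum poly_prod_mset')
  have R: "poly R z = fps_nth (fps_rat_pow ?\<Phi> z * partition_gf) n" for z
    by (simp add: R_def poly_sum fps_mult_nth fps_rat_pow_def mult.commute[of "fps_nth partition_gf _"])
  have "L = R"
  proof (rule poly_eq_if_infinite)
    show "inj (\<lambda>t. (of_nat t)\<^sup>2 :: rat)"
      by (rule injI) (metis of_nat_eq_iff of_nat_power power2_eq_imp_eq zero_le)
    fix t assume "2 * a \<le> t"
    have "poly R ((of_nat t)\<^sup>2) = fps_nth (?\<Phi> ^ (t * t) * partition_gf) n"
      using fps_rat_pow_of_nat[OF euler_prod_nth_0, of a "t * t"] by (simp add: R power2_eq_square)
    with diag_hooks_gf[OF assms \<open>2 * a \<le> t\<close>] show "poly L ((of_nat t)\<^sup>2) = poly R ((of_nat t)\<^sup>2)"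
      by (simp add: L)
  qed
  have "(\<Sum>\<mu>\<in>partitions_of n. \<Prod>h\<in>#hook_lengths \<mu>. 1 + of_int k / (of_nat h)\<^sup>2) = poly L (- of_int k)"
    by (simp add: L)
  also have "\<dots> = fps_nth (fps_rat_pow ?\<Phi> (- of_int k) * partition_gf) n"
    unfolding \<open>L = R\<close> R ..
  also have "\<dots> = fps_nth (fps_rat_pow ?\<Phi> (- of_int (k + 1)) * (?\<Phi> * partition_gf)) n"
    using fps_rat_pow_add[OF euler_prod_nth_0, of a "- of_int (k + 1)" 1]
    by (simp add: fps_rat_pow_1[OF euler_prod_nth_0] mult.assoc)
  also have "\<dots> = fps_nth (fps_rat_pow ?\<Phi> (- of_int (k + 1)) * 1) n"
    using fps_eq_upto_mult[OF fps_eq_upto_refl euler_partition_gf[of a]] assms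
    unfolding fps_eq_upto_def by blast
  finally show ?thesis by simp
qed

section \<open>The two \<open>q\<close>-series\<close>

lemma infsum_fps_nth:
  fixes f :: "'a \<Rightarrow> rat fps"
  assumes fin: "\<And>N. finite {x\<in>S. e x \<le> (N::nat)}"
    and zero: "\<And>x n. x \<in> S \<Longrightarrow> n < e x \<Longrightarrow> fps_nth (f x) n = 0"
  shows "fps_nth (infsum f S) n = (\<Sum>x | x \<in> S \<and> e x \<le> n. fps_nth (f x) n)"
proof -
  have fin': "finite {x\<in>S. fps_nth (f x) n \<noteq> 0}" for n
    by (rule finite_subset[OF _ fin[of n]]) (use zero not_le in blast)
  then have "(f has_sum Abs_fps (\<lambda>n. \<Sum>x | x \<in> S \<and> fps_nth (f x) n \<noteq> 0. fps_nth (f x) n)) S"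
    by (intro has_sum_fpsI) auto
  then have "infsum f S = Abs_fps (\<lambda>n. \<Sum>x | x \<in> S \<and> fps_nth (f x) n \<noteq> 0. fps_nth (f x) n)"
    by (rule infsumI)
  then have "fps_nth (infsum f S) n = (\<Sum>x | x \<in> S \<and> fps_nth (f x) n \<noteq> 0. fps_nth (f x) n)" by simp
  also have "\<dots> = (\<Sum>x | x \<in> S \<and> e x \<le> n. fps_nth (f x) n)"
    by (rule sum.mono_neutral_left[OF fin]) (use zero not_le in blast, auto)
  finally show ?thesis .
qed

lemma fps_eq_upto_prod:
  "(\<And>x. x \<in> A \<Longrightarrow> fps_eq_upto n (f x) (g x)) \<Longrightarrow> fps_eq_upto n (\<Prod>x\<in>A. f x) (\<Prod>x\<in>A. g x)"
  by (induction A rule: infinite_finite_induct) (auto intro: fps_eq_upto_mult)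

lemma one_mod_fps_eq_upto:
  "fps_X ^ N dvd f - (1 :: rat fps) \<Longrightarrow> n < N \<Longrightarrow> fps_eq_upto n f 1"
  using one_mod_nth[of N f] by (auto simp: fps_eq_upto_def)

text \<open>The factors from index a on are 1 modulo X^(a+1), so they do not affect degrees up to
  a.\<close>

lemma prodinf_fps_eq_upto:
  fixes f :: "nat \<Rightarrow> rat fps"
  assumes f: "\<And>i. fps_X ^ Suc i dvd f i - 1"
  shows "fps_eq_upto a (prodinf f) (\<Prod>i<a. f i)"
proof -
  have stable: "fps_eq_upto b (\<Prod>i<m. f i) (\<Prod>i<b. f i)" if "b \<le> m" for b m
  proof -
    have "fps_eq_upto b (f i) 1" if "i \<in> {b..<m}" for i
      using that by (intro one_mod_fps_eq_upto[OF f]) auto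
    then have "fps_eq_upto b ((\<Prod>i<b. f i) * (\<Prod>i\<in>{b..<m}. f i)) ((\<Prod>i<b. f i) * (\<Prod>i\<in>{b..<m}. 1))"
      by (intro fps_eq_upto_mult fps_eq_upto_prod fps_eq_upto_refl)
    moreover have "(\<Prod>i<m. f i) = (\<Prod>i<b. f i) * (\<Prod>i\<in>{b..<m}. f i)"
      using that by (subst prod.union_disjoint[symmetric]) (auto intro: prod.cong)
    ultimately show ?thesis by simp
  qed
  define L where "L = Abs_fps (\<lambda>n. fps_nth (\<Prod>i<n. f i) n)"
  have "(\<lambda>m. \<Prod>i\<le>m. f i) \<longlonglongrightarrow> L"
  proof (rule tendsto_fpsI)
    fix n
    have "fps_nth (\<Prod>i\<le>m. f i) n = fps_nth L n" if "n \<le> m" for m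
      using stable[of n "Suc m"] that by (simp add: L_def fps_eq_upto_def lessThan_Suc_atMost)
    then show "eventually (\<lambda>m. fps_nth (\<Prod>i\<le>m. f i) n = fps_nth L n) sequentially"
      by (auto simp: eventually_sequentially)
  qed
  moreover have "fps_nth L 0 = 1" by (simp add: L_def)
  then have "L \<noteq> 0" by auto
  ultimately have "f has_prod L" by (simp add: has_prod_def raw_has_prod_def)
  \<comment> \<open>\<open>prodinf\<close> is a definite description, so uniqueness is needed too.
    The variant of \<open>has_prod\<close> with a zero factor is excluded because every factor has
    constant term 1.\<close>
  moreover have "p = L" if "f has_prod p" for p
  proof -
    have "fps_nth (f i) 0 = 1" for i using one_mod_nth[OF f, of 0] by simp
    then have "f i \<noteq> 0" for i by (metis fps_zero_nth zero_neq_one)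
    with that have "(\<lambda>m. \<Prod>i\<le>m. f i) \<longlonglongrightarrow> p" by (simp add: has_prod_def raw_has_prod_def)
    then show ?thesis using \<open>(\<lambda>m. \<Prod>i\<le>m. f i) \<longlonglongrightarrow> L\<close> by (rule LIMSEQ_unique)
  qed
  ultimately have "prodinf f = L" unfolding prodinf_def by (rule the_equality)
  moreover have "fps_nth L n = fps_nth (\<Prod>i<a. f i) n" if "n \<le> a" for n
    using stable[OF that] by (simp add: L_def fps_eq_upto_def)
  ultimately show ?thesis by (simp add: fps_eq_upto_def)
qed

section \<open>Increasing tuples as shifted partitions\<close>

text \<open>The row index is reversed because rows decrease while tuples increase: the first row is
  added to the last entry.\<close>

definition tuple_of :: "nat \<Rightarrow> (nat \<Rightarrow> nat) \<Rightarrow> nat list" where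
  "tuple_of a f = map (\<lambda>i. f (a - 1 - i) + Suc i) [0..<a]"

definition bounded_rows :: "nat \<Rightarrow> (nat \<Rightarrow> nat) set" where
  "bounded_rows a = {f. antimono f \<and> (\<forall>i\<ge>a. f i = 0)}"

lemma bounded_rows_pbox: "f \<in> bounded_rows a \<Longrightarrow> f \<in> pbox a (f 0)"
  by (simp add: bounded_rows_def pbox_def)

lemma tuple_of_bij: "bij_betw (tuple_of a) (bounded_rows a) (incr_tuples a)"
proof (rule bij_betw_imageI)
  show "inj_on (tuple_of a) (bounded_rows a)"
  proof (rule inj_onI)
    fix f g assume fg: "f \<in> bounded_rows a" "g \<in> bounded_rows a" "tuple_of a f = tuple_of a g"
    show "f = g"
    proof
      fix j show "f j = g j"
      proof (cases "j < a")
        case True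
        then have "tuple_of a f ! (a - 1 - j) = tuple_of a g ! (a - 1 - j)" using fg(3) by simp
        then show ?thesis using True by (simp add: tuple_of_def)
      qed (use fg in \<open>simp add: bounded_rows_def\<close>)
    qed
  qed
  show "tuple_of a ` bounded_rows a = incr_tuples a"
  proof (intro equalityI subsetI)
    fix ns assume "ns \<in> tuple_of a ` bounded_rows a"
    then obtain f where f: "f \<in> bounded_rows a" "ns = tuple_of a f" by auto
    have "f (a - 1 - i) + Suc i < f (a - 1 - j) + Suc j" if "i < j" "j < a" for i j
    proof -
      have "a - 1 - j \<le> a - 1 - i" using that by simp
      then have "f (a - 1 - i) \<le> f (a - 1 - j)" using f(1) by (auto simp: bounded_rows_def dest: antimonoD)
      with that show ?thesis by simp
    qed
    then show "ns \<in> incr_tuples a"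
      unfolding f(2) by (auto simp: incr_tuples_def tuple_of_def sorted_wrt_iff_nth_less)
  next
    fix ns assume ns: "ns \<in> incr_tuples a"
    have len: "length ns = a" using ns by (simp add: incr_tuples_def)
    have inc: "ns ! i < ns ! j" if "i < j" "j < a" for i j
      using ns that by (auto simp: incr_tuples_def sorted_wrt_iff_nth_less)
    have ge: "Suc i \<le> ns ! i" if "i < a" for i
      using that
    proof (induction i)
      case 0 then show ?case using ns by (auto simp: incr_tuples_def)
    next
      case (Suc i) then show ?case using inc[of i "Suc i"] by simp
    qed
    define f where "f j = (if j < a then ns ! (a - 1 - j) - (a - j) else 0)" for j
    have "f (Suc j) \<le> f j" for j
    proof (cases "Suc j < a")
      case True
      then obtain k where k: "a = k + Suc (Suc j)" by (metis Suc_leI le_Suc_ex add.commute)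
      then show ?thesis using inc[of k "Suc k"] ge[of k] ge[of "Suc k"] by (simp add: f_def)
    qed (simp add: f_def)
    then have "f \<in> bounded_rows a" by (simp add: bounded_rows_def antimono_iff_le_Suc f_def)
    moreover have "tuple_of a f = ns"
    proof (rule nth_equalityI)
      fix i assume "i < length (tuple_of a f)"
      then have "i < a" by (simp add: tuple_of_def)
      then show "tuple_of a f ! i = ns ! i" using ge[of i] by (simp add: tuple_of_def f_def)
    qed (simp add: tuple_of_def len)
    ultimately show "ns \<in> tuple_of a ` bounded_rows a" by force
  qed
qed

lemma sum_list_tuple_of: "(\<Sum>n\<leftarrow>tuple_of a f. h n) = (\<Sum>i<a. h (f (a - 1 - i) + Suc i) :: nat)"
  by (simp add: tuple_of_def o_def interv_sum_list_conv_sum_set_nat atLeast0LessThan)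

lemma sum_tuple_of:
  assumes "f \<in> bounded_rows a"
  shows "sum_list (tuple_of a f) = part_size f + (\<Sum>i<a. Suc i)"
proof -
  have "sum_list (tuple_of a f) = (\<Sum>i<a. f (a - 1 - i)) + (\<Sum>i<a. Suc i)"
    using sum_list_tuple_of[of "\<lambda>n. n" a f] by (simp only: sum.distrib list.map_ident)
  also have "(\<Sum>i<a. f (a - 1 - i)) = (\<Sum>i<a. f i)"
    using sum.nat_diff_reindex[of f a] by (simp add: diff_diff_add)
  also have "\<dots> = part_size f" using part_size_pbox[OF bounded_rows_pbox[OF assms]] by simp
  finally show ?thesis .
qed

definition inv_factor :: "int \<Rightarrow> nat \<Rightarrow> rat fps" where
  "inv_factor k n = 1 / (1 - fps_X ^ n) powi k"

lemma inv_factor_mod: "0 < n \<Longrightarrow> fps_X ^ n dvd inv_factor k n - 1"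
  unfolding inv_factor_def by (intro one_mod_one_divide one_mod_powi one_mod_factor) auto

lemma divide_denominator:
  assumes "\<forall>n\<in>set ns. 1 \<le> n"
  shows "fps_X ^ m / (\<Prod>n\<leftarrow>ns. (1 - fps_X ^ n) powi k) = fps_X ^ m * (\<Prod>n\<leftarrow>ns. inv_factor k n)"
proof -
  have "inverse (\<Prod>n\<leftarrow>ns. (1 - fps_X ^ n) powi k) = (\<Prod>n\<leftarrow>ns. inv_factor k n)"
    using assms by (induction ns) (auto simp: fps_inverse_mult inv_factor_def fps_divide_unit factor_powi_nth_0)
  then show ?thesis using denominator_nth_0[OF assms] by (simp add: fps_divide_unit)
qed

definition base_prod :: "nat \<Rightarrow> int \<Rightarrow> rat fps" where
  "base_prod a k = (\<Prod>i<a. inv_factor k (Suc i))"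

lemma prod_tuple_of: "(\<Prod>n\<leftarrow>tuple_of a f. h n) = (\<Prod>i<a. h (f (a - 1 - i) + Suc i) :: rat fps)"
proof -
  have "(\<Prod>n\<leftarrow>map g [0..<m]. h n) = (\<Prod>i<m. h (g i))" for g m
    by (induction m) (auto simp: mult.commute)
  then show ?thesis unfolding tuple_of_def .
qed

text \<open>A tuple of excess \<open>e\<close> over \<open>1, \<dots>, a\<close> can only differ from it in the last \<open>e\<close> entries.\<close>

lemma tuple_prod_upto:
  assumes f: "f \<in> bounded_rows a" and e: "part_size f \<le> a"
  shows "fps_eq_upto (a - part_size f) (\<Prod>n\<leftarrow>tuple_of a f. inv_factor k n) (base_prod a k)"
  unfolding prod_tuple_of base_prod_def
proof (rule fps_eq_upto_prod)
  fix i assume "i \<in> {..<a}"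
  then have i: "i < a" by simp
  show "fps_eq_upto (a - part_size f) (inv_factor k (f (a - 1 - i) + Suc i)) (inv_factor k (Suc i))"
  proof (cases "f (a - 1 - i) = 0")
    case False
    \<comment> \<open>A nonempty row a - 1 - i forces more than a - 1 - i cells, so i is so large
      that both factors are 1 in the degrees considered.\<close>
    then have "a - 1 - i < part_size f" by (rule part_size_ge(2)[OF bounded_rows_pbox[OF f]])
    then have "a - part_size f < Suc i" using i by simp
    then have "fps_eq_upto (a - part_size f) (inv_factor k (f (a - 1 - i) + Suc i)) 1"
      "fps_eq_upto (a - part_size f) (inv_factor k (Suc i)) 1"
      by (auto intro!: one_mod_fps_eq_upto[OF inv_factor_mod])
    then show ?thesis using fps_eq_upto_trans fps_eq_upto_sym by blast
  qed simp
qed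

lemma finite_incr_tuples_weight:
  fixes w :: "nat list \<Rightarrow> nat"
  assumes "\<And>ns. sum_list ns \<le> w ns"
  shows "finite {ns \<in> incr_tuples a. w ns \<le> N}"
  by (rule finite_subset[OF _ finite_lists_bounded_sum[of a N]])
     (use assms order_trans in \<open>auto simp: incr_tuples_def\<close>)

text \<open>Serves both series, w being the exponent in the numerator; its lower bound makes the sum
  locally finite.\<close>

lemma series_nth:
  fixes w :: "nat list \<Rightarrow> nat"
  assumes w: "\<And>ns. sum_list ns \<le> w ns"
  shows "fps_nth (\<Sum>\<^sub>\<infinity>ns\<in>incr_tuples a. fps_X ^ w ns / (\<Prod>n\<leftarrow>ns. (1 - fps_X ^ n) powi k)) n =
    (\<Sum>f | f \<in> bounded_rows a \<and> w (tuple_of a f) \<le> n.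
       fps_nth (\<Prod>n\<leftarrow>tuple_of a f. inv_factor k n) (n - w (tuple_of a f)))"
proof -
  let ?F = "\<lambda>ns. fps_X ^ w ns / (\<Prod>n\<leftarrow>ns. (1 - fps_X ^ n) powi k) :: rat fps"
  have F: "?F ns = fps_X ^ w ns * (\<Prod>n\<leftarrow>ns. inv_factor k n)" if "ns \<in> incr_tuples a" for ns
    using that by (intro divide_denominator) (auto simp: incr_tuples_def)
  have "fps_nth (infsum ?F (incr_tuples a)) n =
      (\<Sum>ns | ns \<in> incr_tuples a \<and> w ns \<le> n. fps_nth (?F ns) n)"
    using finite_incr_tuples_weight[OF w]
    by (rule infsum_fps_nth) (simp add: F fps_X_power_mult_nth)
  also have "\<dots> = (\<Sum>ns | ns \<in> incr_tuples a \<and> w ns \<le> n. fps_nth (\<Prod>n\<leftarrow>ns. inv_factor k n) (n - w ns))"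
    by (intro sum.cong refl) (auto simp: F fps_X_power_mult_nth)
  also have "\<dots> = (\<Sum>f | f \<in> bounded_rows a \<and> w (tuple_of a f) \<le> n.
       fps_nth (\<Prod>n\<leftarrow>tuple_of a f. inv_factor k n) (n - w (tuple_of a f)))"
  proof (rule sum.reindex_bij_betw[symmetric])
    show "bij_betw (tuple_of a) {f. f \<in> bounded_rows a \<and> w (tuple_of a f) \<le> n} {ns. ns \<in> incr_tuples a \<and> w ns \<le> n}"
      using tuple_of_bij[of a] by (auto simp: bij_betw_def inj_on_def)
  qed
  finally show ?thesis .
qed

lemma bounded_rows_upto: "{f \<in> bounded_rows a. part_size f \<le> a} = parts_upto a"
  by (auto simp: parts_upto_def intro: parts_uptoI[OF bounded_rows_pbox, unfolded parts_upto_def, THEN CollectD, THEN conjunct1])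
     (auto simp: bounded_rows_def pbox_def)

text \<open>A partition f contributes from degree w0 + r |f| on, where w0 belongs to the tuple 1,
  ..., a. At degree w0 + n its product is read only up to degree n - r |f| \<le> a - |f|, where it
  agrees with the product for 1, ..., a.\<close>

lemma A_series_nth:
  assumes "1 \<le> r"
  shows "n < r * (\<Sum>i<a. Suc i) \<Longrightarrow> fps_nth (A_series a k r) n = 0"
    and "n \<le> a \<Longrightarrow> fps_nth (A_series a k r) (r * (\<Sum>i<a. Suc i) + n) =
       fps_nth ((\<Sum>f\<in>parts_upto a. fps_X ^ (r * part_size f)) * base_prod a k) n"
proof -
  let ?w0 = "r * (\<Sum>i<a. Suc i)"
  let ?U = "\<lambda>f. \<Prod>n\<leftarrow>tuple_of a f. inv_factor k n"
  have ser: "fps_nth (A_series a k r) m =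
     (\<Sum>f | f \<in> bounded_rows a \<and> r * sum_list (tuple_of a f) \<le> m. fps_nth (?U f) (m - r * sum_list (tuple_of a f)))" for m
    using series_nth[where w = "\<lambda>ns. r * sum_list ns" and a = a and k = k and n = m] assms by (simp add: A_series_def A_term_def)
  have w: "r * sum_list (tuple_of a f) = ?w0 + r * part_size f" if "f \<in> bounded_rows a" for f
    using sum_tuple_of[OF that] by (simp add: algebra_simps)
  show "fps_nth (A_series a k r) n = 0" if "n < ?w0"
    unfolding ser by (rule sum.neutral) (use w that in auto)
  assume n: "n \<le> a"
  have ps: "part_size f \<le> n" if "r * part_size f \<le> n" for f using that assms by (cases r) auto
  have "fps_nth (A_series a k r) (?w0 + n) =
     (\<Sum>f | f \<in> bounded_rows a \<and> r * part_size f \<le> n. fps_nth (?U f) (n - r * part_size f))"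
    unfolding ser by (rule sum.cong) (use w in auto)
  also have "\<dots> = (\<Sum>f | f \<in> bounded_rows a \<and> r * part_size f \<le> n. fps_nth (base_prod a k) (n - r * part_size f))"
  proof (intro sum.cong refl)
    fix f assume "f \<in> {f. f \<in> bounded_rows a \<and> r * part_size f \<le> n}"
    then have f: "f \<in> bounded_rows a" "r * part_size f \<le> n" by auto
    have "part_size f \<le> r * part_size f" using assms by simp
    then have "n - r * part_size f \<le> a - part_size f" "part_size f \<le> a" using n f(2) by linarith+
    then show "fps_nth (?U f) (n - r * part_size f) = fps_nth (base_prod a k) (n - r * part_size f)"
      using tuple_prod_upto[OF f(1), of k] by (simp add: fps_eq_upto_def)
  qed
  also have "\<dots> = (\<Sum>f\<in>parts_upto a. fps_nth (fps_X ^ (r * part_size f) * base_prod a k) n)"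
    unfolding bounded_rows_upto[symmetric]
  proof (rule sum.mono_neutral_cong_left)
    show "finite {f \<in> bounded_rows a. part_size f \<le> a}" by (simp add: bounded_rows_upto finite_parts_upto)
    show "{f. f \<in> bounded_rows a \<and> r * part_size f \<le> n} \<subseteq> {f \<in> bounded_rows a. part_size f \<le> a}"
      using ps n le_trans by blast
  qed (auto simp: fps_X_power_mult_nth)
  finally show "fps_nth (A_series a k r) (?w0 + n) =
       fps_nth ((\<Sum>f\<in>parts_upto a. fps_X ^ (r * part_size f)) * base_prod a k) n"
    by (simp add: sum_distrib_right fps_sum_nth)
qed

text \<open>Here only the tuple 1, ..., a matters: any other tuple has last entry at least a + 1,
  and its square alone raises the exponent by at least r (2 a + 1) > a. Therefore no sum over
  partitions remains, unlike in the linear case.\<close>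

lemma B_series_nth:
  fixes a r s :: nat
  assumes "1 \<le> r" "1 \<le> s"
  defines "w0 \<equiv> r * (\<Sum>i<a. (Suc i)\<^sup>2) + s * (\<Sum>i<a. Suc i)"
  shows "n < w0 \<Longrightarrow> fps_nth (B_series a k r s) n = 0"
    and "n \<le> a \<Longrightarrow> fps_nth (B_series a k r s) (w0 + n) = fps_nth (base_prod a k) n"
proof -
  let ?W = "\<lambda>ns. r * (\<Sum>n\<leftarrow>ns. n\<^sup>2) + s * sum_list ns"
  let ?U = "\<lambda>f. \<Prod>n\<leftarrow>tuple_of a f. inv_factor k n"
  have le: "sum_list ns \<le> ?W ns" for ns using assms(2) by (simp add: trans_le_add2)
  have ser: "fps_nth (B_series a k r s) m =
     (\<Sum>f | f \<in> bounded_rows a \<and> ?W (tuple_of a f) \<le> m. fps_nth (?U f) (m - ?W (tuple_of a f)))" for m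
    using series_nth[where w = ?W and a = a and k = k and n = m, OF le] by (simp add: B_series_def B_term_def)
  have sq: "(\<Sum>n\<leftarrow>tuple_of a f. n\<^sup>2) = (\<Sum>i<a. (f (a - 1 - i) + Suc i)\<^sup>2)" for f
    by (rule sum_list_tuple_of)
  have wle: "w0 \<le> ?W (tuple_of a f)" if "f \<in> bounded_rows a" for f
    unfolding sq w0_def sum_tuple_of[OF that]
    by (intro add_mono mult_left_mono sum_mono power_mono) auto
  show "fps_nth (B_series a k r s) n = 0" if "n < w0"
    
  proof -
    have "{f. f \<in> bounded_rows a \<and> ?W (tuple_of a f) \<le> n} = {}"
      using less_le_trans[OF that wle] by (auto simp: not_le)
    then show ?thesis unfolding ser by (simp only: sum.empty)
  qed
  have wgt: "w0 + a < ?W (tuple_of a f)" if f: "f \<in> bounded_rows a" "f \<noteq> (\<lambda>_. 0)" for f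
  proof -
    obtain i where "f i \<noteq> 0" using f(2) by auto
    then have f0: "f 0 \<noteq> 0" using antimonoD[of f 0 i] f(1) by (auto simp: bounded_rows_def)
    then have "a \<noteq> 0" using f(1) by (auto simp: bounded_rows_def)
    then obtain b where b: "a = Suc b" by (cases a) auto
    have "(\<Sum>i<a. (Suc i)\<^sup>2) + a < (\<Sum>i<a. (f (a - 1 - i) + Suc i)\<^sup>2)"
    proof -
      have "(\<Sum>i<b. (Suc i)\<^sup>2) \<le> (\<Sum>i<b. (f (a - 1 - i) + Suc i)\<^sup>2)"
        by (intro sum_mono power_mono) auto
      moreover have "(Suc b)\<^sup>2 + a < (f 0 + Suc b)\<^sup>2"
      proof -
        have "(Suc b)\<^sup>2 + a < (1 + Suc b)\<^sup>2" using b by (simp add: power2_eq_square)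
        also have "\<dots> \<le> (f 0 + Suc b)\<^sup>2" using f0 by (intro power_mono) auto
        finally show ?thesis .
      qed
      ultimately show ?thesis by (simp add: b)
    qed
    then have "(\<Sum>i<a. (Suc i)\<^sup>2) + a + 1 \<le> (\<Sum>i<a. (f (a - 1 - i) + Suc i)\<^sup>2)" by simp
    then have "r * ((\<Sum>i<a. (Suc i)\<^sup>2) + a + 1) \<le> r * (\<Sum>i<a. (f (a - 1 - i) + Suc i)\<^sup>2)"
      by (rule mult_le_mono2)
    moreover have "1 * (a + 1) \<le> r * (a + 1)" using assms(1) by (rule mult_le_mono1)
    then have "r * (\<Sum>i<a. (Suc i)\<^sup>2) + (a + 1) \<le> r * ((\<Sum>i<a. (Suc i)\<^sup>2) + a + 1)"
      unfolding add.assoc add_mult_distrib2[of r "\<Sum>i<a. (Suc i)\<^sup>2"] by simp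
    moreover have "s * (\<Sum>i<a. Suc i) \<le> s * sum_list (tuple_of a f)"
      unfolding sum_tuple_of[OF f(1)] by (intro mult_left_mono) auto
    ultimately show ?thesis unfolding sq w0_def by linarith
  qed
  assume n: "n \<le> a"
  have zero: "(\<lambda>_. 0) \<in> bounded_rows a" by (simp add: bounded_rows_def monotone_def)
  have w0': "?W (tuple_of a (\<lambda>_. 0)) = w0"
    using sum_tuple_of[OF zero] unfolding sq w0_def by (simp add: part_size_def)
  have "{f. f \<in> bounded_rows a \<and> ?W (tuple_of a f) \<le> w0 + n} = {\<lambda>_. 0}"
  proof (intro equalityI subsetI)
    fix f assume "f \<in> {f. f \<in> bounded_rows a \<and> ?W (tuple_of a f) \<le> w0 + n}"
    then show "f \<in> {\<lambda>_. 0}" using wgt[of f] n by fastforce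
  qed (use zero w0' in simp)
  then have "fps_nth (B_series a k r s) (w0 + n) = fps_nth (?U (\<lambda>_. 0)) n"
    unfolding ser by (simp add: w0')
  then show "fps_nth (B_series a k r s) (w0 + n) = fps_nth (base_prod a k) n"
    by (simp add: prod_tuple_of base_prod_def)
qed

lemma base_prod_eq: "base_prod a k = fps_rat_pow (euler_prod a) (- of_int k)"
proof (induction a)
  case 0
  have "(1 :: rat fps) powi (- k) = 1" by (auto simp: power_int_def)
  then have "fps_rat_pow 1 (- of_int k) = 1" using powi_fps_rat_pow[of 1 "- k"] by simp
  then show ?case by (simp add: base_prod_def euler_prod_def)
next
  case (Suc a)
  have "euler_prod (Suc a) = euler_prod a * (1 - fps_X ^ Suc a)" by (simp add: euler_prod_def)
  moreover have "fps_nth (1 - fps_X ^ Suc a :: rat fps) 0 = 1" by (simp del: power_Suc)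
  ultimately show ?case
    using Suc by (simp add: base_prod_def inv_factor_def one_divide_powi fps_rat_pow_mult euler_prod_nth_0 del: power_Suc)
qed

section \<open>Euler's identity in q^r\<close>

lemma fps_compose_X_power_nth:
  assumes "1 \<le> r"
  shows "fps_nth (f oo fps_X ^ r) n = (if r dvd n then fps_nth f (n div r) else (0 :: rat))"
proof -
  have eq: "fps_nth ((fps_X ^ r) ^ i) n = (if n = r * i then 1 else (0::rat))" for i
    by (simp flip: power_mult) 
  have "fps_nth (f oo fps_X ^ r) n = (\<Sum>i=0..n. if i = n div r \<and> r dvd n then fps_nth f i else 0)"
    unfolding fps_compose_nth eq using assms by (intro sum.cong) auto
  also have "\<dots> = (if r dvd n then fps_nth f (n div r) else 0)"
    by (auto simp: sum.delta)
  finally show ?thesis .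
qed

lemma fps_X_power_compose:
  assumes "1 \<le> r"
  shows "(fps_X ^ j) oo (fps_X ^ r) = (fps_X ^ (r * j) :: rat fps)"
proof -
  have X0: "fps_nth (fps_X ^ r) 0 = (0::rat)" using assms by simp
  show ?thesis
    using fps_compose_power[OF X0, of fps_X j] fps_X_fps_compose_startby0[OF X0] by (simp add: power_mult)
qed

text \<open>Substituting q^r for q preserves the truncation, since coefficient i of the result is
  either 0 or coefficient i div r \<le> a of the original.\<close>

lemma euler_power_gf:
  assumes "1 \<le> r"
  shows "fps_eq_upto a ((\<Prod>j=1..a. 1 - fps_X ^ (r * j)) * (\<Sum>f\<in>parts_upto a. fps_X ^ (r * part_size f))) (1 :: rat fps)"
proof -
  let ?P = "\<Sum>f\<in>parts_upto a. fps_X ^ part_size f :: rat fps"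
  have X0: "fps_nth (fps_X ^ r) 0 = (0::rat)" using assms by simp
  have "(euler_prod a * ?P) oo (fps_X ^ r) =
      (\<Prod>j=1..a. 1 - fps_X ^ (r * j)) * (\<Sum>f\<in>parts_upto a. fps_X ^ (r * part_size f))"
    unfolding fps_compose_mult_distrib[OF X0] euler_prod_def fps_compose_prod_distrib[OF X0]
      fps_compose_sum_distrib fps_compose_sub_distrib fps_X_power_compose[OF assms] by simp
  moreover have "fps_eq_upto a (euler_prod a * ?P) 1"
    using fps_eq_upto_trans[OF fps_eq_upto_mult[OF fps_eq_upto_refl partition_gf_upto] euler_partition_gf] .
  then have "fps_eq_upto a ((euler_prod a * ?P) oo (fps_X ^ r)) 1"
    unfolding fps_eq_upto_def fps_compose_X_power_nth[OF assms]
  proof (intro allI impI)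
    fix i assume P: "\<forall>i\<le>a. fps_nth (euler_prod a * ?P) i = fps_nth 1 i" and "i \<le> a"
    then have "i div r \<le> a" using div_le_dividend le_trans by blast
    with P have "fps_nth (euler_prod a * ?P) (i div r) = fps_nth 1 (i div r)" by blast
    then show "(if r dvd i then fps_nth (euler_prod a * ?P) (i div r) else 0) = fps_nth 1 i"
      using assms by (auto simp: dvd_div_eq_0_iff)
  qed
  ultimately show ?thesis by simp
qed

section \<open>Leading exponents and comparison with the infinite products\<close>

text \<open>The negative power of q places the equation in the Laurent series; the vanishing low
  coefficients make the quotient a power series, and E is its difference from R.\<close>

lemma shifted_series:
  assumes low: "\<And>n. n < m \<Longrightarrow> fps_nth A n = 0"
    and high: "\<And>n. n \<le> a \<Longrightarrow> fps_nth A (m + n) = fps_nth R n"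
  shows "\<exists>E\<in>big_O_q (a + 1). fls_X powi (- int m) * fps_to_fls A = fps_to_fls (R + E)"
proof
  define A' where "A' = Abs_fps (\<lambda>n. fps_nth A (m + n))"
  have "A = fps_X ^ m * A'"
    by (rule fps_ext) (simp add: A'_def fps_X_power_mult_nth low)
  then have "fps_to_fls A = fls_X ^ m * fps_to_fls A'"
    by (simp add: fls_times_fps_to_fls fps_to_fls_power)
  moreover have "fls_X powi (- int m) * fls_X ^ m = (1 :: rat fls)"
    by (simp add: power_int_minus)
  ultimately show "fls_X powi (- int m) * fps_to_fls A = fps_to_fls (R + (A' - R))"
    by (simp add: mult.assoc[symmetric])
  show "A' - R \<in> big_O_q (a + 1)" using high by (simp add: big_O_q_def A'_def)
qed

lemma sum_Suc_lessThan: "2 * (\<Sum>i<a. Suc i) = a * (a + 1)"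
  by (induction a) auto

lemma sum_Suc_square_lessThan: "6 * (\<Sum>i<a. (Suc i)\<^sup>2) = a * (a + 1) * (2 * a + 1)"
  by (induction a) (auto simp: power2_eq_square algebra_simps)

text \<open>The exponent of the tuple 1, ..., a. The numerator is twice the right-hand side, so the
  \<open>div\<close> in the exponent rounds nothing off.\<close>

lemma A_leading_exponent: "r * a * (a + 1) div 2 = r * (\<Sum>i<a. Suc i)"
proof -
  have "r * a * (a + 1) = 2 * (r * (\<Sum>i<a. Suc i))"
    using sum_Suc_lessThan[of a] by (simp add: algebra_simps)
  then show ?thesis by simp
qed

lemma B_leading_exponent:
  "a * (a + 1) * (r + 2 * a * r + 3 * s) div 6 = r * (\<Sum>i<a. (Suc i)\<^sup>2) + s * (\<Sum>i<a. Suc i)"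
proof -
  have "6 * (r * (\<Sum>i<a. (Suc i)\<^sup>2) + s * (\<Sum>i<a. Suc i)) =
      r * (6 * (\<Sum>i<a. (Suc i)\<^sup>2)) + 3 * s * (2 * (\<Sum>i<a. Suc i))"
    by (simp only: algebra_simps)
  also have "\<dots> = a * (a + 1) * (r + 2 * a * r + 3 * s)"
    unfolding sum_Suc_lessThan sum_Suc_square_lessThan by (simp add: algebra_simps)
  finally show ?thesis by (metis nonzero_mult_div_cancel_left zero_neq_numeral)
qed

text \<open>Euler's identity in q^r identifies the sum over partitions with the inverse of the
  finite product \<open>?D\<close> up to degree a.\<close>

lemma A_product:
  assumes "1 \<le> r"
  shows "fps_eq_upto a (\<Prod>n. 1 / ((1 - fps_X ^ (r * Suc n)) * (1 - fps_X ^ Suc n) powi k))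
    ((\<Sum>f\<in>parts_upto a. fps_X ^ (r * part_size f)) * base_prod a k)"
proof -
  let ?f = "\<lambda>n. 1 / ((1 - fps_X ^ (r * Suc n)) * (1 - fps_X ^ Suc n) powi k) :: rat fps"
  let ?Q = "\<Sum>f\<in>parts_upto a. fps_X ^ (r * part_size f) :: rat fps"
  let ?D = "\<Prod>j=1..a. 1 - fps_X ^ (r * j) :: rat fps"
  have rn: "Suc n \<le> r * Suc n" for n using assms by (cases r) auto
  have c1: "fps_nth (1 - fps_X ^ (r * Suc n) :: rat fps) 0 = 1" for n using assms by (simp del: power_Suc mult_Suc_right)
  have c2: "fps_nth ((1 - fps_X ^ Suc n :: rat fps) powi k) 0 = 1" for n by (intro factor_powi_nth_0) simp
  have f: "?f n = inverse (1 - fps_X ^ (r * Suc n)) * inv_factor k (Suc n)" for n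
    using c1[of n] c2[of n]
    by (simp add: fps_divide_unit inv_factor_def fps_inverse_mult del: power_Suc mult_Suc_right)
  have lim: "fps_eq_upto a (\<Prod>n. ?f n) (\<Prod>n<a. ?f n)"
    by (intro prodinf_fps_eq_upto one_mod_one_divide one_mod_mult one_mod_powi one_mod_factor rn) auto
  have split: "(\<Prod>n<a. ?f n) = inverse ?D * base_prod a k"
  proof -
    have "?D = (\<Prod>n<a. 1 - fps_X ^ (r * Suc n))"
      by (rule prod.reindex_bij_witness[where i = Suc and j = "\<lambda>j. j - 1"]) auto
    moreover have "inverse (\<Prod>n<a. 1 - fps_X ^ (r * Suc n)) = (\<Prod>n<a. inverse (1 - fps_X ^ (r * Suc n)) :: rat fps)"
      by (induction a) (simp_all add: fps_inverse_mult del: power_Suc mult_Suc_right)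
    ultimately show ?thesis unfolding f by (simp only: prod.distrib base_prod_def)
  qed
  have "fps_eq_upto a (inverse ?D) ?Q"
  proof -
    have "fps_nth ?D 0 = 1"
      using assms by (intro fps_prod_nth_0) auto
    then have "inverse ?D * (?D * ?Q) = ?Q" by (simp add: mult.assoc[symmetric] inverse_mult_eq_1)
    moreover have "fps_eq_upto a (inverse ?D * (?D * ?Q)) (inverse ?D * 1)"
      by (intro fps_eq_upto_mult fps_eq_upto_refl euler_power_gf assms)
    ultimately show ?thesis using fps_eq_upto_sym by (simp only: mult_1_right)
  qed
  then have "fps_eq_upto a (inverse ?D * base_prod a k) (?Q * base_prod a k)"
    by (intro fps_eq_upto_mult fps_eq_upto_refl)
  with lim show ?thesis unfolding split by (rule fps_eq_upto_trans)
qed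

lemma B_product:
  "fps_eq_upto a (\<Prod>n. 1 / (1 - fps_X ^ Suc n) powi k) (base_prod a k)"
  unfolding base_prod_def inv_factor_def
  by (intro prodinf_fps_eq_upto one_mod_one_divide one_mod_powi one_mod_factor) auto

lemma parts_power_nth:
  assumes "1 \<le> r" "n \<le> a"
  shows "fps_nth (\<Sum>f\<in>parts_upto a. fps_X ^ (r * part_size f)) n =
    (if r dvd n then of_nat (num_partitions (n div r)) else (0 :: rat))"
proof -
  let ?P = "\<Sum>f\<in>parts_upto a. fps_X ^ part_size f :: rat fps"
  have "?P oo fps_X ^ r = (\<Sum>f\<in>parts_upto a. fps_X ^ (r * part_size f))"
    by (simp add: fps_compose_sum_distrib fps_X_power_compose[OF assms(1)])
  then have "fps_nth (\<Sum>f\<in>parts_upto a. fps_X ^ (r * part_size f)) n = (if r dvd n then fps_nth ?P (n div r) else 0)"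
    using fps_compose_X_power_nth[OF assms(1), of ?P n] by simp
  moreover have "n div r \<le> a" using assms(2) div_le_dividend le_trans by blast
  then have "fps_nth ?P (n div r) = of_nat (num_partitions (n div r))"
    using partition_gf_upto[of a] by (simp add: fps_eq_upto_def partition_gf_def)
  ultimately show ?thesis by simp
qed

text \<open>The Cauchy product of the partition numbers, placed at multiples of r, with the hook
  formula for k - 1.\<close>

lemma A_nth_hooks:
  assumes "1 \<le> r" "n \<le> a"
  shows "fps_nth ((\<Sum>f\<in>parts_upto a. fps_X ^ (r * part_size f)) * base_prod a k) n =
    (\<Sum>m=0..n div r. of_nat (num_partitions m) *
       (\<Sum>\<mu>\<in>partitions_of (n - r * m). \<Prod>h\<in>#hook_lengths \<mu>. 1 + of_int (k - 1) / (of_nat h)\<^sup>2))"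
proof -
  let ?N = "\<lambda>n. \<Sum>\<mu>\<in>partitions_of n. \<Prod>h\<in>#hook_lengths \<mu>. 1 + of_int (k - 1) / (of_nat h)\<^sup>2 :: rat"
  have N: "fps_nth (base_prod a k) i = ?N i" if "i \<le> n" for i
    using nekrasov_okounkov[of i a "k - 1"] that assms(2) by (simp add: base_prod_eq)
  have "fps_nth ((\<Sum>f\<in>parts_upto a. fps_X ^ (r * part_size f)) * base_prod a k) n =
     (\<Sum>j=0..n. (if r dvd j then of_nat (num_partitions (j div r)) else 0) * ?N (n - j))"
    unfolding fps_mult_nth using assms by (intro sum.cong refl) (simp add: parts_power_nth N)
  also have "\<dots> = (\<Sum>m=0..n div r. of_nat (num_partitions m) * ?N (n - r * m))"
  proof (rule sum.mono_neutral_cong_right[THEN trans])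
    show "finite {0..n}" "{j\<in>{0..n}. r dvd j} \<subseteq> {0..n}" by auto
    show "\<forall>i\<in>{0..n} - {j\<in>{0..n}. r dvd j}. (if r dvd i then of_nat (num_partitions (i div r)) else 0) * ?N (n - i) = 0"
      by auto
    show "(\<Sum>j | j \<in> {0..n} \<and> r dvd j. of_nat (num_partitions (j div r)) * ?N (n - j)) =
      (\<Sum>m=0..n div r. of_nat (num_partitions m) * ?N (n - r * m))"
      using assms(1)
      by (intro sum.reindex_bij_witness[where i = "\<lambda>m. r * m" and j = "\<lambda>j. j div r"])
         (auto simp: div_le_mono less_eq_div_iff_mult_less_eq mult.commute)
  qed auto
  finally show ?thesis .
qed

theorem theorem1p2:
  fixes a r s :: nat and k :: int
  assumes "1 \<le> a" and "1 \<le> r" and "1 \<le> s"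
  shows
    "(\<exists>E\<in>big_O_q (a + 1).
        fls_X powi (- int (r * a * (a + 1) div 2)) * fps_to_fls (A_series a k r) =
        fps_to_fls ((\<Prod>n. 1 / ((1 - fps_X ^ (r * Suc n)) * (1 - fps_X ^ Suc n) powi k)) + E))
     \<and> (\<exists>E\<in>big_O_q (a + 1).
        fls_X powi (- int (a * (a + 1) * (r + 2 * a * r + 3 * s) div 6)) *
          fps_to_fls (B_series a k r s) =
        fps_to_fls ((\<Prod>n. 1 / (1 - fps_X ^ Suc n) powi k) + E))
     \<and> (\<forall>n\<le>a.
        c_coeff a k r (n + r * a * (a + 1) div 2) =
        (\<Sum>m=0..n div r. of_nat (num_partitions m) *
           (\<Sum>\<mu>\<in>partitions_of (n - r * m).
              \<Prod>h\<in>#hook_lengths \<mu>. 1 + of_int (k - 1) / (of_nat h)\<^sup>2)))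
     \<and> (\<forall>n\<le>a.
        c_coeff a k 1 (n + a * (a + 1) div 2) =
          d_coeff a (k + 1) r s (n + a * (a + 1) * (r + 2 * a * r + 3 * s) div 6)
        \<and> d_coeff a (k + 1) r s (n + a * (a + 1) * (r + 2 * a * r + 3 * s) div 6) =
          (\<Sum>\<mu>\<in>partitions_of n. \<Prod>h\<in>#hook_lengths \<mu>. 1 + of_int k / (of_nat h)\<^sup>2))"
proof (intro conjI allI impI)
  show "\<exists>E\<in>big_O_q (a + 1).
        fls_X powi (- int (r * a * (a + 1) div 2)) * fps_to_fls (A_series a k r) =
        fps_to_fls ((\<Prod>n. 1 / ((1 - fps_X ^ (r * Suc n)) * (1 - fps_X ^ Suc n) powi k)) + E)"
    unfolding A_leading_exponent
    using A_series_nth[OF assms(2), where a = a and k = k] A_product[OF assms(2), of a k]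
    by (intro shifted_series) (auto simp: fps_eq_upto_def)
  show "\<exists>E\<in>big_O_q (a + 1).
        fls_X powi (- int (a * (a + 1) * (r + 2 * a * r + 3 * s) div 6)) *
          fps_to_fls (B_series a k r s) =
        fps_to_fls ((\<Prod>n. 1 / (1 - fps_X ^ Suc n) powi k) + E)"
    unfolding B_leading_exponent
    using B_series_nth[OF assms(2,3), where a = a and k = k] B_product[of a k]
    by (intro shifted_series) (auto simp: fps_eq_upto_def)
next
  fix n assume n: "n \<le> a"
  show "c_coeff a k r (n + r * a * (a + 1) div 2) =
        (\<Sum>m=0..n div r. of_nat (num_partitions m) *
           (\<Sum>\<mu>\<in>partitions_of (n - r * m).
              \<Prod>h\<in>#hook_lengths \<mu>. 1 + of_int (k - 1) / (of_nat h)\<^sup>2))"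
    unfolding c_coeff_def A_leading_exponent add.commute[of n]
    by (simp only: A_series_nth(2)[OF assms(2) n] A_nth_hooks[OF assms(2) n])
next
  fix n assume n: "n \<le> a"
  let ?N = "\<Sum>\<mu>\<in>partitions_of n. \<Prod>h\<in>#hook_lengths \<mu>. 1 + of_int k / (of_nat h)\<^sup>2 :: rat"
  have d: "d_coeff a (k + 1) r s (n + a * (a + 1) * (r + 2 * a * r + 3 * s) div 6) = ?N"
    unfolding d_coeff_def B_leading_exponent add.commute[of n]
    using B_series_nth(2)[OF assms(2,3) n, of "k + 1"] nekrasov_okounkov[OF n, of k]
    by (simp only: base_prod_eq)
  \<comment> \<open>For r = 1 the sum over partitions is the inverse of one Euler product up to
    degree a, which raises the exponent from k to k + 1. Hence c with k matches d with k +
    1.\<close>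
  have c: "c_coeff a k 1 (n + a * (a + 1) div 2) = ?N"
  proof -
    let ?\<Phi> = "euler_prod a" and ?Q = "\<Sum>f\<in>parts_upto a. fps_X ^ part_size f :: rat fps"
    have "c_coeff a k 1 (n + a * (a + 1) div 2) = fps_nth (?Q * fps_rat_pow ?\<Phi> (- of_int k)) n"
      using A_series_nth(2)[of 1 n a k] n A_leading_exponent[of 1 a]
      by (simp add: c_coeff_def base_prod_eq add.commute)
    also have "?Q * fps_rat_pow ?\<Phi> (- of_int k) = fps_rat_pow ?\<Phi> (- of_int (k + 1)) * (?\<Phi> * ?Q)"
      using fps_rat_pow_add[OF euler_prod_nth_0, of a "- of_int (k + 1)" 1]
      by (simp add: fps_rat_pow_1[OF euler_prod_nth_0] mult_ac)
    also have "fps_nth \<dots> n = fps_nth (fps_rat_pow ?\<Phi> (- of_int (k + 1)) * 1) n"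
    proof -
      have "fps_eq_upto a (?\<Phi> * ?Q) 1" using euler_power_gf[of 1 a] by (simp add: euler_prod_def)
      from fps_eq_upto_mult[OF fps_eq_upto_refl this] n show ?thesis unfolding fps_eq_upto_def by blast
    qed
    finally show ?thesis using nekrasov_okounkov[OF n, of k] by simp
  qed
  show "c_coeff a k 1 (n + a * (a + 1) div 2) =
          d_coeff a (k + 1) r s (n + a * (a + 1) * (r + 2 * a * r + 3 * s) div 6)"
    unfolding c d ..
  show "d_coeff a (k + 1) r s (n + a * (a + 1) * (r + 2 * a * r + 3 * s) div 6) = ?N" by (rule d)
qed

end
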